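(* Let $k$ be a field, let $P$ be a poset all of whose closed intervals are finite, and let $\sim$ be an equivalence relation on $\mathrm{Int}(P)$ such that $(P,\sim)$ satisfies the order-compatibility, invariance, finiteness and concatenation axioms. Let $A=k[P]_{\mathrm{red}}=A_0\oplus I$. Then the associated graded ring $R=\mathrm{gr}_IA$ is quadratic if and only if every open interval $(x,y)$ in $P$ has order complex $\Delta(x,y)$ that is sequential-gallery-connected (SGC).
   Context: **Posets and axioms.** For $x\le y$ in $P$ put $[x,y]=\{z: x\le z\le y\}$ and $(x,y)=\{z: x<z<y\}$; $\mathrm{Int}(P)$ is the set of all closed intervals $[x,y]$. The class of $[x,y]$ under $\sim$ is $\widetilde{[x,y]}$. For elements, $x\sim y$ means $[x,x]\sim[y,y]$; $P/\!\sim$ is the set of classes $\tilde x$, identified with $\widetilde{[x,x]}$. The axioms are: 1. (order-compatibility) If $[x,y]\sim[x',y']$ and $[y,z]\sim[y',z']$, then $[x,z]\sim[x',z']$. 2. (invariance) Let $\mathrm{int}_{[x,y]}:[x,y]\to(\mathrm{Int}(P)/\!\sim)\times(\mathrm{Int}(P)/\!\sim)$ be $z\mapsto(\widetilde{[x,z]},\widetilde{[z,y]})$. Whenever $[x,y]\sim[x',y']$, (a) there exists a map $\tau:[x,y]\to[x',y']$ with $\mathrm{int}_{[x',y']}\circ\tau=\mathrm{int}_{[x,y]}$, and (b) such a map $\tau$ is unique. 3. (finiteness) $P/\!\sim$ is finite. 4. (concatenation) If $x\le y_1$ and $y_2\le z$ in $P$ with $y_1\sim y_2$, then there exist $x'\le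 y'\le z'$ in $P$ with $[x',y']\sim[x,y_1]$ and $[y',z']\sim[y_2,z]$. **Reduced incidence algebra.** $A=k[P]_{\mathrm{red}}$ is the $k$-vector space with basis $\{\xi_\alpha\}$ indexed by $\alpha\in\mathrm{Int}(P)/\!\sim$, with $k$-bilinear multiplication: $\xi_\alpha\xi_\beta=\xi_\gamma$ if there exist $x\le y\le z$ in $P$ with $\widetilde{[x,y]}=\alpha$, $\widetilde{[y,z]}=\beta$, $\widetilde{[x,z]}=\gamma$, and $\xi_\alpha\xi_\beta=0$ if no such $x\le y\le z$ exist. Decompose $A=A_0\oplus I$, where $A_0$ is the $k$-span of the $\xi_{\widetilde{[x,x]}}$ (a semisimple subring) and $I$ is the two-sided ideal spanned by the $\xi_{\widetilde{[x,y]}}$ with $x<y$. $\mathrm{gr}_IA=\bigoplus_{d\ge0}I^d/I^{d+1}$ with $I^0=A$. **Quadratic rings.** For an $\mathbb N$-graded ring $R=\bigoplus_{d\ge0}R_d$ let $T_{R_0}(R_1)=\bigoplus_{d\ge0}R_1^{\otimes_{R_0}d}$ be the tensor algebra and $\pi:T_{R_0}(R_1)\to R$ the multiplication map $r_1\otimes\cdots\otimes r_d\mapsto r_1\cdots r_d$. $R$ is quadratic if (a) $\pi$ is surjective, and (b) $\ker\pi$ is generated as a two-sided ideal by $\ker\pi\cap(R_1\otimes_{R_0}R_1)$. **SGC complexes.** The order complex of a poset is the simplicial complex of its finite chains, including the empty chain (of dimension $-1$); by convention $\Delta(x,x)$ is void. For faces $F,G$ of a simplicial complex with $\dim F\le\dim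 G$, a sequential gallery connecting $F$ to $G$ (written $F\to G$) is a sequence of faces $F=F_0,F_1,\dots,F_t=G$ such that for each $i$ either $\dim F_{i-1}=\dim F_i=1+\dim(F_{i-1}\cap F_i)$, or $F_{i-1}\subset F_i$ and $\dim F_i=\dim F_{i-1}+1$. A complex is sequential-gallery-connected (SGC) if every pair of faces has a sequential gallery connecting them (from the one of smaller or equal dimension to the other). *)

theory Defs
  imports "HOL-Algebra.Algebra"
begin

section \<open>Closed intervals and equivalence relations on them\<close>

text \<open>
  A poset is a subset \<open>P\<close> of a partially ordered type with the induced order (so the empty poset
  is allowed).  The closed interval \<open>[x,y]\<close>, as a member of \<open>Int(P)\<close>, is encoded by the pair of its
  end points, which it determines.  An equivalence relation on \<open>Int(P)\<close> is a relation \<open>r\<close> with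
  \<open>equiv (intervals P) r\<close>; the class of \<open>[x,y]\<close> is \<open>r `` {(x, y)}\<close>.
\<close>

definition intervals :: "'p::order set \<Rightarrow> ('p \<times> 'p) set" where
  "intervals P = {(x, y). x \<in> P \<and> y \<in> P \<and> x \<le> y}"

definition closed_interval :: "'p::order set \<Rightarrow> 'p \<Rightarrow> 'p \<Rightarrow> 'p set" where
  "closed_interval P x y = {z \<in> P. x \<le> z \<and> z \<le> y}"

definition open_interval :: "'p::order set \<Rightarrow> 'p \<Rightarrow> 'p \<Rightarrow> 'p set" where
  "open_interval P x y = {z \<in> P. x < z \<and> z < y}"

definition interval_finite :: "'p::order set \<Rightarrow> bool" where
  "interval_finite P \<longleftrightarrow> (\<forall>(x, y) \<in> intervals P. finite (closed_interval P x y))"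

definition order_compatible :: "(('p \<times> 'p) \<times> ('p \<times> 'p)) set \<Rightarrow> bool" where
  "order_compatible r \<longleftrightarrow>
     (\<forall>x y z x' y' z'. ((x, y), (x', y')) \<in> r \<and> ((y, z), (y', z')) \<in> r
        \<longrightarrow> ((x, z), (x', z')) \<in> r)"

definition interval_types ::
    "(('p \<times> 'p) \<times> ('p \<times> 'p)) set \<Rightarrow> 'p \<Rightarrow> 'p \<Rightarrow> 'p \<Rightarrow> ('p \<times> 'p) set \<times> ('p \<times> 'p) set" where
  "interval_types r x y z = (r `` {(x, z)}, r `` {(z, y)})"

definition interval_invariant ::
    "'p::order set \<Rightarrow> (('p \<times> 'p) \<times> ('p \<times> 'p)) set \<Rightarrow> bool" where
  "interval_invariant P r \<longleftrightarrow>
     (\<forall>x y x' y'. ((x, y), (x', y')) \<in> r \<longrightarrow>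
        (\<exists>!\<tau>. \<tau> \<in> closed_interval P x y \<rightarrow>\<^sub>E closed_interval P x' y' \<and>
             (\<forall>z \<in> closed_interval P x y. interval_types r x' y' (\<tau> z) = interval_types r x y z)))"

text \<open>
  The finiteness axiom is about \<open>P/\<sim>\<close>, the set of classes of the one-point intervals.
\<close>

definition point_classes ::
    "'p::order set \<Rightarrow> (('p \<times> 'p) \<times> ('p \<times> 'p)) set \<Rightarrow> ('p \<times> 'p) set set" where
  "point_classes P r = {r `` {(x, x)} | x. x \<in> P}"

definition concatenation_closed ::
    "'p::order set \<Rightarrow> (('p \<times> 'p) \<times> ('p \<times> 'p)) set \<Rightarrow> bool" where
  "concatenation_closed P r \<longleftrightarrow>
     (\<forall>x y\<^sub>1 y\<^sub>2 z. (x, y\<^sub>1) \<in> intervals P \<and> (y\<^sub>2, z) \<in> intervals P \<and> ((y\<^sub>1, y\<^sub>1), (y\<^sub>2, y\<^sub>2)) \<in> r \<longrightarrow>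
        (\<exists>x' y' z'. (x', y') \<in> intervals P \<and> (y', z') \<in> intervals P \<and>
           ((x', y'), (x, y\<^sub>1)) \<in> r \<and> ((y', z'), (y\<^sub>2, z)) \<in> r))"


section \<open>The reduced incidence algebra\<close>

text \<open>
  The element \<open>\<Sum>\<alpha>. f \<alpha> \<xi>\<^sub>\<alpha>\<close> is the finitely supported coefficient function \<open>f\<close>.
  \<open>composable P r \<alpha> \<beta> \<gamma>\<close> says that \<open>\<xi>\<^sub>\<alpha> \<xi>\<^sub>\<beta> = \<xi>\<^sub>\<gamma>\<close>; order-compatibility makes \<open>\<gamma>\<close> unique.  The
  multiplicative identity is the sum of the \<open>\<xi>\<^sub>\<alpha>\<close> over the finitely many point classes \<open>\<alpha>\<close>.
\<close>

definition composable ::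
    "'p::order set \<Rightarrow> (('p \<times> 'p) \<times> ('p \<times> 'p)) set \<Rightarrow>
     ('p \<times> 'p) set \<Rightarrow> ('p \<times> 'p) set \<Rightarrow> ('p \<times> 'p) set \<Rightarrow> bool" where
  "composable P r \<alpha> \<beta> \<gamma> \<longleftrightarrow>
     (\<exists>x y z. (x, y) \<in> intervals P \<and> (y, z) \<in> intervals P \<and>
        r `` {(x, y)} = \<alpha> \<and> r `` {(y, z)} = \<beta> \<and> r `` {(x, z)} = \<gamma>)"

definition reduced_incidence_algebra ::
    "'p::order set \<Rightarrow> (('p \<times> 'p) \<times> ('p \<times> 'p)) set \<Rightarrow> (('p \<times> 'p) set \<Rightarrow> 'k::field) ring" where
  "reduced_incidence_algebra P r =
     \<lparr>carrier = {f. finite {\<alpha>. f \<alpha> \<noteq> 0} \<and> {\<alpha>. f \<alpha> \<noteq> 0} \<subseteq> intervals P // r},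
      monoid.mult = (\<lambda>f g \<gamma>. \<Sum>\<alpha> | f \<alpha> \<noteq> 0. \<Sum>\<beta> | g \<beta> \<noteq> 0.
                 if composable P r \<alpha> \<beta> \<gamma> then f \<alpha> * g \<beta> else 0),
      one = (\<lambda>\<alpha>. if \<alpha> \<in> point_classes P r then 1 else 0),
      ring.zero = (\<lambda>\<alpha>. 0),
      add = (\<lambda>f g \<alpha>. f \<alpha> + g \<alpha>)\<rparr>"

text \<open>The ideal \<open>I\<close>: the span of the \<open>\<xi>\<^sub>\<alpha>\<close> with \<open>\<alpha>\<close> the class of some \<open>[x,y]\<close>, \<open>x < y\<close>.\<close>

definition incidence_ideal ::
    "'p::order set \<Rightarrow> (('p \<times> 'p) \<times> ('p \<times> 'p)) set \<Rightarrow> (('p \<times> 'p) set \<Rightarrow> 'k::field) set" where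
  "incidence_ideal P r =
     {f \<in> carrier (reduced_incidence_algebra P r).
        \<forall>\<alpha>. f \<alpha> \<noteq> 0 \<longrightarrow> (\<exists>(x, y) \<in> intervals P. x < y \<and> \<alpha> = r `` {(x, y)})}"


section \<open>Graded rings given by their homogeneous pieces\<close>

text \<open>
  The ring \<open>\<Oplus>d. H d\<close> assembled from abelian groups \<open>H d\<close> (in multiplicative notation), products
  \<open>m i j\<close> from \<open>H i \<times> H j\<close> to \<open>H (i + j)\<close>, and a unit element \<open>u\<close> in degree \<open>0\<close>.
\<close>

definition direct_sum_ring ::
    "(nat \<Rightarrow> 'g monoid) \<Rightarrow> (nat \<Rightarrow> nat \<Rightarrow> 'g \<Rightarrow> 'g \<Rightarrow> 'g) \<Rightarrow> 'g \<Rightarrow> (nat \<Rightarrow> 'g) ring" where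
  "direct_sum_ring H m u =
     \<lparr>carrier = carrier (sum_group UNIV H),
      monoid.mult = (\<lambda>x y d. \<Otimes>\<^bsub>H d\<^esub>i\<in>{..d}. m i (d - i) (x i) (y (d - i))),
      one = (\<lambda>d. if d = 0 then u else \<one>\<^bsub>H d\<^esub>),
      ring.zero = \<one>\<^bsub>sum_group UNIV H\<^esub>,
      add = monoid.mult (sum_group UNIV H)\<rparr>"

definition homogeneous :: "(nat \<Rightarrow> 'g monoid) \<Rightarrow> nat \<Rightarrow> (nat \<Rightarrow> 'g) set" where
  "homogeneous H d = {x \<in> carrier (sum_group UNIV H). \<forall>e. e \<noteq> d \<longrightarrow> x e = \<one>\<^bsub>H e\<^esub>}"


section \<open>The associated graded ring of an ideal\<close>

primrec ideal_power :: "('a, 'm) ring_scheme \<Rightarrow> 'a set \<Rightarrow> nat \<Rightarrow> 'a set" where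
  "ideal_power A I 0 = carrier A"
| "ideal_power A I (Suc d) = ideal_prod A (ideal_power A I d) I"

definition gr_piece :: "'a ring \<Rightarrow> 'a set \<Rightarrow> nat \<Rightarrow> 'a set monoid" where
  "gr_piece A I d = (add_monoid A)\<lparr>carrier := ideal_power A I d\<rparr> Mod ideal_power A I (Suc d)"

definition assoc_graded_ring :: "'a ring \<Rightarrow> 'a set \<Rightarrow> (nat \<Rightarrow> 'a set) ring" where
  "assoc_graded_ring A I =
     direct_sum_ring (gr_piece A I)
       (\<lambda>i j. rcoset_mult A (ideal_power A I (Suc (i + j))))
       (ideal_power A I 1 +>\<^bsub>A\<^esub> \<one>\<^bsub>A\<^esub>)"

definition assoc_graded_component :: "'a ring \<Rightarrow> 'a set \<Rightarrow> nat \<Rightarrow> (nat \<Rightarrow> 'a set) set" where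
  "assoc_graded_component A I = homogeneous (gr_piece A I)"


section \<open>Tensor algebras and quadratic rings\<close>

text \<open>
  \<open>R\<close> is a ring with grading \<open>G\<close>, so \<open>R\<^sub>0 = G 0\<close> and \<open>R\<^sub>1 = G 1\<close>.  The pure tensor
  \<open>s \<otimes> m\<^sub>1 \<otimes> \<dots> \<otimes> m\<^sub>d\<close> in \<open>R\<^sub>0 \<otimes> R\<^sub>1 \<otimes> \<dots> \<otimes> R\<^sub>1\<close> (tensor products over \<open>R\<^sub>0\<close>) is represented by the
  pair \<open>(s, [m\<^sub>1, \<dots>, m\<^sub>d])\<close>.  Through \<open>R\<^sub>0 \<otimes> M = M\<close> this bimodule is the \<open>d\<close>-fold tensor power
  of \<open>R\<^sub>1\<close>; the leading factor is there to make the case \<open>d = 0\<close>, where the tensor power is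
  \<open>R\<^sub>0\<close>, uniform with the others.
\<close>

type_synonym 'a tensor_word = "'a \<times> 'a list"

definition tensor_words :: "(nat \<Rightarrow> 'a set) \<Rightarrow> nat \<Rightarrow> 'a tensor_word set" where
  "tensor_words G d = {(s, ms). s \<in> G 0 \<and> set ms \<subseteq> G 1 \<and> length ms = d}"

text \<open>
  Additivity in the leading factor and in every other factor, and \<open>R\<^sub>0\<close>-balancedness at every
  tensor sign.
\<close>

inductive_set tensor_relators ::
    "'a ring \<Rightarrow> (nat \<Rightarrow> 'a set) \<Rightarrow> nat \<Rightarrow> ('a tensor_word \<Rightarrow>\<^sub>0 int) set"
  for R :: "'a ring" and G :: "nat \<Rightarrow> 'a set" and d :: nat where
  add_head:
    "\<lbrakk>(s, ms) \<in> tensor_words G d; (s', ms) \<in> tensor_words G d\<rbrakk> \<Longrightarrow>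
     frag_of (s \<oplus>\<^bsub>R\<^esub> s', ms) - frag_of (s, ms) - frag_of (s', ms) \<in> tensor_relators R G d"
| add_factor:
    "\<lbrakk>(s, us @ m # vs) \<in> tensor_words G d; (s, us @ m' # vs) \<in> tensor_words G d\<rbrakk> \<Longrightarrow>
     frag_of (s, us @ (m \<oplus>\<^bsub>R\<^esub> m') # vs) - frag_of (s, us @ m # vs) - frag_of (s, us @ m' # vs)
       \<in> tensor_relators R G d"
| balanced_head:
    "\<lbrakk>(s, m # vs) \<in> tensor_words G d; t \<in> G 0\<rbrakk> \<Longrightarrow>
     frag_of (s \<otimes>\<^bsub>R\<^esub> t, m # vs) - frag_of (s, (t \<otimes>\<^bsub>R\<^esub> m) # vs) \<in> tensor_relators R G d"
| balanced_factor:
    "\<lbrakk>(s, us @ m # n # vs) \<in> tensor_words G d; t \<in> G 0\<rbrakk> \<Longrightarrow>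
     frag_of (s, us @ (m \<otimes>\<^bsub>R\<^esub> t) # n # vs) - frag_of (s, us @ m # (t \<otimes>\<^bsub>R\<^esub> n) # vs)
       \<in> tensor_relators R G d"

definition tensor_relations ::
    "'a ring \<Rightarrow> (nat \<Rightarrow> 'a set) \<Rightarrow> nat \<Rightarrow> ('a tensor_word \<Rightarrow>\<^sub>0 int) set" where
  "tensor_relations R G d =
     generate (free_Abelian_group (tensor_words G d)) (tensor_relators R G d)"

definition tensor_power ::
    "'a ring \<Rightarrow> (nat \<Rightarrow> 'a set) \<Rightarrow> nat \<Rightarrow> ('a tensor_word \<Rightarrow>\<^sub>0 int) set monoid" where
  "tensor_power R G d = free_Abelian_group (tensor_words G d) Mod tensor_relations R G d"

text \<open>
  Concatenation of pure tensors; the leading factor of the second one is absorbed by the factor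
  to its left.
\<close>

fun word_mult :: "'a ring \<Rightarrow> 'a tensor_word \<Rightarrow> 'a tensor_word \<Rightarrow> 'a tensor_word" where
  "word_mult R (s, ms) (t, ns) =
     (if ms = [] then (s \<otimes>\<^bsub>R\<^esub> t, ns)
      else (s, butlast ms @ (last ms \<otimes>\<^bsub>R\<^esub> t) # ns))"

definition frag_mult ::
    "'a ring \<Rightarrow> ('a tensor_word \<Rightarrow>\<^sub>0 int) \<Rightarrow> ('a tensor_word \<Rightarrow>\<^sub>0 int) \<Rightarrow> ('a tensor_word \<Rightarrow>\<^sub>0 int)" where
  "frag_mult R a b = frag_extend (\<lambda>v. frag_extend (\<lambda>w. frag_of (word_mult R v w)) b) a"

definition tensor_mult ::
    "'a ring \<Rightarrow> (nat \<Rightarrow> 'a set) \<Rightarrow> nat \<Rightarrow> nat \<Rightarrow>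
     ('a tensor_word \<Rightarrow>\<^sub>0 int) set \<Rightarrow> ('a tensor_word \<Rightarrow>\<^sub>0 int) set \<Rightarrow> ('a tensor_word \<Rightarrow>\<^sub>0 int) set" where
  "tensor_mult R G i j U V =
     (\<Union>a\<in>U. \<Union>b\<in>V. tensor_relations R G (i + j)
        #>\<^bsub>free_Abelian_group (tensor_words G (i + j))\<^esub> frag_mult R a b)"

definition tensor_algebra ::
    "'a ring \<Rightarrow> (nat \<Rightarrow> 'a set) \<Rightarrow> (nat \<Rightarrow> ('a tensor_word \<Rightarrow>\<^sub>0 int) set) ring" where
  "tensor_algebra R G =
     direct_sum_ring (tensor_power R G) (tensor_mult R G)
       (tensor_relations R G 0 #>\<^bsub>free_Abelian_group (tensor_words G 0)\<^esub> frag_of (\<one>\<^bsub>R\<^esub>, []))"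

definition tensor_component ::
    "'a ring \<Rightarrow> (nat \<Rightarrow> 'a set) \<Rightarrow> nat \<Rightarrow> (nat \<Rightarrow> ('a tensor_word \<Rightarrow>\<^sub>0 int) set) set" where
  "tensor_component R G = homogeneous (tensor_power R G)"

definition frag_eval :: "'a ring \<Rightarrow> ('a tensor_word \<Rightarrow>\<^sub>0 int) \<Rightarrow> 'a" where
  "frag_eval R a =
     (\<Oplus>\<^bsub>R\<^esub>w\<in>Poly_Mapping.keys a.
        add_pow R (Poly_Mapping.lookup a w) (foldl (monoid.mult R) (fst w) (snd w)))"

text \<open>
  The multiplication map \<open>\<pi>\<close>; \<^const>\<open>frag_eval\<close> is constant on each coset making up a tensor power.
\<close>

definition multiplication_map ::
    "'a ring \<Rightarrow> (nat \<Rightarrow> 'a set) \<Rightarrow> (nat \<Rightarrow> ('a tensor_word \<Rightarrow>\<^sub>0 int) set) \<Rightarrow> 'a" where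
  "multiplication_map R G x =
     (\<Oplus>\<^bsub>R\<^esub>d\<in>{d. x d \<noteq> \<one>\<^bsub>tensor_power R G d\<^esub>}. the_elem (frag_eval R ` x d))"

definition quadratic_ring :: "'a ring \<Rightarrow> (nat \<Rightarrow> 'a set) \<Rightarrow> bool" where
  "quadratic_ring R G \<longleftrightarrow>
     (let T = tensor_algebra R G; \<pi> = multiplication_map R G in
        \<pi> ` carrier T = carrier R \<and>
        a_kernel T R \<pi> = Idl\<^bsub>T\<^esub> (a_kernel T R \<pi> \<inter> tensor_component R G 2))"


section \<open>Sequential-gallery-connected complexes\<close>

definition order_complex :: "'p::order set \<Rightarrow> 'p set set" where
  "order_complex Q = {F. F \<subseteq> Q \<and> finite F \<and> (\<forall>a\<in>F. \<forall>b\<in>F. a \<le> b \<or> b \<le> a)}"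

text \<open>
  \<open>\<Delta>(x,x)\<close> is void (without faces), which differs from the order complex of the empty
  set, whose only face is the empty chain.
\<close>

definition interval_complex :: "'p::order set \<Rightarrow> 'p \<Rightarrow> 'p \<Rightarrow> 'p set set" where
  "interval_complex P x y = (if x = y then {} else order_complex (open_interval P x y))"

definition face_dim :: "'v set \<Rightarrow> int" where
  "face_dim F = int (card F) - 1"

definition gallery_step :: "'v set \<Rightarrow> 'v set \<Rightarrow> bool" where
  "gallery_step F F' \<longleftrightarrow>
     (face_dim F = face_dim F' \<and> face_dim F' = 1 + face_dim (F \<inter> F')) \<or>
     (F \<subset> F' \<and> face_dim F' = face_dim F + 1)"

definition sequential_gallery :: "'v set set \<Rightarrow> 'v set \<Rightarrow> 'v set \<Rightarrow> bool" where
  "sequential_gallery K F F' \<longleftrightarrow>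
     (\<exists>Fs. Fs \<noteq> [] \<and> hd Fs = F \<and> last Fs = F' \<and> set Fs \<subseteq> K \<and> successively gallery_step Fs)"

definition SGC :: "'v set set \<Rightarrow> bool" where
  "SGC K \<longleftrightarrow> (\<forall>F\<in>K. \<forall>F'\<in>K. face_dim F \<le> face_dim F' \<longrightarrow> sequential_gallery K F F')"

end

theory Submission
  imports Defs
begin

text \<open>
  The classes of intervals are the morphisms of a finite-object category in which an interval
  \<open>[x,y]\<close> is the composite of \<open>[x,z]\<close> and \<open>[z,y]\<close>: the axioms make composition total on matching end
  points and identify the factorisations of the class of \<open>[x,y]\<close> with the points of \<open>[x,y]\<close>.  The
  reduced incidence algebra is the category algebra, \<open>I\<^sup>d\<close> is spanned by the classes of length at
  least \<open>d\<close> (length being the largest size of a chain), and in the graded ring a product of two basis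
  elements survives exactly when lengths add up.  The tensor algebra is the path algebra on the
  classes of length 1, whose paths with value \<open>[x,y]\<close> are the saturated chains from \<open>x\<close> to \<open>y\<close>.  The
  kernel of the multiplication map is spanned by the saturated chains that are shorter than the
  interval and by the differences of two chains of maximal length, while its part of degree 2 lets one
  replace one interior vertex of a chain, and kills a chain which has two consecutive steps spanning an
  interval of length greater than 2.  So quadraticity says: any two longest chains are linked by such
  replacements, and any shorter saturated chain is linked to one that is killed, that is, to one which
  can be enlarged after one more replacement.  This is what sequential galleries do.
\<close>

section \<open>Convolution rings\<close>

text \<open>Both rings are replaced by functions on a basis. For the tensor algebra this is the main
  obstacle: a tensor power is a quotient of a free abelian group with integer coefficients, and one
  has to know that a formal sum all of whose coefficients along paths vanish is already a
  consequence of the relators (\<open>K_iff\<close>). After that the multiplication map is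
  \<open>push\<close>, and quadraticity becomes \<open>locally_linked\<close>, a condition that
  mentions no field. That a kernel element lies outside the ideal generated in degree 2 needs a
  witness. It is the sum of coefficients over one class of linked paths without a degenerate member:
  the functions on which all these sums vanish form a two-sided ideal. SGC compares faces of all
  dimensions, while paths only see saturated chains, and a gallery never lowers the dimension, so a
  face cannot be left upwards and re-entered from above. What saves the argument is that
  replacements among faces of one fixed cardinality are reversible and that every gallery can be
  truncated to them.\<close>

definition fsupp :: "'b set \<Rightarrow> ('b \<Rightarrow> 'k::field) set" where
  "fsupp B = {f. finite {b. f b \<noteq> 0} \<and> {b. f b \<noteq> 0} \<subseteq> B}"

lemma fsupp_0: "(\<lambda>_. 0) \<in> fsupp B"
  by (simp add: fsupp_def)

lemma fsupp_add: "f \<in> fsupp B \<Longrightarrow> g \<in> fsupp B \<Longrightarrow> (\<lambda>b. f b + g b) \<in> fsupp B"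
proof -
  assume fg: "f \<in> fsupp B" "g \<in> fsupp B"
  have "{b. f b + g b \<noteq> 0} \<subseteq> {b. f b \<noteq> 0} \<union> {b. g b \<noteq> 0}" by auto
  with fg show ?thesis unfolding fsupp_def by (blast intro: finite_subset)
qed

lemma fsupp_uminus: "f \<in> fsupp B \<Longrightarrow> (\<lambda>b. - f b) \<in> fsupp B"
  by (auto simp: fsupp_def)

lemma fsupp_diff: "f \<in> fsupp B \<Longrightarrow> g \<in> fsupp B \<Longrightarrow> (\<lambda>b. f b - g b) \<in> fsupp B"
  using fsupp_add[OF _ fsupp_uminus] by fastforce

lemma fsupp_sum: "(\<And>i. i \<in> I \<Longrightarrow> f i \<in> fsupp B) \<Longrightarrow> (\<lambda>b. \<Sum>i\<in>I. f i b) \<in> fsupp B"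
  by (induction I rule: infinite_finite_induct) (auto simp: fsupp_0 fsupp_add)

lemma fsupp_restrict: "f \<in> fsupp B \<Longrightarrow> (\<lambda>b. if Q b then f b else 0) \<in> fsupp B"
  by (auto simp: fsupp_def intro: finite_subset[of _ "{b. f b \<noteq> 0}"])

definition single :: "'b \<Rightarrow> 'k::field \<Rightarrow> 'b \<Rightarrow> 'k" where
  "single b c = (\<lambda>x. if x = b then c else 0)"

lemma single_apply: "single b c x = (if x = b then c else 0)"
  by (simp add: single_def)

lemma fsupp_single: "b \<in> B \<Longrightarrow> single b c \<in> fsupp B"
  by (auto simp: fsupp_def single_def)

lemma fsupp_outside: "f \<in> fsupp B \<Longrightarrow> b \<notin> B \<Longrightarrow> f b = 0"
  by (auto simp: fsupp_def)

text \<open>The step also records that \<open>b\<close> and the support of \<open>g\<close> stay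
  inside the support of \<open>f\<close>. This carries homogeneity or a lower bound on lengths
  through the induction.\<close>

lemma fsupp_induct [consumes 1, case_names zero add]:
  assumes "f \<in> fsupp B" and "Q (\<lambda>_. 0)"
    and step: "\<And>b c g. b \<in> B \<Longrightarrow> c \<noteq> 0 \<Longrightarrow> f b \<noteq> 0 \<Longrightarrow> g \<in> fsupp B \<Longrightarrow> {x. g x \<noteq> 0} \<subseteq> {x. f x \<noteq> 0} \<Longrightarrow>
      Q g \<Longrightarrow> Q (\<lambda>x. single b c x + g x)"
  shows "Q f"
proof -
  have "Q g" if "finite Z" "g \<in> fsupp B" "{x. g x \<noteq> 0} = Z" "Z \<subseteq> {x. f x \<noteq> 0}" for Z g
    using that
  proof (induction Z arbitrary: g rule: finite_induct)
    case empty
    then have "g = (\<lambda>_. 0)" by auto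
    then show ?case using assms(2) by simp
  next
    case (insert b Z)
    define h where "h = (\<lambda>x. if x \<noteq> b then g x else 0)"
    have h: "h \<in> fsupp B" unfolding h_def using fsupp_restrict[OF insert.prems(1)] .
    have hX: "{x. h x \<noteq> 0} = Z" using insert unfolding h_def by auto
    have "Q (\<lambda>x. single b (g b) x + h x)"
      using insert.prems by (intro step insert.IH h hX) (auto simp: hX fsupp_def)
    moreover have "(\<lambda>x. single b (g b) x + h x) = g" by (auto simp: single_def h_def)
    ultimately show ?case by simp
  qed
  then show ?thesis using assms(1) by (auto simp: fsupp_def)
qed

text \<open>Finiteness of the set of factorisations makes the convolution a finite sum at every
  point, whatever the supports of the two functions are.\<close>

locale partial_semigroup =
  fixes B :: "'b set" and ok :: "'b \<Rightarrow> 'b \<Rightarrow> bool" and opr :: "'b \<Rightarrow> 'b \<Rightarrow> 'b"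
  assumes opr_closed: "x \<in> B \<Longrightarrow> y \<in> B \<Longrightarrow> ok x y \<Longrightarrow> opr x y \<in> B"
    and finite_splits: "finite {(x, y). x \<in> B \<and> y \<in> B \<and> ok x y \<and> opr x y = b}"
begin

definition splits :: "'b \<Rightarrow> ('b \<times> 'b) set" where
  "splits b = {(x, y). x \<in> B \<and> y \<in> B \<and> ok x y \<and> opr x y = b}"

lemma finite_splits' [simp]: "finite (splits b)"
  using finite_splits[of b] by (simp add: splits_def)

definition conv :: "('b \<Rightarrow> 'k::field) \<Rightarrow> ('b \<Rightarrow> 'k) \<Rightarrow> 'b \<Rightarrow> 'k" where
  "conv f g b = (\<Sum>(x, y)\<in>splits b. f x * g y)"

lemma conv_fsupp:
  assumes "f \<in> fsupp B" "g \<in> fsupp B"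
  shows "conv f g \<in> fsupp B"
proof -
  have "{b. conv f g b \<noteq> 0} \<subseteq> (\<lambda>(x, y). opr x y) ` ({b. f b \<noteq> 0} \<times> {b. g b \<noteq> 0}) \<inter> B"
  proof
    fix b assume "b \<in> {b. conv f g b \<noteq> 0}"
    then obtain p where "p \<in> splits b" "(case p of (x, y) \<Rightarrow> f x * g y) \<noteq> 0"
      unfolding conv_def by (metis (mono_tags, lifting) mem_Collect_eq sum.not_neutral_contains_not_neutral)
    then obtain x y where "(x, y) \<in> splits b" "f x \<noteq> 0" "g y \<noteq> 0" by (cases p) auto
    then show "b \<in> (\<lambda>(x, y). opr x y) ` ({b. f b \<noteq> 0} \<times> {b. g b \<noteq> 0}) \<inter> B"
      using opr_closed by (force simp: splits_def)
  qed
  then show ?thesis using assms by (auto simp: fsupp_def intro: finite_subset)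
qed

lemma conv_add_left: "conv (\<lambda>b. f b + f' b) g = (\<lambda>b. conv f g b + conv f' g b)"
  by (rule ext) (simp add: conv_def case_prod_unfold distrib_right distrib_left sum.distrib)

lemma conv_add_right: "conv f (\<lambda>b. g b + g' b) = (\<lambda>b. conv f g b + conv f g' b)"
  by (rule ext) (simp add: conv_def case_prod_unfold distrib_right distrib_left sum.distrib)

lemma conv_single:
  assumes "x \<in> B" "y \<in> B"
  shows "conv (single x c) (single y d) = (if ok x y then single (opr x y) (c * d) else (\<lambda>_. 0))"
proof
  fix b
  have "conv (single x c) (single y d) b = (\<Sum>p\<in>splits b. if p = (x, y) then c * d else 0)"
    unfolding conv_def by (rule sum.cong) (auto simp: single_def split: if_splits)
  also have "\<dots> = (if (x, y) \<in> splits b then c * d else 0)"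
    by simp
  finally show "conv (single x c) (single y d) b = (if ok x y then single (opr x y) (c * d) else (\<lambda>_. 0)) b"
    using assms by (auto simp: splits_def single_def)
qed

lemma conv_zero: "conv (\<lambda>_. 0) g = (\<lambda>_. 0)" "conv f (\<lambda>_. 0) = (\<lambda>_. 0)"
  by (auto simp: conv_def case_prod_unfold)

text \<open>Both sides sum \<open>f x * g y * h z\<close> over the triples with product
  \<open>b\<close>; they differ only in the bracketing that records a triple as a split of a
  split.\<close>

lemma conv_assoc:
  assumes assoc: "\<And>x y z. x \<in> B \<Longrightarrow> y \<in> B \<Longrightarrow> z \<in> B \<Longrightarrow>
      (ok x y \<and> ok (opr x y) z) = (ok y z \<and> ok x (opr y z)) \<and>
      (ok x y \<and> ok (opr x y) z \<longrightarrow> opr (opr x y) z = opr x (opr y z))"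
  shows "conv (conv f g) h = conv f (conv g h)"
proof
  fix b
  have "conv (conv f g) h b = (\<Sum>(u, z)\<in>splits b. \<Sum>(x, y)\<in>splits u. f x * g y * h z)"
    unfolding conv_def by (rule sum.cong) (auto simp: sum_distrib_right case_prod_unfold)
  also have "\<dots> = (\<Sum>((u, z), (x, y))\<in>Sigma (splits b) (\<lambda>(u, z). splits u). f x * g y * h z)"
    by (subst sum.Sigma[symmetric]) (auto simp: case_prod_unfold)
  also have "\<dots> = (\<Sum>((x, v), (y, z))\<in>Sigma (splits b) (\<lambda>(x, v). splits v). f x * g y * h z)"
  proof -
    \<comment> \<open>\<open>i\<close> turns a right-bracketed factorisation into the left-bracketed
      one, and \<open>j\<close> goes back.\<close>
    define i where "i = (\<lambda>((x, v :: 'b), (y, z :: 'b)). ((opr x y, z), (x, y)))"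
    define j where "j = (\<lambda>((u :: 'b, z), (x :: 'b, y)). ((x, opr y z), (y, z)))"
    have 1: "i (j p) = p \<and> j p \<in> Sigma (splits b) (\<lambda>(x, v). splits v)"
      if "p \<in> Sigma (splits b) (\<lambda>(u, z). splits u)" for p
    proof -
      from that obtain u z x y where p: "p = ((u, z), (x, y))" "x \<in> B" "y \<in> B" "z \<in> B" "ok x y"
          "u = opr x y" "ok u z" "opr u z = b"
        by (auto simp: splits_def)
      then have "ok y z" "ok x (opr y z)" "opr x (opr y z) = b"
        using assoc[of x y z] by auto
      with p show ?thesis
        using opr_closed[of y z] by (auto simp: splits_def i_def j_def)
    qed
    have 2: "j (i p) = p \<and> i p \<in> Sigma (splits b) (\<lambda>(u, z). splits u)"
      if "p \<in> Sigma (splits b) (\<lambda>(x, v). splits v)" for p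
    proof -
      from that obtain x v y z where p: "p = ((x, v), (y, z))" "x \<in> B" "y \<in> B" "z \<in> B" "ok y z"
          "v = opr y z" "ok x v" "opr x v = b"
        by (auto simp: splits_def)
      then have "ok x y" "ok (opr x y) z" "opr (opr x y) z = b"
        using assoc[of x y z] by auto
      with p show ?thesis
        using opr_closed[of x y] by (auto simp: splits_def i_def j_def)
    qed
    show ?thesis
      by (rule sum.reindex_bij_witness[where i = i and j = j])
        (use 1 2 in blast, use 1 in blast, use 2 in blast, use 2 in blast, auto simp: j_def)
  qed
  also have "\<dots> = (\<Sum>(x, v)\<in>splits b. \<Sum>(y, z)\<in>splits v. f x * (g y * h z))"
    by (subst sum.Sigma[symmetric]) (auto simp: case_prod_unfold mult.assoc)
  also have "\<dots> = conv f (conv g h) b"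
    unfolding conv_def by (rule sum.cong) (auto simp: sum_distrib_left case_prod_unfold)
  finally show "conv (conv f g) h b = conv f (conv g h) b" .
qed

end

text \<open>
  The associated graded ring and the tensor algebra are both computed in coordinates: \<open>B\<close> indexes a
  basis, and a product of two basis elements is zero or a basis element.
\<close>

locale convolution_ring = partial_semigroup B ok opr
  for B :: "'b set" and ok opr +
  fixes R :: "'a ring" and emb :: "('b \<Rightarrow> 'k::field) \<Rightarrow> 'a" and e :: "'b \<Rightarrow> 'k"
  assumes carrier_eq: "carrier R = emb ` fsupp B"
    and inj_emb: "inj_on emb (fsupp B)"
    and emb_add: "f \<in> fsupp B \<Longrightarrow> g \<in> fsupp B \<Longrightarrow> emb f \<oplus>\<^bsub>R\<^esub> emb g = emb (\<lambda>b. f b + g b)"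
    and emb_zero: "\<zero>\<^bsub>R\<^esub> = emb (\<lambda>_. 0)"
    and emb_mult: "f \<in> fsupp B \<Longrightarrow> g \<in> fsupp B \<Longrightarrow> emb f \<otimes>\<^bsub>R\<^esub> emb g = emb (conv f g)"
    and emb_one: "\<one>\<^bsub>R\<^esub> = emb e"
    and e_fsupp: "e \<in> fsupp B"
begin

lemma emb_eq_iff: "f \<in> fsupp B \<Longrightarrow> g \<in> fsupp B \<Longrightarrow> emb f = emb g \<longleftrightarrow> f = g"
  using inj_emb by (auto dest: inj_onD)

lemma emb_carrier [simp]: "f \<in> fsupp B \<Longrightarrow> emb f \<in> carrier R"
  by (simp add: carrier_eq)

lemma abelian_group: "abelian_group R"
proof (rule abelian_groupI)
  fix x assume "x \<in> carrier R"
  then obtain f where f: "f \<in> fsupp B" "x = emb f" by (auto simp: carrier_eq)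
  then have "emb (\<lambda>b. - f b) \<oplus>\<^bsub>R\<^esub> x = \<zero>\<^bsub>R\<^esub>"
    by (simp add: emb_add fsupp_uminus emb_zero)
  then show "\<exists>y\<in>carrier R. y \<oplus>\<^bsub>R\<^esub> x = \<zero>\<^bsub>R\<^esub>"
    using fsupp_uminus[OF f(1)] by (auto simp: carrier_eq)
qed (auto simp: carrier_eq emb_add emb_zero fsupp_0 fsupp_add add_ac)

sublocale abelian_group R
  by (rule abelian_group)

lemma emb_uminus: "f \<in> fsupp B \<Longrightarrow> \<ominus>\<^bsub>R\<^esub> emb f = emb (\<lambda>b. - f b)"
  by (rule minus_equality) (auto simp: fsupp_uminus emb_add emb_zero)

lemma emb_finsum:
  assumes "\<And>i. i \<in> I \<Longrightarrow> f i \<in> fsupp B"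
  shows "finsum R (\<lambda>i. emb (f i)) I = emb (\<lambda>b. \<Sum>i\<in>I. f i b)"
proof (cases "finite I")
  case True
  then show ?thesis using assms
  proof (induction I rule: finite_induct)
    case empty
    then show ?case by (simp add: emb_zero)
  next
    case (insert i I)
    then have "(\<lambda>b. \<Sum>i\<in>I. f i b) \<in> fsupp B" by (intro fsupp_sum) auto
    with insert show ?case by (subst finsum_insert) (auto simp: emb_add)
  qed
next
  case False
  then show ?thesis by (simp add: finsum_infinite emb_zero)
qed

text \<open>The tensor powers are built with integer coefficients, so evaluating them in
  \<open>R\<close> produces additive multiples; these act as scalars of \<open>k\<close> through
  \<open>of_int\<close>.\<close>

lemma emb_add_pow:
  assumes f: "f \<in> fsupp B"
  shows "add_pow R (n::int) (emb f) = emb (\<lambda>b. of_int n * f b)"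
proof -
  have nat: "add_pow R (k::nat) (emb f) = emb (\<lambda>b. of_nat k * f b)" for k
  proof (induction k)
    case 0
    then show ?case by (simp add: emb_zero)
  next
    case (Suc k)
    have "(\<lambda>b. of_nat k * f b) \<in> fsupp B"
      using f by (auto simp: fsupp_def intro: finite_subset[of _ "{b. f b \<noteq> 0}"])
    with f Suc show ?case by (simp add: add.nat_pow_Suc emb_add algebra_simps)
  qed
  have sc: "(\<lambda>b. of_nat k * f b) \<in> fsupp B" for k
    using f by (auto simp: fsupp_def intro: finite_subset[of _ "{b. f b \<noteq> 0}"])
  show ?thesis
  proof (cases "n \<ge> 0")
    case True
    then obtain k where "n = int k" using nonneg_int_cases by auto
    then show ?thesis using nat by (simp add: add_pow_def int_pow_int)
  next
    case False
    define k where "k = nat (- n)"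
    with False have k: "n = - int k" by simp
    have "add_pow R n (emb f) = \<ominus>\<^bsub>R\<^esub> add_pow R k (emb f)"
      using f by (simp add: k add.int_pow_neg_int)
    then show ?thesis using nat[of k] k emb_uminus[OF sc] by simp
  qed
qed

lemma ring:
  assumes "\<And>x y z. x \<in> B \<Longrightarrow> y \<in> B \<Longrightarrow> z \<in> B \<Longrightarrow>
      (ok x y \<and> ok (opr x y) z) = (ok y z \<and> ok x (opr y z)) \<and>
      (ok x y \<and> ok (opr x y) z \<longrightarrow> opr (opr x y) z = opr x (opr y z))"
    and unit: "\<And>f. f \<in> fsupp B \<Longrightarrow> conv e f = f" "\<And>f. f \<in> fsupp B \<Longrightarrow> conv f e = f"
  shows "ring R"
proof (rule ringI[OF abelian_group])
  show "monoid R"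
    by (rule monoidI) (auto simp: carrier_eq emb_mult emb_one e_fsupp conv_fsupp conv_assoc[OF assms(1)] unit)
qed (auto simp: carrier_eq emb_mult emb_add fsupp_add conv_fsupp conv_add_left conv_add_right)

end

text \<open>
  A direct sum ring whose degree \<open>d\<close> piece consists of the elements \<open>C d f\<close>, where \<open>C d f\<close>
  depends only on the coordinates of \<open>f\<close> of degree \<open>d\<close>.
\<close>

locale graded_model = partial_semigroup B ok opr
  for B :: "'b set" and ok opr +
  fixes deg :: "'b \<Rightarrow> nat" and H :: "nat \<Rightarrow> 'g monoid" and m :: "nat \<Rightarrow> nat \<Rightarrow> 'g \<Rightarrow> 'g \<Rightarrow> 'g"
    and C :: "nat \<Rightarrow> ('b \<Rightarrow> 'k::field) \<Rightarrow> 'g"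
  assumes deg_opr: "x \<in> B \<Longrightarrow> y \<in> B \<Longrightarrow> ok x y \<Longrightarrow> deg (opr x y) = deg x + deg y"
    and carrier_H: "carrier (H d) = C d ` fsupp B"
    and C_eq_iff: "f \<in> fsupp B \<Longrightarrow> g \<in> fsupp B \<Longrightarrow> C d f = C d g \<longleftrightarrow> (\<forall>b\<in>B. deg b = d \<longrightarrow> f b = g b)"
    and C_mult: "f \<in> fsupp B \<Longrightarrow> g \<in> fsupp B \<Longrightarrow> C d f \<otimes>\<^bsub>H d\<^esub> C d g = C d (\<lambda>b. f b + g b)"
    and C_one: "\<one>\<^bsub>H d\<^esub> = C d (\<lambda>_. 0)"
    and C_m: "f \<in> fsupp B \<Longrightarrow> g \<in> fsupp B \<Longrightarrow> m i j (C i f) (C j g) =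
      C (i + j) (conv (\<lambda>b. if deg b = i then f b else 0) (\<lambda>b. if deg b = j then g b else 0))"
begin

text \<open>Since \<open>C d\<close> reads only the coordinates of degree \<open>d\<close>, the same
  function \<open>f\<close> can be handed to every component without projecting it first.\<close>

definition emb :: "('b \<Rightarrow> 'k) \<Rightarrow> nat \<Rightarrow> 'g" where
  "emb f = (\<lambda>d. C d f)"

lemma comm_group_H: "comm_group (H d)"
proof (rule comm_groupI)
  fix x assume "x \<in> carrier (H d)"
  then obtain f where f: "f \<in> fsupp B" "x = C d f" by (auto simp: carrier_H)
  then have "C d (\<lambda>b. - f b) \<otimes>\<^bsub>H d\<^esub> x = \<one>\<^bsub>H d\<^esub>"
    by (simp add: C_mult fsupp_uminus C_one)
  then show "\<exists>y\<in>carrier (H d). y \<otimes>\<^bsub>H d\<^esub> x = \<one>\<^bsub>H d\<^esub>"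
    using fsupp_uminus[OF f(1)] by (auto simp: carrier_H)
qed (auto simp: carrier_H C_mult C_one fsupp_0 fsupp_add add_ac)

lemma finprod_C:
  assumes "\<And>i. i \<in> I \<Longrightarrow> f i \<in> fsupp B" "finite I"
  shows "finprod (H d) (\<lambda>i. C d (f i)) I = C d (\<lambda>b. \<Sum>i\<in>I. f i b)"
proof -
  interpret comm_group "H d" by (rule comm_group_H)
  show ?thesis using assms(2,1)
  proof (induction I rule: finite_induct)
    case empty
    then show ?case by (simp add: C_one)
  next
    case (insert i I)
    then have "(\<lambda>b. \<Sum>i\<in>I. f i b) \<in> fsupp B" by (intro fsupp_sum) auto
    with insert show ?case by (subst finprod_insert) (auto simp: C_mult carrier_H)
  qed
qed

lemma group_H: "group (H d)"
  using comm_group_H by (simp add: comm_group_def)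

text \<open>An element of the direct sum is glued to a single coordinate function: the value at
  \<open>b\<close> is read from the component of degree \<open>deg b\<close>.\<close>

lemma carrier_sum_H: "carrier (sum_group UNIV H) = emb ` fsupp B"
proof (intro equalityI subsetI)
  fix x assume "x \<in> carrier (sum_group UNIV H)"
  then have x: "x d \<in> carrier (H d)" "finite {d. x d \<noteq> \<one>\<^bsub>H d\<^esub>}" for d
    by (auto simp: carrier_sum_group[OF group_H] PiE_iff)
  \<comment> \<open>Trivial components get the representative 0. Only finitely many supports then
    remain, which keeps the glued function finitely supported.\<close>
  have "\<exists>h. \<forall>d. h d \<in> fsupp B \<and> x d = C d (h d) \<and> (x d = \<one>\<^bsub>H d\<^esub> \<longrightarrow> h d = (\<lambda>_. 0))"
  proof (rule choice, rule allI)
    fix d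
    from x(1)[of d] obtain f where "f \<in> fsupp B" "x d = C d f" by (auto simp: carrier_H)
    then show "\<exists>f. f \<in> fsupp B \<and> x d = C d f \<and> (x d = \<one>\<^bsub>H d\<^esub> \<longrightarrow> f = (\<lambda>_. 0))"
      by (cases "x d = \<one>\<^bsub>H d\<^esub>") (use C_one fsupp_0 in auto)
  qed
  then obtain h where h: "\<And>d. h d \<in> fsupp B" "\<And>d. x d = C d (h d)"
      "\<And>d. x d = \<one>\<^bsub>H d\<^esub> \<Longrightarrow> h d = (\<lambda>_. 0)" by metis
  define f where "f b = h (deg b) b" for b
  have "{b. f b \<noteq> 0} \<subseteq> (\<Union>d\<in>{d. x d \<noteq> \<one>\<^bsub>H d\<^esub>}. {b. h d b \<noteq> 0})"
  proof
    fix b assume "b \<in> {b. f b \<noteq> 0}"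
    then have "h (deg b) b \<noteq> 0" by (simp add: f_def)
    moreover from this have "x (deg b) \<noteq> \<one>\<^bsub>H (deg b)\<^esub>" using h(3)[of "deg b"] by auto
    ultimately show "b \<in> (\<Union>d\<in>{d. x d \<noteq> \<one>\<^bsub>H d\<^esub>}. {b. h d b \<noteq> 0})" by blast
  qed
  moreover have "finite (\<Union>d\<in>{d. x d \<noteq> \<one>\<^bsub>H d\<^esub>}. {b. h d b \<noteq> 0})"
    using x(2) h(1) by (auto simp: fsupp_def)
  ultimately have "f \<in> fsupp B"
    using h(1) by (auto simp: fsupp_def f_def intro: finite_subset)
  moreover from this have "x = emb f"
    using h(1) by (auto simp: emb_def h(2) C_eq_iff f_def)
  ultimately show "x \<in> emb ` fsupp B" by blast
next
  fix x assume "x \<in> emb ` fsupp B"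
  then obtain f where f: "f \<in> fsupp B" "x = emb f" by blast
  have "{d. x d \<noteq> \<one>\<^bsub>H d\<^esub>} \<subseteq> deg ` {b. f b \<noteq> 0}"
    using f by (auto simp: emb_def C_one C_eq_iff fsupp_0)
  then have "finite {d. x d \<noteq> \<one>\<^bsub>H d\<^esub>}"
    using f(1) by (auto simp: fsupp_def intro: finite_subset)
  then show "x \<in> carrier (sum_group UNIV H)"
    using f by (auto simp: carrier_sum_group[OF group_H] PiE_iff emb_def carrier_H)
qed

lemma emb_eq_iff: "f \<in> fsupp B \<Longrightarrow> g \<in> fsupp B \<Longrightarrow> emb f = emb g \<longleftrightarrow> f = g"
  unfolding emb_def fun_eq_iff C_eq_iff using fsupp_outside by metis

lemma homogeneous_eq: "homogeneous H d = emb ` {f \<in> fsupp B. \<forall>b. f b \<noteq> 0 \<longrightarrow> deg b = d}"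
proof -
  have "(\<forall>e. e \<noteq> d \<longrightarrow> emb f e = \<one>\<^bsub>H e\<^esub>) \<longleftrightarrow> (\<forall>b. f b \<noteq> 0 \<longrightarrow> deg b = d)" if f: "f \<in> fsupp B" for f
    using f by (auto simp: emb_def C_one C_eq_iff fsupp_0) (metis fsupp_outside)
  then show ?thesis unfolding homogeneous_def carrier_sum_H by blast
qed

text \<open>The product of the direct sum ring is a Cauchy product over the degrees. The degrees of
  a split of \<open>b\<close> add up to \<open>deg b\<close>, so each split is seen by exactly one
  summand and the sum collapses to the convolution.\<close>

lemma convolution_ring:
  assumes u: "u = C 0 e" "e \<in> fsupp B" "\<And>b. e b \<noteq> 0 \<Longrightarrow> deg b = 0"
  shows "convolution_ring B ok opr (direct_sum_ring H m u) emb e"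
proof unfold_locales
  let ?R = "direct_sum_ring H m u"
  show "carrier ?R = emb ` fsupp B"
    by (simp add: direct_sum_ring_def carrier_sum_H)
  show "inj_on emb (fsupp B)"
    by (auto intro!: inj_onI simp: emb_eq_iff)
  show "\<zero>\<^bsub>?R\<^esub> = emb (\<lambda>_. 0)"
    by (auto simp: direct_sum_ring_def emb_def C_one)
  show "\<one>\<^bsub>?R\<^esub> = emb e"
  proof
    fix d
    have "e b = 0" if "deg b = d" "d > 0" for b
      using u(3)[of b] that by auto
    then show "\<one>\<^bsub>?R\<^esub> d = emb e d"
      using u(1,2) by (auto simp: direct_sum_ring_def emb_def C_one C_eq_iff fsupp_0)
  qed
  fix f g :: "'b \<Rightarrow> 'k" assume fg: "f \<in> fsupp B" "g \<in> fsupp B"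
  then show "emb f \<oplus>\<^bsub>?R\<^esub> emb g = emb (\<lambda>b. f b + g b)"
    by (auto simp: direct_sum_ring_def emb_def C_mult)
  show "emb f \<otimes>\<^bsub>?R\<^esub> emb g = emb (conv f g)"
  proof
    fix d
    let ?h = "\<lambda>i. conv (\<lambda>b. if deg b = i then f b else 0) (\<lambda>b. if deg b = d - i then g b else 0)"
    have h: "?h i \<in> fsupp B" for i
      by (intro conv_fsupp fsupp_restrict fg)
    have "(emb f \<otimes>\<^bsub>?R\<^esub> emb g) d = finprod (H d) (\<lambda>i. m i (d - i) (C i f) (C (d - i) g)) {..d}"
      by (simp add: direct_sum_ring_def emb_def)
    also have "\<dots> = finprod (H d) (\<lambda>i. C d (?h i)) {..d}"
    proof -
      interpret comm_group "H d" by (rule comm_group_H)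
      show ?thesis by (rule finprod_cong) (use fg h in \<open>auto simp: C_m carrier_H simp_implies_def\<close>)
    qed
    also have "\<dots> = C d (\<lambda>b. \<Sum>i\<le>d. ?h i b)"
      using h by (intro finprod_C) auto
    also have "\<dots> = C d (conv f g)"
    proof (subst C_eq_iff)
      show "\<forall>b\<in>B. deg b = d \<longrightarrow> (\<Sum>i\<le>d. ?h i b) = conv f g b"
      proof (intro ballI impI)
        fix b assume b: "b \<in> B" "deg b = d"
        have "(\<Sum>i\<le>d. ?h i b) = (\<Sum>(x, y)\<in>splits b. \<Sum>i\<le>d. if deg x = i \<and> deg y = d - i then f x * g y else 0)"
          unfolding conv_def by (subst sum.swap) (auto simp: case_prod_unfold intro!: sum.cong)
        also have "\<dots> = conv f g b"
          unfolding conv_def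
        proof (rule sum.cong[OF refl], clarify)
          fix x y assume "(x, y) \<in> splits b"
          then have "deg x + deg y = d" using b by (auto simp: splits_def deg_opr)
          \<comment> \<open>The condition on \<open>deg y\<close> follows from the one on
            \<open>deg x\<close>, so only \<open>i = deg x\<close> contributes.\<close>
          then have "(\<Sum>i\<le>d. if deg x = i \<and> deg y = d - i then f x * g y else 0) =
              (\<Sum>i\<le>d. if i = deg x then f x * g y else 0)"
            by (intro sum.cong) auto
          also have "\<dots> = f x * g y" using \<open>deg x + deg y = d\<close> by simp
          finally show "(\<Sum>i\<le>d. if deg x = i \<and> deg y = d - i then f x * g y else 0) = f x * g y" .
        qed
        finally show "(\<Sum>i\<le>d. ?h i b) = conv f g b" .
      qed
    qed (use fg h in \<open>auto intro: fsupp_sum conv_fsupp\<close>)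
    finally show "(emb f \<otimes>\<^bsub>?R\<^esub> emb g) d = emb (conv f g) d" by (simp add: emb_def)
  qed
qed (use u in auto)

end

section \<open>Paths in a category with lengths\<close>

text \<open>
  Objects are encoded by their identities.  The last three axioms determine \<open>len\<close> as the largest
  number of factors in a factorisation without identities.
\<close>

locale length_category =
  fixes S ob :: "'s set" and src tgt :: "'s \<Rightarrow> 's" and cmp :: "'s \<Rightarrow> 's \<Rightarrow> 's" and len :: "'s \<Rightarrow> nat"
  assumes finite_ob: "finite ob" and ob_S: "ob \<subseteq> S"
    and src_ob: "x \<in> S \<Longrightarrow> src x \<in> ob" and tgt_ob: "x \<in> S \<Longrightarrow> tgt x \<in> ob"
    and src_id: "a \<in> ob \<Longrightarrow> src a = a" and tgt_id: "a \<in> ob \<Longrightarrow> tgt a = a"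
    and cmp_S: "x \<in> S \<Longrightarrow> y \<in> S \<Longrightarrow> tgt x = src y \<Longrightarrow> cmp x y \<in> S"
    and src_cmp: "x \<in> S \<Longrightarrow> y \<in> S \<Longrightarrow> tgt x = src y \<Longrightarrow> src (cmp x y) = src x"
    and tgt_cmp: "x \<in> S \<Longrightarrow> y \<in> S \<Longrightarrow> tgt x = src y \<Longrightarrow> tgt (cmp x y) = tgt y"
    and cmp_assoc: "x \<in> S \<Longrightarrow> y \<in> S \<Longrightarrow> z \<in> S \<Longrightarrow> tgt x = src y \<Longrightarrow> tgt y = src z \<Longrightarrow>
      cmp (cmp x y) z = cmp x (cmp y z)"
    and cmp_src: "x \<in> S \<Longrightarrow> cmp (src x) x = x" and cmp_tgt: "x \<in> S \<Longrightarrow> cmp x (tgt x) = x"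
    and finite_factorizations: "finite {(x, y). x \<in> S \<and> y \<in> S \<and> tgt x = src y \<and> cmp x y = z}"
    and len_0: "x \<in> S \<Longrightarrow> len x = 0 \<longleftrightarrow> x \<in> ob"
    and len_cmp: "x \<in> S \<Longrightarrow> y \<in> S \<Longrightarrow> tgt x = src y \<Longrightarrow> len x + len y \<le> len (cmp x y)"
    and len_Suc: "z \<in> S \<Longrightarrow> len z = Suc n \<Longrightarrow>
      \<exists>x\<in>S. \<exists>y\<in>S. tgt x = src y \<and> cmp x y = z \<and> len x = n \<and> len y = 1"
begin

definition gok :: "'s \<Rightarrow> 's \<Rightarrow> bool" where
  "gok x y \<longleftrightarrow> tgt x = src y \<and> len (cmp x y) = len x + len y"

lemma partial_semigroup_cmp: "partial_semigroup S (\<lambda>x y. tgt x = src y) cmp"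
  by unfold_locales (use cmp_S finite_factorizations in auto)

sublocale gr: partial_semigroup S gok cmp
proof
  show "finite {(x, y). x \<in> S \<and> y \<in> S \<and> gok x y \<and> cmp x y = b}" for b
    by (rule finite_subset[OF _ finite_factorizations[of b]]) (auto simp: gok_def)
qed (auto simp: gok_def cmp_S)

section \<open>Paths of arrows of length 1 and their values\<close>

fun path_from :: "'s \<Rightarrow> 's list \<Rightarrow> bool" where
  "path_from a [] \<longleftrightarrow> a \<in> ob"
| "path_from a (x # xs) \<longleftrightarrow> a \<in> ob \<and> x \<in> S \<and> len x = 1 \<and> src x = a \<and> path_from (tgt x) xs"

text \<open>The start object is stored because an empty list of arrows would not determine it; in
  the tensor algebra it matches the leading factor of a word.\<close>

definition paths :: "('s \<times> 's list) set" where
  "paths = {(a, xs). path_from a xs}"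

definition val :: "'s \<times> 's list \<Rightarrow> 's" where
  "val p = foldl cmp (fst p) (snd p)"

abbreviation plen :: "'s \<times> 's list \<Rightarrow> nat" where
  "plen p \<equiv> length (snd p)"

definition pok :: "'s \<times> 's list \<Rightarrow> 's \<times> 's list \<Rightarrow> bool" where
  "pok p q \<longleftrightarrow> tgt (val p) = fst q"

definition pcat :: "'s \<times> 's list \<Rightarrow> 's \<times> 's list \<Rightarrow> 's \<times> 's list" where
  "pcat p q = (fst p, snd p @ snd q)"

lemma path_from_ob: "path_from a xs \<Longrightarrow> a \<in> ob"
  by (cases xs) auto

text \<open>Associativity pulls the accumulator out of a left fold. The claims about membership and
  sources are proved along with it because each step of the induction needs them for the new
  accumulator \<open>cmp x y\<close>.\<close>

lemma foldl_cmp_path: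
  "path_from (tgt x) xs \<Longrightarrow> x \<in> S \<Longrightarrow>
    foldl cmp x xs \<in> S \<and> src (foldl cmp x xs) = src x \<and> foldl cmp x xs = cmp x (foldl cmp (tgt x) xs) \<and>
    foldl cmp (tgt x) xs \<in> S \<and> src (foldl cmp (tgt x) xs) = tgt x"
proof (induction xs arbitrary: x)
  case Nil
  then show ?case using ob_S by (auto simp: cmp_tgt tgt_ob src_id)
next
  case (Cons y ys)
  then have y: "y \<in> S" "src y = tgt x" "path_from (tgt y) ys" by auto
  have 1: "cmp x y \<in> S" "src (cmp x y) = src x" "tgt (cmp x y) = tgt y"
    using y Cons.prems by (auto simp: cmp_S src_cmp tgt_cmp)
  have 2: "cmp (tgt x) y = y" using y cmp_src by metis
  have "foldl cmp y ys \<in> S" "src (foldl cmp y ys) = tgt x"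
      "foldl cmp y ys = cmp y (foldl cmp (tgt y) ys)" "foldl cmp (tgt y) ys \<in> S"
      "src (foldl cmp (tgt y) ys) = tgt y"
    using Cons.IH[OF y(3,1)] y by auto
  moreover have "foldl cmp (cmp x y) ys \<in> S" "src (foldl cmp (cmp x y) ys) = src x"
      "foldl cmp (cmp x y) ys = cmp (cmp x y) (foldl cmp (tgt y) ys)"
    using Cons.IH[of "cmp x y"] 1 y by auto
  ultimately show ?case using 2 y Cons.prems by (simp add: cmp_assoc)
qed

lemma tgt_foldl:
  "path_from (tgt x) xs \<Longrightarrow> x \<in> S \<Longrightarrow> tgt (foldl cmp x xs) = tgt (foldl cmp (tgt x) xs)"
  using foldl_cmp_path[of x xs] tgt_cmp[of x "foldl cmp (tgt x) xs"] by simp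

lemma val_S: "p \<in> paths \<Longrightarrow> val p \<in> S" and src_val: "p \<in> paths \<Longrightarrow> src (val p) = fst p"
proof -
  assume p: "p \<in> paths"
  then have *: "fst p \<in> ob" "path_from (fst p) (snd p)"
    by (auto simp: paths_def path_from_ob)
  then have "path_from (tgt (fst p)) (snd p)" by (simp add: tgt_id)
  with foldl_cmp_path[OF this] * ob_S show "val p \<in> S" "src (val p) = fst p"
    by (auto simp: val_def src_id)
qed

lemma fst_ob: "p \<in> paths \<Longrightarrow> fst p \<in> ob"
  by (auto simp: paths_def path_from_ob)

lemma path_from_append:
  "path_from (tgt x) (xs @ ys) \<longleftrightarrow> path_from (tgt x) xs \<and> path_from (tgt (foldl cmp x xs)) ys" if "x \<in> S"
  using that
proof (induction xs arbitrary: x)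
  case (Cons y xs)
  show ?case
  proof (cases "y \<in> S \<and> src y = tgt x \<and> path_from (tgt y) xs")
    case True
    then have "tgt (foldl cmp (cmp x y) xs) = tgt (foldl cmp y xs)"
      using tgt_foldl[of "cmp x y" xs] tgt_foldl[of y xs] Cons.prems by (simp add: cmp_S tgt_cmp)
    then show ?thesis using Cons True by auto
  next
    case False
    then show ?thesis using Cons by auto
  qed
qed (auto dest: path_from_ob simp: tgt_ob)

lemma paths_append: "(a, xs @ ys) \<in> paths \<longleftrightarrow> (a, xs) \<in> paths \<and> (tgt (val (a, xs)), ys) \<in> paths"
proof (cases "a \<in> ob")
  case True
  then show ?thesis using path_from_append[of a xs ys] ob_S by (auto simp: paths_def val_def tgt_id)
next
  case False
  then show ?thesis by (auto simp: paths_def dest: path_from_ob)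
qed

lemma val_append:
  "(a, xs @ ys) \<in> paths \<Longrightarrow> val (a, xs @ ys) = cmp (val (a, xs)) (val (tgt (val (a, xs)), ys))"
  using foldl_cmp_path[of "val (a, xs)" ys] val_S[of "(a, xs)"]
  unfolding paths_append by (simp add: val_def paths_def)

lemma val_pcat: "p \<in> paths \<Longrightarrow> q \<in> paths \<Longrightarrow> pok p q \<Longrightarrow> val (pcat p q) = cmp (val p) (val q)"
  using val_append[of "fst p" "snd p" "snd q"] by (simp add: pok_def pcat_def paths_append)

lemma pcat_paths: "p \<in> paths \<Longrightarrow> q \<in> paths \<Longrightarrow> pok p q \<Longrightarrow> pcat p q \<in> paths"
  by (simp add: pok_def pcat_def paths_append)

lemma pok_src: "q \<in> paths \<Longrightarrow> pok p q \<longleftrightarrow> tgt (val p) = src (val q)"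
  by (simp add: pok_def src_val)

lemma tgt_val_pcat: "p \<in> paths \<Longrightarrow> q \<in> paths \<Longrightarrow> pok p q \<Longrightarrow> tgt (val (pcat p q)) = tgt (val q)"
  by (simp add: val_pcat tgt_cmp val_S pok_src)

lemma nil_paths: "(a, []) \<in> paths \<longleftrightarrow> a \<in> ob"
  by (simp add: paths_def)

lemma val_nil: "val (a, []) = a"
  by (simp add: val_def)

lemma single_paths: "(a, [x]) \<in> paths \<longleftrightarrow> x \<in> S \<and> len x = 1 \<and> src x = a"
  by (auto simp: paths_def src_ob tgt_ob)

lemma val_single: "x \<in> S \<Longrightarrow> val (src x, [x]) = x"
  by (simp add: val_def cmp_src)

lemma snoc_paths:
  "(a, xs @ [x]) \<in> paths \<longleftrightarrow> (a, xs) \<in> paths \<and> x \<in> S \<and> len x = 1 \<and> tgt (val (a, xs)) = src x"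
  by (auto simp: paths_append single_paths)

lemma val_snoc: "val (a, xs @ [x]) = cmp (val (a, xs)) x"
  by (simp add: val_def)

text \<open>Every arrow has length 1 and lengths are superadditive. Equality singles out the paths
  that survive in the graded ring.\<close>

lemma len_val: "p \<in> paths \<Longrightarrow> plen p \<le> len (val p)"
proof (induction "snd p" arbitrary: p rule: rev_induct)
  case (snoc x xs)
  obtain a where p: "p = (a, xs @ [x])" using snoc.hyps by (metis prod.collapse)
  with snoc.prems have *: "(a, xs) \<in> paths" "x \<in> S" "len x = 1" "tgt (val (a, xs)) = src x"
    by (auto simp: snoc_paths)
  then have "length xs \<le> len (val (a, xs))" using snoc.hyps(1)[of "(a, xs)"] by auto
  moreover have "len (val (a, xs)) + len x \<le> len (val p)"
    unfolding p val_snoc using * by (intro len_cmp val_S) auto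
  ultimately show ?case using * by (simp add: p)
qed (auto simp: paths_def)

text \<open>Removing the last arrow of a nonempty path gives a factorisation of \<open>z\<close>
  with a strictly shorter left factor; there are finitely many factorisations, and induction on the
  length applies to the left factors.\<close>

lemma finite_paths_val: "finite {p \<in> paths. val p = z}"
proof (induction "len z" arbitrary: z rule: less_induct)
  case less
  let ?F = "{(x, y). x \<in> S \<and> y \<in> S \<and> tgt x = src y \<and> cmp x y = z}"
  have "{p \<in> paths. val p = z} \<subseteq> {(z, [])} \<union>
    (\<Union>(x, y)\<in>?F \<inter> {(x, y). len x < len z}. (\<lambda>p. (fst p, snd p @ [y])) ` {p \<in> paths. val p = x})"
  proof
    fix p assume p: "p \<in> {p \<in> paths. val p = z}"
    obtain a xs where a: "p = (a, xs)" by (cases p)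
    show "p \<in> {(z, [])} \<union>
      (\<Union>(x, y)\<in>?F \<inter> {(x, y). len x < len z}. (\<lambda>p. (fst p, snd p @ [y])) ` {p \<in> paths. val p = x})"
    proof (cases xs rule: rev_cases)
      case Nil
      then show ?thesis using p a by (auto simp: val_def)
    next
      case (snoc ys y)
      then have *: "(a, ys) \<in> paths" "y \<in> S" "len y = 1" "tgt (val (a, ys)) = src y" "cmp (val (a, ys)) y = z"
        using p a by (auto simp: snoc_paths val_snoc)
      then have "(val (a, ys), y) \<in> ?F \<inter> {(x, y). len x < len z}"
        using len_cmp[of "val (a, ys)" y] by (auto simp: val_S)
      moreover have "p \<in> (\<lambda>p. (fst p, snd p @ [y])) ` {p \<in> paths. val p = val (a, ys)}"
        using * a snoc by (auto intro!: image_eqI[of _ _ "(a, ys)"])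
      ultimately show ?thesis by blast
    qed
  qed
  moreover have "finite (\<Union>(x, y)\<in>?F \<inter> {(x, y). len x < len z}. (\<lambda>p. (fst p, snd p @ [y])) ` {p \<in> paths. val p = x})"
    using finite_factorizations[of z] less by auto
  ultimately show ?case by (meson finite.emptyI finite_UnI finite_insert finite_subset)
qed

lemma path_exists: "z \<in> S \<Longrightarrow> \<exists>p\<in>paths. val p = z \<and> plen p = len z"
proof (induction "len z" arbitrary: z)
  case 0
  then have "z \<in> ob" using len_0 by auto
  then show ?case using 0 by (intro bexI[of _ "(z, [])"]) (auto simp: nil_paths val_nil)
next
  case (Suc n)
  then obtain x y where xy: "x \<in> S" "y \<in> S" "tgt x = src y" "cmp x y = z" "len x = n" "len y = 1"
    using len_Suc by metis
  then obtain p where "p \<in> paths" "val p = x" "plen p = n" using Suc.hyps(1)[of x] by auto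
  with xy Suc.hyps(2) show ?case
    by (intro bexI[of _ "(fst p, snd p @ [y])"]) (auto simp: snoc_paths val_snoc)
qed

definition paths_to :: "'s \<Rightarrow> ('s \<times> 's list) set" where
  "paths_to z = {p \<in> paths. val p = z \<and> plen p = len z}"

lemma finite_paths_to [simp]: "finite (paths_to z)"
  by (rule finite_subset[OF _ finite_paths_val[of z]]) (auto simp: paths_to_def)

text \<open>A factorisation of a path is determined by the position of the cut.\<close>

sublocale pa: partial_semigroup paths pok pcat
proof
  fix b
  have "{(x, y). x \<in> paths \<and> y \<in> paths \<and> pok x y \<and> pcat x y = b} \<subseteq>
    (\<lambda>i. ((fst b, take i (snd b)), (tgt (val (fst b, take i (snd b))), drop i (snd b)))) ` {..plen b}"
  proof
    fix z assume "z \<in> {(x, y). x \<in> paths \<and> y \<in> paths \<and> pok x y \<and> pcat x y = b}"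
    then show "z \<in> (\<lambda>i. ((fst b, take i (snd b)), (tgt (val (fst b, take i (snd b))), drop i (snd b)))) ` {..plen b}"
      by (auto simp: pok_def pcat_def intro!: image_eqI[of _ _ "plen (fst z)"])
  qed
  then show "finite {(x, y). x \<in> paths \<and> y \<in> paths \<and> pok x y \<and> pcat x y = b}"
    by (rule finite_subset) auto
qed (rule pcat_paths)

lemma splits_take_drop:
  assumes "p \<in> paths" "i \<le> plen p"
  shows "((fst p, take i (snd p)), (tgt (val (fst p, take i (snd p))), drop i (snd p))) \<in> pa.splits p"
  using paths_append[of "fst p" "take i (snd p)" "drop i (snd p)"] assms
  by (auto simp: pa.splits_def pok_def pcat_def)

lemma splitsD:
  assumes "(p, q) \<in> pa.splits r"
  shows "p = (fst r, take (plen p) (snd r))" "q = (tgt (val p), drop (plen p) (snd r))" "plen r = plen p + plen q"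
    "p \<in> paths" "q \<in> paths" "pok p q" "pcat p q = r"
  using assms by (auto simp: pa.splits_def pok_def pcat_def)

text \<open>A homogeneous left factor sees only the cut at its own degree, so one summand
  remains.\<close>

lemma conv_paths_at:
  assumes p: "p \<in> paths" and "i \<le> plen p" and f: "\<And>q. f q \<noteq> 0 \<Longrightarrow> plen q = i"
  shows "pa.conv f g p =
    f (fst p, take i (snd p)) * g (tgt (val (fst p, take i (snd p))), drop i (snd p))"
proof -
  let ?s = "((fst p, take i (snd p)), (tgt (val (fst p, take i (snd p))), drop i (snd p)))"
  have "pa.conv f g p = (\<Sum>s\<in>pa.splits p. if s = ?s then f (fst s) * g (snd s) else 0)"
    unfolding pa.conv_def
  proof (rule sum.cong[OF refl], clarify)
    fix x xs y ys assume s: "((x, xs), (y, ys)) \<in> pa.splits p"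
    show "f (x, xs) * g (y, ys) = (if ((x, xs), (y, ys)) = ?s then f (fst ((x, xs), (y, ys))) * g (snd ((x, xs), (y, ys))) else 0)"
      using splitsD(1,2)[OF s] f[of "(x, xs)"] by (cases "f (x, xs) = 0") auto
  qed
  also have "\<dots> = f (fst p, take i (snd p)) * g (tgt (val (fst p, take i (snd p))), drop i (snd p))"
    using splits_take_drop[OF p assms(2)] by simp
  finally show ?thesis .
qed

text \<open>The multiplication map in coordinates. A path shorter than the length of its value has
  no entry here, because the product of its arrows is zero in the graded ring.\<close>

definition push :: "('s \<times> 's list \<Rightarrow> 'k::field) \<Rightarrow> 's \<Rightarrow> 'k" where
  "push f z = (\<Sum>p\<in>paths_to z. f p)"

lemma push_add: "push (\<lambda>p. f p + g p) = (\<lambda>z. push f z + push g z)"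
  by (rule ext) (simp add: push_def sum.distrib)

lemma push_0: "push (\<lambda>p. 0) = (\<lambda>z. 0)"
  by (rule ext) (simp add: push_def)

lemma push_fsupp:
  assumes "f \<in> fsupp paths" shows "push f \<in> fsupp S"
proof -
  have "{z. push f z \<noteq> 0} \<subseteq> val ` {p. f p \<noteq> 0}"
  proof
    fix z assume "z \<in> {z. push f z \<noteq> 0}"
    then obtain p where "p \<in> paths_to z" "f p \<noteq> 0"
      unfolding push_def by (metis (mono_tags, lifting) mem_Collect_eq sum.not_neutral_contains_not_neutral)
    then show "z \<in> val ` {p. f p \<noteq> 0}" by (auto simp: paths_to_def)
  qed
  moreover have "\<dots> \<subseteq> S" using assms val_S by (auto simp: fsupp_def)
  ultimately show ?thesis using assms unfolding fsupp_def by (auto intro: finite_subset)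
qed

lemma push_surj:
  assumes "g \<in> fsupp S" shows "\<exists>f\<in>fsupp paths. push f = g"
  using assms
proof (induction rule: fsupp_induct)
  case zero
  show ?case by (rule bexI[of _ "\<lambda>_. 0"]) (auto simp: push_0 fsupp_0)
next
  case (add b c h)
  then obtain f where f: "f \<in> fsupp paths" "push f = h" by auto
  obtain p where p: "p \<in> paths" "val p = b" "plen p = len b" using path_exists add by metis
  have "push (single p c) = single b c"
  proof
    fix z
    have "p \<in> paths_to z \<longleftrightarrow> z = b" using p by (auto simp: paths_to_def)
    then show "push (single p c) z = single b c z" by (auto simp: push_def single_def)
  qed
  then show ?case using f p
    by (intro bexI[of _ "\<lambda>x. single p c x + f x"]) (auto simp: push_add fsupp_add fsupp_single)
qed

text \<open>
  Lengths are superadditive, so a concatenation of two paths of maximal length for their product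
  consists of two such paths.
\<close>

lemma push_conv: "push (pa.conv f g) = gr.conv (push f) (push g)"
proof
  fix z
  let ?A = "Sigma (paths_to z) pa.splits"
  let ?B = "Sigma (gr.splits z) (\<lambda>(x, y). paths_to x \<times> paths_to y)"
  have "push (pa.conv f g) z = (\<Sum>(r, (p, q))\<in>?A. f p * g q)"
    unfolding push_def pa.conv_def by (subst sum.Sigma) auto
  also have "\<dots> = (\<Sum>(_, (p, q))\<in>?B. f p * g q)"
  proof -
    define i where "i = (\<lambda>((_ :: 's \<times> 's), (p, q)). (pcat p q, (p, q)))"
    define j where "j = (\<lambda>((_ :: 's \<times> 's list), (p, q)). ((val p, val q), (p, q)))"
    have 1: "i (j t) = t \<and> j t \<in> ?B" if "t \<in> ?A" for t
    proof -
      from that obtain r p q where t: "t = (r, (p, q))" "r \<in> paths" "val r = z" "plen r = len z" "(p, q) \<in> pa.splits r"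
        by (auto simp: paths_to_def)
      note s = splitsD(3-)[OF t(5)]
      have z: "z = cmp (val p) (val q)" "tgt (val p) = src (val q)" "val p \<in> S" "val q \<in> S"
        using val_pcat[OF s(2-4)] s t(3) pok_src[OF s(3), of p] val_S by simp_all
      have "len (val p) + len (val q) \<le> len z" using z len_cmp by simp
      moreover have "plen p \<le> len (val p)" "plen q \<le> len (val q)" using s by (simp_all add: len_val)
      ultimately have "len z = len (val p) + len (val q)" "plen p = len (val p)" "plen q = len (val q)"
        using t(4) s(1) by linarith+
      then show ?thesis
        using s z(2-4) by (simp add: t(1) i_def j_def gr.splits_def paths_to_def gok_def flip: z(1))
    qed
    have 2: "j (i t) = t \<and> i t \<in> ?A" if "t \<in> ?B" for t
    proof -
      from that obtain x y p q where t: "t = ((x, y), (p, q))" "(x, y) \<in> gr.splits z" "p \<in> paths" "val p = x"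
          "plen p = len x" "q \<in> paths" "val q = y" "plen q = len y"
        by (auto simp: paths_to_def)
      then have *: "pok p q" "cmp x y = z" "len z = len x + len y" by (auto simp: gr.splits_def gok_def pok_src)
      moreover have "plen (pcat p q) = plen p + plen q" by (simp add: pcat_def)
      ultimately show ?thesis
        using t by (simp add: i_def j_def paths_to_def pa.splits_def pcat_paths val_pcat)
    qed
    show ?thesis
      by (rule sum.reindex_bij_witness[where i = i and j = j])
        (use 1 in blast, use 1 in blast, use 2 in blast, use 2 in blast, auto simp: j_def)
  qed
  also have "\<dots> = (\<Sum>(x, y)\<in>gr.splits z. \<Sum>(p, q)\<in>paths_to x \<times> paths_to y. f p * g q)"
    unfolding case_prod_unfold by (subst sum.Sigma) (auto simp: case_prod_unfold)
  also have "\<dots> = gr.conv (push f) (push g) z"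
    unfolding gr.conv_def push_def sum_product
    by (rule sum.cong) (auto simp: sum.cartesian_product)
  finally show "push (pa.conv f g) z = gr.conv (push f) (push g) z" .
qed

definition path_unit :: "'s \<times> 's list \<Rightarrow> 'k::field" where
  "path_unit p = (if fst p \<in> ob \<and> snd p = [] then 1 else 0)"

lemma path_unit_fsupp: "path_unit \<in> fsupp paths"
proof -
  have "{p. path_unit p \<noteq> (0 :: 'k::field)} \<subseteq> (\<lambda>a. (a, [])) ` ob"
    by (auto simp: path_unit_def)
  moreover have "\<dots> \<subseteq> paths" by (auto simp: nil_paths)
  ultimately show ?thesis unfolding fsupp_def using finite_ob by (auto intro: finite_subset)
qed

lemma conv_path_unit_left:
  fixes f :: "'s \<times> 's list \<Rightarrow> 'k::field"
  shows "f \<in> fsupp paths \<Longrightarrow> pa.conv path_unit f = f"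
proof
  fix p assume f: "f \<in> fsupp paths"
  show "pa.conv path_unit f p = f p"
  proof (cases "p \<in> paths")
    case True
    have "pa.conv path_unit f p = path_unit (fst p, []) * f (tgt (val (fst p, [])), snd p)"
    proof -
      have "plen q = 0" if "path_unit q \<noteq> (0 :: 'k)" for q :: "'s \<times> 's list"
        using that by (auto simp: path_unit_def split: if_splits)
      from conv_paths_at[OF True le0 this, where g = f] show ?thesis by simp
    qed
    then show ?thesis
      using fst_ob[OF True] by (simp add: path_unit_def val_nil tgt_id)
  next
    case False
    with pa.conv_fsupp[OF path_unit_fsupp f] f show ?thesis by (simp add: fsupp_outside)
  qed
qed

lemma conv_path_unit_right: "f \<in> fsupp paths \<Longrightarrow> pa.conv f path_unit = f"
proof
  fix p assume f: "f \<in> fsupp paths"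
  show "pa.conv f path_unit p = f p"
  proof (cases "p \<in> paths")
    case True
    have "pa.conv f path_unit p = (\<Sum>s\<in>pa.splits p. if s = (p, (tgt (val p), [])) then f p else 0)"
      unfolding pa.conv_def
    proof (rule sum.cong[OF refl], clarify)
      fix x xs y ys assume s: "((x, xs), (y, ys)) \<in> pa.splits p"
      show "f (x, xs) * path_unit (y, ys) = (if ((x, xs), (y, ys)) = (p, (tgt (val p), [])) then f p else 0)"
      proof (cases "ys = []")
        case True
        have "(y, ys) \<in> paths" "pok (x, xs) (y, ys)" "pcat (x, xs) (y, ys) = p"
          using splitsD(3-)[OF s] by simp_all
        with True fst_ob[of "(y, ys)"] show ?thesis by (auto simp: path_unit_def pcat_def pok_def)
      qed (auto simp: path_unit_def)
    qed
    also have "\<dots> = f p"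
      using splits_take_drop[OF True, of "plen p"] by simp
    finally show ?thesis .
  next
    case False
    with pa.conv_fsupp[OF f path_unit_fsupp] f show ?thesis by (simp add: fsupp_outside)
  qed
qed

lemma pcat_assoc:
  assumes "x \<in> paths" "y \<in> paths" "z \<in> paths"
  shows "(pok x y \<and> pok (pcat x y) z) = (pok y z \<and> pok x (pcat y z)) \<and>
    (pok x y \<and> pok (pcat x y) z \<longrightarrow> pcat (pcat x y) z = pcat x (pcat y z))"
proof -
  have "pok x (pcat y z) = pok x y" by (simp add: pok_def pcat_def)
  moreover have "pok x y \<Longrightarrow> pok (pcat x y) z = pok y z"
    using tgt_val_pcat[of x y] assms by (simp add: pok_def)
  ultimately show ?thesis by (auto simp: pcat_def)
qed

end

section \<open>Coordinates on the tensor algebra\<close>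

text \<open>The linear extension of \<open>h\<close> to formal sums; integer coefficients enter
  \<open>k\<close> through \<open>of_int\<close>, which allows every characteristic.\<close>

definition frag_lin :: "('w \<Rightarrow> 'k::field) \<Rightarrow> ('w \<Rightarrow>\<^sub>0 int) \<Rightarrow> 'k" where
  "frag_lin h x = (\<Sum>w\<in>Poly_Mapping.keys x. of_int (Poly_Mapping.lookup x w) * h w)"

lemma frag_lin_superset:
  "finite W \<Longrightarrow> Poly_Mapping.keys x \<subseteq> W \<Longrightarrow> frag_lin h x = (\<Sum>w\<in>W. of_int (Poly_Mapping.lookup x w) * h w)"
  unfolding frag_lin_def by (rule sum.mono_neutral_left) (auto simp: in_keys_iff)

lemma frag_lin_0 [simp]: "frag_lin h 0 = 0"
  by (simp add: frag_lin_def)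

lemma frag_lin_of [simp]: "frag_lin h (frag_of w) = h w"
  by (simp add: frag_lin_def)

lemma frag_lin_add: "frag_lin h (x + y) = frag_lin h x + frag_lin h y"
proof -
  let ?W = "Poly_Mapping.keys x \<union> Poly_Mapping.keys y"
  have "Poly_Mapping.keys (x + y) \<subseteq> ?W" by (rule keys_add)
  then show ?thesis
    by (simp add: frag_lin_superset[of ?W] lookup_add algebra_simps sum.distrib)
qed

lemma frag_lin_minus: "frag_lin h (- x) = - frag_lin h x"
  using frag_lin_add[of h x "- x"] by (simp add: eq_neg_iff_add_eq_0 add.commute)

lemma frag_lin_diff: "frag_lin h (x - y) = frag_lin h x - frag_lin h y"
  using frag_lin_add[of h x "- y"] by (simp add: frag_lin_minus)

lemma frag_lin_sum: "frag_lin h (\<Sum>i\<in>I. f i) = (\<Sum>i\<in>I. frag_lin h (f i))"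
  by (induction I rule: infinite_finite_induct) (auto simp: frag_lin_add)

text \<open>Isolates what the computation of the tensor algebra uses about the graded ring: a basis
  of morphisms, the product that survives when lengths add up, and pieces \<open>G d\<close> spanned
  by the morphisms of length \<open>d\<close>.\<close>

locale graded_path_ring = length_category S ob src tgt cmp len
  for S ob :: "'s set" and src tgt cmp len +
  fixes R :: "'a ring" and emb :: "('s \<Rightarrow> 'k::field) \<Rightarrow> 'a" and G :: "nat \<Rightarrow> 'a set"
  assumes ring_R: "convolution_ring S gok cmp R emb (\<lambda>x. if x \<in> ob then 1 else 0)"
    and G_eq: "G d = emb ` {f \<in> fsupp S. \<forall>x. f x \<noteq> 0 \<longrightarrow> len x = d}"
begin

sublocale R: convolution_ring S gok cmp R emb "\<lambda>x. if x \<in> ob then 1 else 0"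
  by (rule ring_R)

definition co :: "'a \<Rightarrow> 's \<Rightarrow> 'k" where
  "co x = inv_into (fsupp S) emb x"

lemma co_emb [simp]: "f \<in> fsupp S \<Longrightarrow> co (emb f) = f"
  by (simp add: co_def R.inj_emb)

lemma co_fsupp: "x \<in> G d \<Longrightarrow> co x \<in> fsupp S" and emb_co: "x \<in> G d \<Longrightarrow> emb (co x) = x"
  and co_len: "x \<in> G d \<Longrightarrow> co x z \<noteq> 0 \<Longrightarrow> len z = d"
  by (auto simp: G_eq)

lemma emb_G: "f \<in> fsupp S \<Longrightarrow> (\<And>x. f x \<noteq> 0 \<Longrightarrow> len x = d) \<Longrightarrow> emb f \<in> G d"
  by (auto simp: G_eq)

text \<open>In degree 0 only identities occur, and the only identity that can stand to the left of
  \<open>z\<close> is its source. So a degree 0 element multiplies each basis element by its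
  coordinate at the source.\<close>

lemma conv_ob_left:
  assumes f: "\<And>x. f x \<noteq> 0 \<Longrightarrow> len x = 0" and g: "g \<in> fsupp S"
  shows "gr.conv f g = (\<lambda>z. f (src z) * g z)"
proof
  fix z
  show "gr.conv f g z = f (src z) * g z"
  proof (cases "z \<in> S")
    case True
    have "gr.conv f g z = (\<Sum>s\<in>gr.splits z. if s = (src z, z) then f (src z) * g z else 0)"
      unfolding gr.conv_def
    proof (rule sum.cong[OF refl], clarify)
      fix x y assume s: "(x, y) \<in> gr.splits z"
      show "f x * g y = (if (x, y) = (src z, z) then f (src z) * g z else 0)"
      proof (cases "f x = 0")
        case False
        with f[of x] s have "x \<in> ob" using len_0 by (auto simp: gr.splits_def)
        with s have "x = src y" "y \<in> S" by (auto simp: gr.splits_def gok_def tgt_id)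
        with s have "y = z" by (auto simp: gr.splits_def cmp_src)
        with \<open>x = src y\<close> show ?thesis by simp
      qed auto
    qed
    also have "(src z, z) \<in> gr.splits z"
      using True ob_S src_ob[OF True] by (auto simp: gr.splits_def gok_def cmp_src tgt_id len_0)
    then have "(\<Sum>s\<in>gr.splits z. if s = (src z, z) then f (src z) * g z else 0) = f (src z) * g z"
      by simp
    finally show ?thesis .
  next
    case False
    then have "gr.splits z = {}" by (auto simp: gr.splits_def gok_def cmp_S)
    with False g show ?thesis by (simp add: gr.conv_def fsupp_outside)
  qed
qed

lemma conv_ob_right:
  assumes g: "\<And>x. g x \<noteq> 0 \<Longrightarrow> len x = 0" and f: "f \<in> fsupp S"
  shows "gr.conv f g = (\<lambda>z. f z * g (tgt z))"
proof
  fix z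
  show "gr.conv f g z = f z * g (tgt z)"
  proof (cases "z \<in> S")
    case True
    have "gr.conv f g z = (\<Sum>s\<in>gr.splits z. if s = (z, tgt z) then f z * g (tgt z) else 0)"
      unfolding gr.conv_def
    proof (rule sum.cong[OF refl], clarify)
      fix x y assume s: "(x, y) \<in> gr.splits z"
      show "f x * g y = (if (x, y) = (z, tgt z) then f z * g (tgt z) else 0)"
      proof (cases "g y = 0")
        case False
        with g[of y] s have "y \<in> ob" using len_0 by (auto simp: gr.splits_def)
        with s have "y = tgt x" "x \<in> S" by (auto simp: gr.splits_def gok_def src_id)
        with s have "x = z" by (auto simp: gr.splits_def cmp_tgt)
        with \<open>y = tgt x\<close> show ?thesis by simp
      qed auto
    qed
    also have "(z, tgt z) \<in> gr.splits z"
      using True ob_S tgt_ob[OF True] by (auto simp: gr.splits_def gok_def cmp_tgt src_id len_0)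
    then have "(\<Sum>s\<in>gr.splits z. if s = (z, tgt z) then f z * g (tgt z) else 0) = f z * g (tgt z)"
      by simp
    finally show ?thesis .
  next
    case False
    then have "gr.splits z = {}" by (auto simp: gr.splits_def gok_def cmp_S)
    with False f show ?thesis by (simp add: gr.conv_def fsupp_outside)
  qed
qed

lemma mult_G0_left:
  assumes "s \<in> G 0" "x \<in> G d"
  shows "s \<otimes>\<^bsub>R\<^esub> x \<in> G d" "co (s \<otimes>\<^bsub>R\<^esub> x) = (\<lambda>z. co s (src z) * co x z)"
proof -
  have eq: "s \<otimes>\<^bsub>R\<^esub> x = emb (gr.conv (co s) (co x))"
    using R.emb_mult[of "co s" "co x"] assms by (simp add: co_fsupp emb_co)
  have c: "gr.conv (co s) (co x) = (\<lambda>z. co s (src z) * co x z)"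
    by (rule conv_ob_left) (use assms in \<open>auto simp: co_fsupp co_len\<close>)
  have f: "gr.conv (co s) (co x) \<in> fsupp S"
    using assms by (intro gr.conv_fsupp co_fsupp)
  then show "co (s \<otimes>\<^bsub>R\<^esub> x) = (\<lambda>z. co s (src z) * co x z)" by (simp add: eq c)
  show "s \<otimes>\<^bsub>R\<^esub> x \<in> G d"
    unfolding eq using f assms(2) by (intro emb_G) (auto simp: c co_len)
qed

lemma mult_G0_right:
  assumes "s \<in> G 0" "x \<in> G d"
  shows "x \<otimes>\<^bsub>R\<^esub> s \<in> G d" "co (x \<otimes>\<^bsub>R\<^esub> s) = (\<lambda>z. co x z * co s (tgt z))"
proof -
  have eq: "x \<otimes>\<^bsub>R\<^esub> s = emb (gr.conv (co x) (co s))"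
    using R.emb_mult[of "co x" "co s"] assms by (simp add: co_fsupp emb_co)
  have c: "gr.conv (co x) (co s) = (\<lambda>z. co x z * co s (tgt z))"
    by (rule conv_ob_right) (use assms in \<open>auto simp: co_fsupp co_len\<close>)
  have f: "gr.conv (co x) (co s) \<in> fsupp S"
    using assms by (intro gr.conv_fsupp co_fsupp)
  then show "co (x \<otimes>\<^bsub>R\<^esub> s) = (\<lambda>z. co x z * co s (tgt z))" by (simp add: eq c)
  show "x \<otimes>\<^bsub>R\<^esub> s \<in> G d"
    unfolding eq using f assms(2) by (intro emb_G) (auto simp: c co_len)
qed

lemma add_G:
  assumes "x \<in> G d" "y \<in> G d"
  shows "x \<oplus>\<^bsub>R\<^esub> y \<in> G d" "co (x \<oplus>\<^bsub>R\<^esub> y) = (\<lambda>z. co x z + co y z)"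
proof -
  have eq: "x \<oplus>\<^bsub>R\<^esub> y = emb (\<lambda>z. co x z + co y z)"
    using R.emb_add[of "co x" "co y"] assms by (simp add: co_fsupp emb_co)
  have f: "(\<lambda>z. co x z + co y z) \<in> fsupp S" using assms by (intro fsupp_add co_fsupp)
  then show "co (x \<oplus>\<^bsub>R\<^esub> y) = (\<lambda>z. co x z + co y z)" by (simp add: eq)
  show "x \<oplus>\<^bsub>R\<^esub> y \<in> G d"
    unfolding eq
  proof (rule emb_G[OF f])
    fix z assume "co x z + co y z \<noteq> 0"
    then have "co x z \<noteq> 0 \<or> co y z \<noteq> 0" by auto
    then show "len z = d" using assms co_len by auto
  qed
qed

definition cf :: "'a list \<Rightarrow> 's list \<Rightarrow> 'k" where
  "cf ms xs = prod_list (map2 co ms xs)"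

lemma cf_simps [simp]: "cf [] [] = 1" "cf (m # ms) (x # xs) = co m x * cf ms xs"
  by (auto simp: cf_def)

lemma cf_append: "length us = length xs \<Longrightarrow> cf (us @ vs) (xs @ ys) = cf us xs * cf vs ys"
  by (simp add: cf_def)

text \<open>The coefficient of a path after expanding a pure tensor multilinearly in the basis. Only
  composable sequences of arrows are recorded: a tensor of arrows that do not meet vanishes over the
  degree 0 part.\<close>

definition word_coef :: "'a tensor_word \<Rightarrow> 's \<times> 's list \<Rightarrow> 'k" where
  "word_coef w p = (if p \<in> paths \<and> plen p = length (snd w) then co (fst w) (fst p) * cf (snd w) (snd p) else 0)"

definition coef :: "('a tensor_word \<Rightarrow>\<^sub>0 int) \<Rightarrow> 's \<times> 's list \<Rightarrow> 'k" where
  "coef x p = frag_lin (\<lambda>w. word_coef w p) x"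

lemma coef_simps: "coef 0 = (\<lambda>_. 0)" "coef (frag_of w) = word_coef w"
  "coef (x + y) = (\<lambda>p. coef x p + coef y p)" "coef (x - y) = (\<lambda>p. coef x p - coef y p)"
  "coef (- x) = (\<lambda>p. - coef x p)"
  by (auto simp: coef_def frag_lin_add frag_lin_diff frag_lin_minus)

abbreviation FG :: "nat \<Rightarrow> ('a tensor_word \<Rightarrow>\<^sub>0 int) monoid" where
  "FG d \<equiv> free_Abelian_group (tensor_words G d)"

lemma cf_nonzero: "length ms = length xs \<Longrightarrow> cf ms xs \<noteq> 0 \<Longrightarrow> set xs \<subseteq> (\<Union>m\<in>set ms. {x. co m x \<noteq> 0})"
proof (induction ms xs rule: list_induct2)
  case (Cons m ms x xs)
  then show ?case by auto
qed auto

lemma word_coef_fsupp: "w \<in> tensor_words G d \<Longrightarrow> word_coef w \<in> fsupp paths"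
proof -
  assume w: "w \<in> tensor_words G d"
  let ?U = "\<Union>m\<in>set (snd w). {x. co m x \<noteq> 0}"
  have "finite ?U" using w co_fsupp by (fastforce simp: tensor_words_def fsupp_def)
  have "finite {x. co (fst w) x \<noteq> 0}" using w co_fsupp[of "fst w" 0] by (auto simp: tensor_words_def fsupp_def)
  then have "finite ({x. co (fst w) x \<noteq> 0} \<times> {xs. set xs \<subseteq> ?U \<and> length xs = length (snd w)})"
    using finite_lists_length_eq[OF \<open>finite ?U\<close>] by blast
  moreover have "{p. word_coef w p \<noteq> 0} \<subseteq> {x. co (fst w) x \<noteq> 0} \<times> {xs. set xs \<subseteq> ?U \<and> length xs = length (snd w)}"
  proof
    fix p assume "p \<in> {p. word_coef w p \<noteq> 0}"
    then have "plen p = length (snd w)" "co (fst w) (fst p) \<noteq> 0" "cf (snd w) (snd p) \<noteq> 0"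
      by (auto simp: word_coef_def split: if_splits)
    with cf_nonzero[of "snd w" "snd p"] show "p \<in> {x. co (fst w) x \<noteq> 0} \<times> {xs. set xs \<subseteq> ?U \<and> length xs = length (snd w)}"
      by (cases p) auto
  qed
  ultimately have "finite {p. word_coef w p \<noteq> 0}" by (rule finite_subset[rotated])
  then show ?thesis by (auto simp: fsupp_def word_coef_def)
qed

lemma coef_fsupp: "x \<in> carrier (FG d) \<Longrightarrow> coef x \<in> fsupp paths"
  and coef_len: "x \<in> carrier (FG d) \<Longrightarrow> coef x p \<noteq> 0 \<Longrightarrow> plen p = d"
proof -
  assume x: "x \<in> carrier (FG d)"
  then have "Poly_Mapping.keys x \<subseteq> tensor_words G d" by simp
  then have "coef x \<in> fsupp paths \<and> (\<forall>p. coef x p \<noteq> 0 \<longrightarrow> plen p = d)"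
  proof (induction x rule: frag_induction)
    case zero
    then show ?case by (simp add: coef_simps fsupp_0)
  next
    case (one w)
    then show ?case
      using word_coef_fsupp[of w d] unfolding coef_simps
      by (metis (mono_tags, lifting) case_prodD mem_Collect_eq prod.collapse tensor_words_def word_coef_def)
  next
    case (diff x y)
    have "coef (x - y) p \<noteq> 0 \<Longrightarrow> coef x p \<noteq> 0 \<or> coef y p \<noteq> 0" for p by (auto simp: coef_simps)
    moreover have "coef (x - y) \<in> fsupp paths" using diff by (simp add: coef_simps fsupp_diff)
    ultimately show ?case using diff by blast
  qed
  then show "coef x \<in> fsupp paths" "coef x p \<noteq> 0 \<Longrightarrow> plen p = d" by blast+
qed

lemma path_adjacent: "(a, us @ x # y # vs) \<in> paths \<Longrightarrow> tgt x = src y"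
proof -
  assume "(a, us @ x # y # vs) \<in> paths"
  then have "(a, (us @ [x]) @ y # vs) \<in> paths" by simp
  then have 1: "(a, us @ [x]) \<in> paths" "(tgt (val (a, us @ [x])), y # vs) \<in> paths"
    unfolding paths_append by auto
  then have "tgt (val (a, us @ [x])) = tgt x" by (auto simp: snoc_paths val_snoc tgt_cmp val_S)
  with 1 show ?thesis by (simp add: paths_def)
qed

lemma relators_carrier: "x \<in> tensor_relators R G d \<Longrightarrow> x \<in> carrier (FG d)"
proof -
  have d2: "frag_of v - frag_of w \<in> carrier (FG d)" if "v \<in> tensor_words G d" "w \<in> tensor_words G d" for v w
    using keys_diff[of "frag_of v" "frag_of w"] that by auto
  have d3: "frag_of u - frag_of v - frag_of w \<in> carrier (FG d)"
    if "u \<in> tensor_words G d" "v \<in> tensor_words G d" "w \<in> tensor_words G d" for u v w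
    using keys_diff[of "frag_of u - frag_of v" "frag_of w"] d2[of u v] that by auto
  assume "x \<in> tensor_relators R G d"
  then show ?thesis
  proof cases
    case (add_head s ms s')
    show ?thesis unfolding add_head(1)
      by (rule d3) (use add_head add_G in \<open>auto simp: tensor_words_def\<close>)
  next
    case (add_factor s us m vs m')
    show ?thesis unfolding add_factor(1)
      by (rule d3) (use add_factor add_G in \<open>auto simp: tensor_words_def\<close>)
  next
    case (balanced_head s m vs t)
    show ?thesis unfolding balanced_head(1)
      by (rule d2) (use balanced_head mult_G0_left in \<open>auto simp: tensor_words_def\<close>)
  next
    case (balanced_factor s us m n vs t)
    show ?thesis unfolding balanced_factor(1)
      by (rule d2) (use balanced_factor mult_G0_left mult_G0_right in \<open>auto simp: tensor_words_def\<close>)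
  qed
qed

text \<open>The additivity relators vanish because the coefficients are multilinear. The balancing
  relators vanish because consecutive arrows of a path meet: the scalar counts with its coordinate
  at the target of the left arrow, which is the source of the right one. At the head the start of
  the path plays this role.\<close>

lemma relators_coef: "x \<in> tensor_relators R G d \<Longrightarrow> coef x = (\<lambda>_. 0)"
proof
  fix p
  assume "x \<in> tensor_relators R G d"
  then show "coef x p = 0"
  proof cases
    case (add_head s ms s')
    then have "co (s \<oplus>\<^bsub>R\<^esub> s') = (\<lambda>z. co s z + co s' z)"
      using add_G(2)[of s 0 s'] by (auto simp: tensor_words_def)
    then show ?thesis by (simp add: add_head coef_simps word_coef_def algebra_simps)
  next
    case (add_factor s us m vs m')
    then have *: "co (m \<oplus>\<^bsub>R\<^esub> m') = (\<lambda>z. co m z + co m' z)"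
      using add_G(2)[of m 1 m'] by (auto simp: tensor_words_def)
    show ?thesis
    proof (cases "p \<in> paths \<and> plen p = length us + Suc (length vs)")
      case True
      define xs where "xs = take (length us) (snd p)"
      obtain x ys where "drop (length us) (snd p) = x # ys" "length ys = length vs"
        using True by (metis add_diff_cancel_left' length_Suc_conv length_drop)
      then have "snd p = xs @ x # ys" "length us = length xs" "length vs = length ys"
        using True by (auto simp: xs_def) (metis append_take_drop_id)
      then show ?thesis using * by (simp add: add_factor coef_simps word_coef_def cf_append algebra_simps)
    qed (auto simp: add_factor coef_simps word_coef_def)
  next
    case (balanced_head s m vs t)
    then have G: "s \<in> G 0" "m \<in> G 1" "t \<in> G 0" by (auto simp: tensor_words_def)
    show ?thesis
    proof (cases "p \<in> paths \<and> plen p = Suc (length vs)")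
      case True
      then obtain x ys where x: "snd p = x # ys" "length vs = length ys" by (cases "snd p") auto
      then have "src x = fst p" "src (fst p) = fst p" using True
        by (cases p, auto simp: paths_def path_from_ob src_id)+
      then show ?thesis using x G
        using mult_G0_left(2)[of s t 0] mult_G0_left(2)[of t m 1]
        by (simp add: balanced_head coef_simps word_coef_def algebra_simps)
    qed (auto simp: balanced_head coef_simps word_coef_def)
  next
    case (balanced_factor s us m n vs t)
    then have G: "m \<in> G 1" "n \<in> G 1" "t \<in> G 0" by (auto simp: tensor_words_def)
    show ?thesis
    proof (cases "p \<in> paths \<and> plen p = length us + Suc (Suc (length vs))")
      case True
      define xs where "xs = take (length us) (snd p)"
      obtain x y ys where "drop (length us) (snd p) = x # y # ys" "length ys = length vs"
        using True by (metis add_diff_cancel_left' length_Suc_conv length_drop)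
      then have x: "snd p = xs @ x # y # ys" "length us = length xs" "length vs = length ys"
        using True by (auto simp: xs_def) (metis append_take_drop_id)
      moreover from x True have "tgt x = src y" by (cases p) (auto intro: path_adjacent)
      ultimately show ?thesis using G
        by (simp add: balanced_factor coef_simps word_coef_def cf_append mult_G0_left mult_G0_right algebra_simps)
    qed (auto simp: balanced_factor coef_simps word_coef_def)
  qed
qed

abbreviation K :: "nat \<Rightarrow> ('a tensor_word \<Rightarrow>\<^sub>0 int) set" where
  "K d \<equiv> tensor_relations R G d"

lemma subgroup_K: "subgroup (K d) (FG d)"
  unfolding tensor_relations_def
  by (rule group.generate_is_subgroup) (use relators_carrier in auto)

lemma K_carrier: "x \<in> K d \<Longrightarrow> x \<in> carrier (FG d)"
  using subgroup.mem_carrier[OF subgroup_K] .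

lemma K_0: "0 \<in> K d" and K_add: "x \<in> K d \<Longrightarrow> y \<in> K d \<Longrightarrow> x + y \<in> K d"
  and K_minus: "x \<in> K d \<Longrightarrow> - x \<in> K d"
  using subgroup.one_closed[OF subgroup_K[of d]] subgroup.m_closed[OF subgroup_K[of d]]
    subgroup.m_inv_closed[OF subgroup_K[of d], of x] K_carrier[of x d] inv_free_Abelian_group[of x "tensor_words G d"]
  by auto

lemma K_diff: "x \<in> K d \<Longrightarrow> y \<in> K d \<Longrightarrow> x - y \<in> K d"
  using K_add[OF _ K_minus] by fastforce

lemma K_sum: "(\<And>i. i \<in> I \<Longrightarrow> f i \<in> K d) \<Longrightarrow> (\<Sum>i\<in>I. f i) \<in> K d"
  by (induction I rule: infinite_finite_induct) (auto simp: K_0 K_add)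

lemma relator_K: "x \<in> tensor_relators R G d \<Longrightarrow> x \<in> K d"
  by (simp add: tensor_relations_def generate.incl)

lemma K_coef: "x \<in> K d \<Longrightarrow> coef x = (\<lambda>_. 0)"
  unfolding tensor_relations_def
proof (induction rule: generate.induct)
  case (inv h)
  then have "Poly_Mapping.keys h \<subseteq> tensor_words G d" using relators_carrier by auto
  then show ?case using relators_coef[OF inv] by (simp add: coef_simps)
qed (auto simp: coef_simps relators_coef)

end

section \<open>Normal forms: every tensor is a combination of paths modulo the relations\<close>

context graded_path_ring
begin

abbreviation \<xi> :: "'s \<Rightarrow> 'k \<Rightarrow> 'a" where
  "\<xi> x c \<equiv> emb (single x c)"

lemma single_mult_left: "a \<in> ob \<Longrightarrow> y \<in> S \<Longrightarrow>
    \<xi> a c \<otimes>\<^bsub>R\<^esub> \<xi> y d = (if a = src y then \<xi> y (c * d) else emb (\<lambda>_. 0))"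
  using ob_S by (subst R.emb_mult)
    (auto simp: fsupp_single gr.conv_single gok_def tgt_id cmp_src len_0)

lemma single_mult_right: "a \<in> ob \<Longrightarrow> y \<in> S \<Longrightarrow>
    \<xi> y c \<otimes>\<^bsub>R\<^esub> \<xi> a d = (if tgt y = a then \<xi> y (c * d) else emb (\<lambda>_. 0))"
  using ob_S by (subst R.emb_mult)
    (auto simp: fsupp_single gr.conv_single gok_def src_id cmp_tgt len_0)

lemma single_G: "x \<in> S \<Longrightarrow> len x = d \<Longrightarrow> \<xi> x c \<in> G d"
  by (rule emb_G) (auto simp: fsupp_single single_apply split: if_splits)

lemma zero_G: "emb (\<lambda>_. 0) \<in> G d"
  by (rule emb_G) (auto simp: fsupp_0)

lemma path_atoms: "(a, xs) \<in> paths \<Longrightarrow> x \<in> set xs \<Longrightarrow> x \<in> S \<and> len x = 1"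
  unfolding paths_def by (induction xs arbitrary: a) auto

lemma path_ob: "(a, xs) \<in> paths \<Longrightarrow> a \<in> ob"
  by (auto simp: paths_def path_from_ob)

lemma atoms_G: "(a, xs) \<in> paths \<Longrightarrow> set (map (\<lambda>x. \<xi> x 1) xs) \<subseteq> G 1"
  using path_atoms by (auto intro!: single_G)

lemma ob_G: "a \<in> ob \<Longrightarrow> \<xi> a c \<in> G 0"
  using ob_S len_0 by (intro single_G) auto

text \<open>The whole scalar sits in the leading factor and every arrow has coefficient 1; this
  fixes one representative for each multiple of a path.\<close>

definition path_word :: "'k \<Rightarrow> 's \<times> 's list \<Rightarrow> 'a tensor_word" where
  "path_word c p = (\<xi> (fst p) c, map (\<lambda>x. \<xi> x 1) (snd p))"

lemma path_word_W: "p \<in> paths \<Longrightarrow> path_word c p \<in> tensor_words G (plen p)"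
  using atoms_G[of "fst p" "snd p"] path_ob[of "fst p" "snd p"]
  by (auto simp: path_word_def tensor_words_def ob_G)

lemma cf_atoms: "length xs = length ys \<Longrightarrow> set xs \<subseteq> S \<Longrightarrow>
    cf (map (\<lambda>x. \<xi> x 1) xs) ys = (if xs = ys then 1 else 0)"
  by (induction xs ys rule: list_induct2) (auto simp: fsupp_single single_apply)

lemma coef_path_word: assumes "p \<in> paths" shows "coef (frag_of (path_word c p)) = single p c"
proof
  fix q
  have "set (snd p) \<subseteq> S" "fst p \<in> S"
    using path_atoms[of "fst p" "snd p"] path_ob[of "fst p" "snd p"] ob_S assms by auto
  then have "coef (frag_of (path_word c p)) q =
      (if q \<in> paths \<and> fst q = fst p \<and> snd q = snd p then c else 0)"
    using cf_atoms[of "snd p" "snd q"] by (auto simp: coef_simps word_coef_def path_word_def fsupp_single single_apply)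
  then show "coef (frag_of (path_word c p)) q = single p c q"
    using prod.expand[of q p] assms by (auto simp: single_apply)
qed

lemma emb_0_add: "emb (\<lambda>_. 0) \<oplus>\<^bsub>R\<^esub> emb (\<lambda>_. 0) = emb (\<lambda>_. 0)"
  by (subst R.emb_add) (auto simp: fsupp_0)

text \<open>The additivity relator for \<open>0 + 0 = 0\<close> is the negative of this
  generator.\<close>

lemma zero_head_K: "(emb (\<lambda>_. 0), ms) \<in> tensor_words G d \<Longrightarrow> frag_of (emb (\<lambda>_. 0), ms) \<in> K d"
  using K_minus[OF relator_K[OF tensor_relators.add_head[of "emb (\<lambda>_. 0)" ms G d "emb (\<lambda>_. 0)" R]]]
  by (simp add: emb_0_add)

lemma zero_factor_K: "(s, us @ emb (\<lambda>_. 0) # vs) \<in> tensor_words G d \<Longrightarrow> frag_of (s, us @ emb (\<lambda>_. 0) # vs) \<in> K d"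
  using K_minus[OF relator_K[OF tensor_relators.add_factor[of s us "emb (\<lambda>_. 0)" vs G d "emb (\<lambda>_. 0)" R]]]
  by (simp add: emb_0_add)

lemma path_word_0_K: "p \<in> paths \<Longrightarrow> plen p = d \<Longrightarrow> frag_of (path_word 0 p) \<in> K d"
proof -
  assume "p \<in> paths" "plen p = d"
  moreover have "single (fst p) 0 = (\<lambda>_. 0 :: 'k)" by (auto simp: single_apply fun_eq_iff)
  ultimately show ?thesis
    using path_word_W[of p 0] by (auto simp: path_word_def intro: zero_head_K)
qed

lemma path_word_add_K: "p \<in> paths \<Longrightarrow> plen p = d \<Longrightarrow>
  frag_of (path_word (c + c') p) - frag_of (path_word c p) - frag_of (path_word c' p) \<in> K d"
proof -
  assume p: "p \<in> paths" "plen p = d"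
  have "fst p \<in> S" using path_ob[of "fst p" "snd p"] p ob_S by auto
  then have "\<xi> (fst p) c \<oplus>\<^bsub>R\<^esub> \<xi> (fst p) c' = emb (\<lambda>x. single (fst p) c x + single (fst p) c' x)"
    by (simp add: R.emb_add fsupp_single)
  also have "(\<lambda>x. single (fst p) c x + single (fst p) c' x) = single (fst p) (c + c')"
    by (auto simp: single_apply fun_eq_iff)
  finally have "\<xi> (fst p) c \<oplus>\<^bsub>R\<^esub> \<xi> (fst p) c' = \<xi> (fst p) (c + c')" .
  then show ?thesis
    using tensor_relators.add_head[of "\<xi> (fst p) c" "map (\<lambda>x. \<xi> x 1) (snd p)" G d "\<xi> (fst p) c'" R]
      path_word_W[OF p(1), of c] path_word_W[OF p(1), of c'] p(2)
    by (auto simp: path_word_def intro: relator_K)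
qed

definition nf :: "nat \<Rightarrow> ('s \<times> 's list \<Rightarrow> 'k) \<Rightarrow> 'a tensor_word \<Rightarrow>\<^sub>0 int" where
  "nf d f = (\<Sum>p | f p \<noteq> 0 \<and> plen p = d. frag_of (path_word (f p) p))"

lemma finite_support: "f \<in> fsupp B \<Longrightarrow> finite {p. f p \<noteq> 0 \<and> Q p}"
  by (rule finite_subset[of _ "{p. f p \<noteq> 0}"]) (auto simp: fsupp_def)

lemma nf_superset:
  assumes "finite Z" "Z \<subseteq> {p \<in> paths. plen p = d}" "{p. f p \<noteq> 0 \<and> plen p = d} \<subseteq> Z"
  shows "(\<Sum>p\<in>Z. frag_of (path_word (f p) p)) - nf d f \<in> K d"
proof -
  let ?Y = "{p. f p \<noteq> 0 \<and> plen p = d}"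
  have "(\<Sum>p\<in>Z. frag_of (path_word (f p) p)) - nf d f = (\<Sum>p\<in>Z - ?Y. frag_of (path_word (f p) p))"
    unfolding nf_def using assms by (subst sum.subset_diff[of ?Y Z]) auto
  also have "\<dots> \<in> K d"
  proof (rule K_sum)
    fix p assume "p \<in> Z - ?Y"
    then have "f p = 0" "p \<in> paths" "plen p = d" using assms(2) by auto
    then show "frag_of (path_word (f p) p) \<in> K d" by (simp add: path_word_0_K)
  qed
  finally show ?thesis .
qed

text \<open>The generators of the free group do not depend additively on the scalar, so normal forms
  add up only modulo the relations. Both supports are first enlarged to a common finite set, where
  the added words have scalar 0 and are relations themselves.\<close>

lemma nf_add:
  assumes f: "f \<in> fsupp paths" and g: "g \<in> fsupp paths"
  shows "nf d (\<lambda>p. f p + g p) - nf d f - nf d g \<in> K d"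
proof -
  let ?h = "\<lambda>p. f p + g p"
  let ?Z = "{p. f p \<noteq> 0 \<and> plen p = d} \<union> {p. g p \<noteq> 0 \<and> plen p = d}"
  have Z: "finite ?Z" "?Z \<subseteq> {p \<in> paths. plen p = d}" "{p. ?h p \<noteq> 0 \<and> plen p = d} \<subseteq> ?Z"
    using f g finite_support[OF f] finite_support[OF g] by (auto simp: fsupp_def)
  let ?s = "\<lambda>f. \<Sum>p\<in>?Z. frag_of (path_word (f p) p)"
  have 1: "?s ?h - nf d ?h \<in> K d" "?s f - nf d f \<in> K d" "?s g - nf d g \<in> K d"
    by (rule nf_superset; use Z in auto)+
  have "?s ?h - ?s f - ?s g \<in> K d"
    unfolding sum_subtractf[symmetric] using Z(2) by (intro K_sum path_word_add_K) auto
  from K_add[OF K_add[OF K_diff[OF this 1(1)] 1(2)] 1(3)] show ?thesis by (simp add: algebra_simps)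
qed

lemma coef_sum: "coef (\<Sum>i\<in>I. x i) = (\<lambda>p. \<Sum>i\<in>I. coef (x i) p)"
  by (auto simp: coef_def frag_lin_sum)

lemma coef_nf:
  assumes f: "f \<in> fsupp paths" shows "coef (nf d f) p = (if plen p = d then f p else 0)"
proof -
  have "coef (nf d f) p = (\<Sum>q | f q \<noteq> 0 \<and> plen q = d. single q (f q) p)"
    unfolding nf_def coef_sum
  proof (rule sum.cong[OF refl])
    fix q assume "q \<in> {q. f q \<noteq> 0 \<and> plen q = d}"
    then have "q \<in> paths" using f by (auto simp: fsupp_def)
    then show "coef (frag_of (path_word (f q) q)) p = single q (f q) p" by (simp add: coef_path_word)
  qed
  also have "\<dots> = (if plen p = d then f p else 0)"
    using finite_support[OF f] by (auto simp: single_apply fun_eq_iff)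
  finally show ?thesis .
qed

lemma nf_carrier: "f \<in> fsupp paths \<Longrightarrow> nf d f \<in> carrier (FG d)"
  unfolding nf_def
proof (rule sum_closed_free_Abelian_group)
  fix p assume "f \<in> fsupp paths" "p \<in> {p. f p \<noteq> 0 \<and> plen p = d}"
  then have "p \<in> paths" "plen p = d" by (auto simp: fsupp_def)
  then show "frag_of (path_word (f p) p) \<in> carrier (FG d)"
    using path_word_W[of p "f p"] by simp
qed

definition reducible :: "nat \<Rightarrow> ('a tensor_word \<Rightarrow>\<^sub>0 int) \<Rightarrow> bool" where
  "reducible d x \<longleftrightarrow> (\<exists>f\<in>fsupp paths. x - nf d f \<in> K d)"

lemma reducible_add: "reducible d x \<Longrightarrow> reducible d y \<Longrightarrow> reducible d (x + y)"
proof -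
  assume "reducible d x" "reducible d y"
  then obtain f g where f: "f \<in> fsupp paths" "x - nf d f \<in> K d" and g: "g \<in> fsupp paths" "y - nf d g \<in> K d"
    by (auto simp: reducible_def)
  have "(x - nf d f) + (y - nf d g) - (nf d (\<lambda>p. f p + g p) - nf d f - nf d g) \<in> K d"
    by (rule K_diff[OF K_add[OF f(2) g(2)] nf_add[OF f(1) g(1)]])
  then show ?thesis
    unfolding reducible_def using f g by (intro bexI[of _ "\<lambda>p. f p + g p"]) (auto simp: algebra_simps fsupp_add)
qed

lemma nf_0: "nf d (\<lambda>_. 0) = 0"
  by (simp add: nf_def)

lemma reducible_minus: "reducible d x \<Longrightarrow> reducible d (- x)"
proof -
  assume "reducible d x"
  then obtain f where f: "f \<in> fsupp paths" "x - nf d f \<in> K d"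
    by (auto simp: reducible_def)
  have "(nf d (\<lambda>p. f p + - f p) - nf d f - nf d (\<lambda>p. - f p)) - (x - nf d f) \<in> K d"
    by (rule K_diff[OF nf_add[OF f(1) fsupp_uminus[OF f(1)]] f(2)])
  also have "(nf d (\<lambda>p. f p + - f p) - nf d f - nf d (\<lambda>p. - f p)) - (x - nf d f) = - x - nf d (\<lambda>p. - f p)"
    by (simp add: nf_0)
  finally show ?thesis
    unfolding reducible_def using f
    by (intro bexI[of _ "\<lambda>p. - f p"]) (auto simp: fsupp_uminus)
qed

lemma reducible_K: "reducible d y \<Longrightarrow> x - y \<in> K d \<Longrightarrow> reducible d x"
proof -
  assume "reducible d y" and xy: "x - y \<in> K d"
  then obtain f where f: "f \<in> fsupp paths" "y - nf d f \<in> K d"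
    by (auto simp: reducible_def)
  from K_add[OF xy f(2)] have "x - nf d f \<in> K d" by simp
  with f(1) show ?thesis unfolding reducible_def by blast
qed

lemma reducible_in_K: "x \<in> K d \<Longrightarrow> reducible d x"
  unfolding reducible_def by (rule bexI[of _ "\<lambda>_. 0"]) (auto simp: nf_0 fsupp_0)

text \<open>The scalar on \<open>y\<close> is the action of a multiple of the identity at the source
  of \<open>y\<close>. Balancedness carries it across the tensor sign to the arrow before, and
  repeating this brings it to the leading factor.\<close>

lemma move_scalar:
  assumes "(a, us @ [y]) \<in> paths" "set vs \<subseteq> G 1" "d = Suc (length us + length vs)"
  shows "frag_of (\<xi> a c, map (\<lambda>x. \<xi> x 1) us @ \<xi> y c' # vs) -
    frag_of (\<xi> a (c * c'), map (\<lambda>x. \<xi> x 1) us @ \<xi> y 1 # vs) \<in> K d"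
  using assms
proof (induction us arbitrary: y vs rule: rev_induct)
  case Nil
  then have a: "a \<in> ob" "y \<in> S" "len y = 1" "src y = a" by (auto simp: paths_def)
  have "frag_of (\<xi> a c \<otimes>\<^bsub>R\<^esub> \<xi> a c', \<xi> y 1 # vs) - frag_of (\<xi> a c, (\<xi> a c' \<otimes>\<^bsub>R\<^esub> \<xi> y 1) # vs) \<in> K d"
    by (rule relator_K, rule tensor_relators.balanced_head)
      (use Nil a in \<open>auto simp: tensor_words_def ob_G single_G\<close>)
  moreover have "a \<in> S" using a ob_S by auto
  ultimately have "- (frag_of (\<xi> a (c * c'), \<xi> y 1 # vs) - frag_of (\<xi> a c, \<xi> y c' # vs)) \<in> K d"
    using a by (intro K_minus) (simp add: single_mult_left src_id)
  then show ?case by simp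
next
  case (snoc z us)
  have p: "(a, us @ [z]) \<in> paths" using snoc.prems(1) by (simp only: snoc_paths)
  have zy: "tgt z = src y" using path_adjacent[of a us z y "[]"] snoc.prems(1) by simp
  have S: "z \<in> S" "len z = 1" "y \<in> S" "len y = 1" "tgt z \<in> ob" "a \<in> ob"
    using path_atoms[OF snoc.prems(1)] path_ob[OF snoc.prems(1)] by (auto simp: tgt_ob)
  let ?us = "map (\<lambda>x. \<xi> x 1) us"
  have us: "set ?us \<subseteq> G 1" using p by (intro atoms_G[of a]) (auto simp: paths_append)
  have "frag_of (\<xi> a c, ?us @ (\<xi> z 1 \<otimes>\<^bsub>R\<^esub> \<xi> (tgt z) c') # \<xi> y 1 # vs) -
      frag_of (\<xi> a c, ?us @ \<xi> z 1 # (\<xi> (tgt z) c' \<otimes>\<^bsub>R\<^esub> \<xi> y 1) # vs) \<in> K d"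
    by (rule relator_K, rule tensor_relators.balanced_factor)
      (use snoc.prems us S in \<open>auto simp: tensor_words_def ob_G single_G\<close>)
  then have 1: "frag_of (\<xi> a c, ?us @ \<xi> z c' # \<xi> y 1 # vs) - frag_of (\<xi> a c, ?us @ \<xi> z 1 # \<xi> y c' # vs) \<in> K d"
    using S zy by (simp add: single_mult_left single_mult_right)
  have 2: "frag_of (\<xi> a c, ?us @ \<xi> z c' # \<xi> y 1 # vs) - frag_of (\<xi> a (c * c'), ?us @ \<xi> z 1 # \<xi> y 1 # vs) \<in> K d"
    using snoc.IH[of z "\<xi> y 1 # vs"] p snoc.prems S by (simp add: single_G)
  from K_diff[OF 2 1] show ?case by simp
qed

lemma reducible_path_word: assumes "p \<in> paths" shows "reducible (plen p) (frag_of (path_word c p))"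
proof (cases "c = 0")
  case True
  then show ?thesis using path_word_0_K[OF assms refl] by (simp add: reducible_in_K)
next
  case False
  have "{q. single p c q \<noteq> 0 \<and> plen q = plen p} = {p}" using False by (auto simp: single_apply fun_eq_iff)
  then have "nf (plen p) (single p c) = frag_of (path_word c p)" by (simp add: nf_def single_apply)
  then show ?thesis
    unfolding reducible_def using assms by (intro bexI[of _ "single p c"]) (auto simp: K_0 fsupp_single)
qed

text \<open>The initial factors are already the arrows of a path. The next factor is expanded in
  basis arrows; an arrow that continues the path passes its scalar to the head and lengthens the
  path, while any other arrow makes the tensor a relation.\<close>

lemma reducible_prefix:
  "(a, xs) \<in> paths \<Longrightarrow> set ms \<subseteq> G 1 \<Longrightarrow> d = length xs + length ms \<Longrightarrow>
    reducible d (frag_of (\<xi> a c, map (\<lambda>x. \<xi> x 1) xs @ ms))"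
proof (induction ms arbitrary: xs c)
  case Nil
  then show ?case using reducible_path_word[of "(a, xs)" c] by (simp add: path_word_def)
next
  case (Cons m ms)
  let ?xs = "map (\<lambda>x. \<xi> x 1) xs"
  have a: "a \<in> ob" "\<xi> a c \<in> G 0" using path_ob[OF Cons.prems(1)] by (auto simp: ob_G)
  have W: "(s, ?xs @ m' # ms) \<in> tensor_words G d" if "m' \<in> G 1" "s \<in> G 0" for m' s
    using atoms_G[OF Cons.prems(1)] a Cons.prems that by (auto simp: tensor_words_def)
  have single: "reducible d (frag_of (\<xi> a c, ?xs @ \<xi> b c' # ms))" if b: "b \<in> S" "len b = 1" for b c'
  proof (cases "tgt (val (a, xs)) = src b")
    case True
    then have p: "(a, xs @ [b]) \<in> paths" using Cons.prems b by (simp add: snoc_paths)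
    have "reducible d (frag_of (\<xi> a (c * c'), map (\<lambda>x. \<xi> x 1) (xs @ [b]) @ ms))"
      using Cons.prems by (intro Cons.IH p) auto
    moreover have "frag_of (\<xi> a c, ?xs @ \<xi> b c' # ms) - frag_of (\<xi> a (c * c'), ?xs @ \<xi> b 1 # ms) \<in> K d"
      using Cons.prems by (intro move_scalar p) auto
    ultimately show ?thesis by (auto intro: reducible_K)
  next
    case False
    \<comment> \<open>The identity at the source of \<open>b\<close> fixes \<open>b\<close> from the
      left and annihilates the preceding factor from the right. Moving it across the tensor sign
      makes the tensor zero.\<close>
    let ?t = "\<xi> (src b) 1"
    have t: "src b \<in> ob" "?t \<in> G 0" using b src_ob ob_G by auto
    have bt: "?t \<otimes>\<^bsub>R\<^esub> \<xi> b c' = \<xi> b c'" using b t by (simp add: single_mult_left)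
    show ?thesis
    proof (cases xs rule: rev_cases)
      case Nil
      have "frag_of (\<xi> a c \<otimes>\<^bsub>R\<^esub> ?t, \<xi> b c' # ms) - frag_of (\<xi> a c, (?t \<otimes>\<^bsub>R\<^esub> \<xi> b c') # ms) \<in> K d"
        by (rule relator_K, rule tensor_relators.balanced_head)
          (use W[of "\<xi> b c'"] a b t Nil in \<open>auto simp: single_G\<close>)
      moreover have "\<xi> a c \<otimes>\<^bsub>R\<^esub> ?t = emb (\<lambda>_. 0)"
        using False Nil a t ob_S by (auto simp: single_mult_right tgt_id val_nil)
      moreover have "frag_of (emb (\<lambda>_. 0), \<xi> b c' # ms) \<in> K d"
        using W[of "\<xi> b c'" "emb (\<lambda>_. 0)"] b Nil by (auto simp: single_G zero_G intro!: zero_head_K)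
      ultimately have "frag_of (\<xi> a c, \<xi> b c' # ms) \<in> K d"
        using bt K_diff[of "frag_of (emb (\<lambda>_. 0), \<xi> b c' # ms)" d
            "frag_of (emb (\<lambda>_. 0), \<xi> b c' # ms) - frag_of (\<xi> a c, \<xi> b c' # ms)"] by simp
      then show ?thesis using Nil by (auto intro: reducible_in_K)
    next
      case (snoc ys z)
      let ?ys = "map (\<lambda>x. \<xi> x 1) ys"
      have z: "z \<in> S" "len z = 1" "tgt z = tgt (val (a, xs))"
        using Cons.prems(1) snoc by (auto simp: snoc_paths val_snoc tgt_cmp val_S)
      have "frag_of (\<xi> a c, ?ys @ (\<xi> z 1 \<otimes>\<^bsub>R\<^esub> ?t) # \<xi> b c' # ms) -
          frag_of (\<xi> a c, ?ys @ \<xi> z 1 # (?t \<otimes>\<^bsub>R\<^esub> \<xi> b c') # ms) \<in> K d"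
        by (rule relator_K, rule tensor_relators.balanced_factor)
          (use W[of "\<xi> b c'"] a b t snoc in \<open>auto simp: single_G\<close>)
      moreover have "\<xi> z 1 \<otimes>\<^bsub>R\<^esub> ?t = emb (\<lambda>_. 0)"
        using False z t by (auto simp: single_mult_right)
      moreover have "frag_of (\<xi> a c, ?ys @ emb (\<lambda>_. 0) # \<xi> b c' # ms) \<in> K d"
        using W[of "\<xi> b c'" "\<xi> a c"] a b snoc
        by (intro zero_factor_K) (auto simp: single_G zero_G tensor_words_def)
      ultimately have "frag_of (\<xi> a c, ?ys @ \<xi> z 1 # \<xi> b c' # ms) \<in> K d"
        using bt K_diff[of "frag_of (\<xi> a c, ?ys @ emb (\<lambda>_. 0) # \<xi> b c' # ms)" d
            "frag_of (\<xi> a c, ?ys @ emb (\<lambda>_. 0) # \<xi> b c' # ms) - frag_of (\<xi> a c, ?ys @ \<xi> z 1 # \<xi> b c' # ms)"] by simp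
      then show ?thesis using snoc by (auto intro: reducible_in_K)
    qed
  qed
  have m: "m \<in> G 1" using Cons.prems by auto
  have "reducible d (frag_of (\<xi> a c, ?xs @ emb (co m) # ms))"
    using co_fsupp[OF m]
  proof (induction rule: fsupp_induct)
    case zero
    show ?case using W[OF zero_G a(2)] by (auto intro: reducible_in_K zero_factor_K)
  next
    case (add b c' g)
    then have b: "b \<in> S" "len b = 1" "emb g \<in> G 1"
      using co_len[OF m] by (auto intro!: emb_G)
    have "emb (\<lambda>x. single b c' x + g x) = \<xi> b c' \<oplus>\<^bsub>R\<^esub> emb g"
      using add by (simp add: R.emb_add fsupp_single)
    then have "frag_of (\<xi> a c, ?xs @ emb (\<lambda>x. single b c' x + g x) # ms) -
        (frag_of (\<xi> a c, ?xs @ \<xi> b c' # ms) + frag_of (\<xi> a c, ?xs @ emb g # ms)) \<in> K d"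
      using relator_K[OF tensor_relators.add_factor[OF W[OF single_G[OF b(1,2)] a(2)] W[OF b(3) a(2)]]]
      by (simp add: algebra_simps)
    then show ?case using single[OF b(1,2)] add.IH by (blast intro: reducible_K reducible_add)
  qed
  then show ?case using m by (simp add: emb_co)
qed

lemma reducible_word: assumes "w \<in> tensor_words G d" shows "reducible d (frag_of w)"
proof -
  obtain s ms where w: "w = (s, ms)" "s \<in> G 0" "set ms \<subseteq> G 1" "length ms = d"
    using assms by (auto simp: tensor_words_def)
  have W: "(s', ms) \<in> tensor_words G d" if "s' \<in> G 0" for s'
    using w that by (auto simp: tensor_words_def)
  have "reducible d (frag_of (emb (co s), ms))"
    using co_fsupp[OF w(2)]
  proof (induction rule: fsupp_induct)
    case zero
    show ?case using W[OF zero_G] by (auto intro: reducible_in_K zero_head_K)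
  next
    case (add b c g)
    then have b: "b \<in> ob" "emb g \<in> G 0" using co_len[OF w(2)] len_0 by (auto intro!: emb_G)
    have "reducible d (frag_of (\<xi> b c, ms))"
      using reducible_prefix[of b "[]" ms d c] b w by (simp add: nil_paths)
    moreover have "emb (\<lambda>x. single b c x + g x) = \<xi> b c \<oplus>\<^bsub>R\<^esub> emb g"
      using add by (simp add: R.emb_add fsupp_single)
    then have "frag_of (emb (\<lambda>x. single b c x + g x), ms) - (frag_of (\<xi> b c, ms) + frag_of (emb g, ms)) \<in> K d"
      using relator_K[OF tensor_relators.add_head[OF W[OF ob_G[OF b(1)]] W[OF b(2)]]]
      by (simp add: algebra_simps)
    ultimately show ?case using add.IH by (blast intro: reducible_K reducible_add)
  qed
  then show ?thesis using w by (simp add: emb_co)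
qed

lemma reducible: assumes "x \<in> carrier (FG d)" shows "reducible d x"
proof -
  have "Poly_Mapping.keys x \<subseteq> tensor_words G d" using assms by simp
  then show ?thesis
  proof (induction x rule: frag_induction)
    case (diff x y)
    then show ?case using reducible_add[OF _ reducible_minus, of d x y] by simp
  qed (auto intro: reducible_word reducible_in_K K_0)
qed

text \<open>Modulo the relations, \<open>x\<close> is a normal form with the same coefficients. If
  these vanish, the normal form is an empty sum, so nothing but a relation is left.\<close>

lemma K_iff: assumes "x \<in> carrier (FG d)" shows "x \<in> K d \<longleftrightarrow> coef x = (\<lambda>_. 0)"
proof
  assume 0: "coef x = (\<lambda>_. 0)"
  obtain f where f: "f \<in> fsupp paths" "x - nf d f \<in> K d"
    using reducible[OF assms] by (auto simp: reducible_def)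
  from K_coef[OF f(2)] 0 have "coef (nf d f) = (\<lambda>_. 0)" by (auto simp: coef_simps fun_eq_iff)
  then have "f p = 0" if "plen p = d" for p using coef_nf[OF f(1), of d p] that by simp
  then have "{p. f p \<noteq> 0 \<and> plen p = d} = {}" by blast
  then have "nf d f = 0" by (simp only: nf_def sum.empty)
  with f show "x \<in> K d" by simp
qed (rule K_coef)

end

section \<open>The tensor algebra as the path algebra\<close>

context graded_path_ring
begin

text \<open>A coset of the relations, described by the coefficients of its members instead of a
  representative; it depends only on the values of \<open>f\<close> on paths of length
  \<open>d\<close>.\<close>

definition TC :: "nat \<Rightarrow> ('s \<times> 's list \<Rightarrow> 'k) \<Rightarrow> ('a tensor_word \<Rightarrow>\<^sub>0 int) set" where
  "TC d f = {x \<in> carrier (FG d). \<forall>p\<in>paths. plen p = d \<longrightarrow> coef x p = f p}"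

lemma TC_cong: "(\<And>p. p \<in> paths \<Longrightarrow> plen p = d \<Longrightarrow> f p = g p) \<Longrightarrow> TC d f = TC d g"
  unfolding TC_def by auto

lemma FG_add: "x \<in> carrier (FG d) \<Longrightarrow> y \<in> carrier (FG d) \<Longrightarrow> x + y \<in> carrier (FG d)"
  using keys_add[of x y] by auto

lemma FG_diff: "x \<in> carrier (FG d) \<Longrightarrow> y \<in> carrier (FG d) \<Longrightarrow> x - y \<in> carrier (FG d)"
  using keys_diff[of x y] by auto

lemma coset_TC: assumes x: "x \<in> carrier (FG d)" shows "K d #>\<^bsub>FG d\<^esub> x = TC d (coef x)"
proof (intro equalityI subsetI)
  fix y assume "y \<in> K d #>\<^bsub>FG d\<^esub> x"
  then obtain h where h: "h \<in> K d" "y = h + x" by (auto simp: r_coset_def)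
  then show "y \<in> TC d (coef x)"
    using K_coef[OF h(1)] FG_add[OF K_carrier[OF h(1)] x] by (simp add: TC_def coef_simps)
next
  fix y assume "y \<in> TC d (coef x)"
  then have y: "y \<in> carrier (FG d)" "\<And>p. p \<in> paths \<Longrightarrow> plen p = d \<Longrightarrow> coef y p = coef x p"
    unfolding TC_def by blast+
  have "coef (y - x) p = 0" for p
  proof (cases "p \<in> paths \<and> plen p = d")
    case True
    then show ?thesis using y(2) by (simp add: coef_simps)
  next
    case False
    then have "coef x p = 0" "coef y p = 0"
      using coef_len[OF x, of p] coef_len[OF y(1), of p]
        fsupp_outside[OF coef_fsupp[OF x], of p] fsupp_outside[OF coef_fsupp[OF y(1)], of p] by blast+
    then show ?thesis by (simp add: coef_simps)
  qed
  then have "y - x \<in> K d" using FG_diff[OF y(1) x] by (subst K_iff) auto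
  then show "y \<in> K d #>\<^bsub>FG d\<^esub> x" by (force simp: r_coset_def)
qed

lemma TC_nf: "f \<in> fsupp paths \<Longrightarrow> TC d f = K d #>\<^bsub>FG d\<^esub> nf d f"
  unfolding coset_TC[OF nf_carrier] by (rule TC_cong) (simp add: coef_nf)

lemma normal_K: "K d \<lhd> FG d"
  using comm_group.subgroup_imp_normal[OF abelian_free_Abelian_group subgroup_K] .

lemma TC_eq_iff: "f \<in> fsupp paths \<Longrightarrow> g \<in> fsupp paths \<Longrightarrow>
  TC d f = TC d g \<longleftrightarrow> (\<forall>p\<in>paths. plen p = d \<longrightarrow> f p = g p)"
proof
  assume f: "f \<in> fsupp paths" and eq: "TC d f = TC d g"
  have "nf d f \<in> TC d f" using f nf_carrier[OF f] by (simp add: TC_def coef_nf del: carrier_free_Abelian_group_iff)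
  then have "nf d f \<in> TC d g" by (simp add: eq)
  then show "\<forall>p\<in>paths. plen p = d \<longrightarrow> f p = g p" using coef_nf[OF f] by (simp add: TC_def)
qed (rule TC_cong, blast)

lemma TC_add: assumes "f \<in> fsupp paths" "g \<in> fsupp paths"
  shows "TC d f <#>\<^bsub>FG d\<^esub> TC d g = TC d (\<lambda>p. f p + g p)"
proof -
  have "TC d f <#>\<^bsub>FG d\<^esub> TC d g = K d #>\<^bsub>FG d\<^esub> (nf d f + nf d g)"
    using normal.rcos_sum[OF normal_K nf_carrier[OF assms(1)] nf_carrier[OF assms(2)]] assms
    by (simp add: TC_nf)
  also have "\<dots> = TC d (coef (nf d f + nf d g))"
    by (intro coset_TC FG_add nf_carrier assms)
  also have "\<dots> = TC d (\<lambda>p. f p + g p)"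
    using assms by (intro TC_cong) (simp add: coef_simps coef_nf)
  finally show ?thesis .
qed

lemma TC_0: "K d = TC d (\<lambda>_. 0)"
  using TC_nf[OF fsupp_0, of d] subgroup.rcos_const[OF subgroup_K, of d 0] K_0
    group.coset_mult_one[of "FG d" "K d"] K_carrier
  by (auto simp: nf_0)

lemma word_mult_W: "v \<in> tensor_words G i \<Longrightarrow> w \<in> tensor_words G j \<Longrightarrow> word_mult R v w \<in> tensor_words G (i + j)"
proof -
  assume vw: "v \<in> tensor_words G i" "w \<in> tensor_words G j"
  obtain s ms t ns where e: "v = (s, ms)" "w = (t, ns)" by (cases v, cases w)
  with vw have *: "s \<in> G 0" "t \<in> G 0" "set ms \<subseteq> G 1" "set ns \<subseteq> G 1" "length ms = i" "length ns = j"
    by (auto simp: tensor_words_def)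
  show ?thesis
  proof (cases ms rule: rev_cases)
    case Nil
    then show ?thesis using * e by (auto simp: tensor_words_def mult_G0_left)
  next
    case (snoc us m)
    then show ?thesis using * e by (auto simp: tensor_words_def mult_G0_right)
  qed
qed

text \<open>Only the cut after \<open>i\<close> arrows contributes. The absorbed factor
  \<open>t\<close> acts by its coordinate at the vertex where the two paths meet, whether it is
  absorbed by the last arrow or, when \<open>ms\<close> is empty, by the head.\<close>

lemma word_coef_mult:
  assumes vw: "v \<in> tensor_words G i" "w \<in> tensor_words G j"
  shows "word_coef (word_mult R v w) = pa.conv (word_coef v) (word_coef w)"
proof
  fix p
  obtain s ms t ns where e: "v = (s, ms)" "w = (t, ns)" by (cases v, cases w)
  with vw have *: "s \<in> G 0" "t \<in> G 0" "set ms \<subseteq> G 1" "set ns \<subseteq> G 1" "length ms = i" "length ns = j"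
    by (auto simp: tensor_words_def)
  have lw: "length (snd (word_mult R v w)) = i + j"
    using word_mult_W[OF vw] by (auto simp: tensor_words_def)
  have vlen: "plen q = i" if "word_coef v q \<noteq> 0" for q
    using that * e by (auto simp: word_coef_def split: if_splits)
  show "word_coef (word_mult R v w) p = pa.conv (word_coef v) (word_coef w) p"
  proof (cases "p \<in> paths \<and> i \<le> plen p")
    case False
    then have l: "word_coef (word_mult R v w) p = 0" using lw by (auto simp: word_coef_def)
    have "(case u of (x, y) \<Rightarrow> word_coef v x * word_coef w y) = 0" if "u \<in> pa.splits p" for u
    proof -
      obtain x y where Pair: "u = (x, y)" by (cases u)
      with that have "(x, y) \<in> pa.splits p" by simp
      note d = splitsD(3-)[OF this]
      have "plen p = plen x + plen y" "p \<in> paths"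
        using d(1) pcat_paths[OF d(2-4)] d(5) by simp_all
      then have "word_coef v x = 0" using False vlen[of x] by auto
      then show ?thesis by (simp add: Pair)
    qed
    then show ?thesis unfolding l pa.conv_def by simp
  next
    case True
    let ?x = "(fst p, take i (snd p))"
    let ?y = "(tgt (val ?x), drop i (snd p))"
    have conv: "pa.conv (word_coef v) (word_coef w) p = word_coef v ?x * word_coef w ?y"
      using True vlen by (intro conv_paths_at) auto
    have xy: "?x \<in> paths" "?y \<in> paths" using splitsD(4,5)[OF splits_take_drop] True by blast+
    show ?thesis
    proof (cases "plen p = i + j")
      case False
      then show ?thesis unfolding conv using lw True * e by (auto simp: word_coef_def)
    next
      case len: True
      have r: "word_coef v ?x * word_coef w ?y =
          (co s (fst p) * cf ms (take i (snd p))) * (co t (tgt (val ?x)) * cf ns (drop i (snd p)))"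
        using xy len * by (simp add: word_coef_def e)
      show ?thesis
      proof (cases ms rule: rev_cases)
        case Nil
        have "fst p \<in> ob" using True fst_ob by blast
        then have "tgt (val ?x) = fst p" "src (fst p) = fst p" using Nil * by (auto simp: val_nil tgt_id src_id)
        then show ?thesis
          unfolding conv r using Nil True * lw len e mult_G0_left(2)[of s t 0] by (simp add: word_coef_def)
      next
        case (snoc us m)
        then have "length (take i (snd p)) = Suc (length us)" using len * by simp
        then obtain ys z where yz: "take i (snd p) = ys @ [z]" "length ys = length us"
          by (metis length_Suc_conv_rev)
        then have p: "snd p = ys @ z # drop i (snd p)" by (metis append_Cons append_Nil append_assoc append_take_drop_id)
        have "tgt (val ?x) = tgt z" using xy(1) unfolding yz by (auto simp: snoc_paths val_snoc tgt_cmp val_S)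
        moreover have "m \<in> G 1" using snoc * by auto
        moreover have "cf (us @ m \<otimes>\<^bsub>R\<^esub> t # ns) (snd p) = cf us ys * (co (m \<otimes>\<^bsub>R\<^esub> t) z * cf ns (drop i (snd p)))"
          by (subst p, subst cf_append) (use yz in auto)
        moreover have "cf ms (take i (snd p)) = cf us ys * co m z"
          unfolding yz snoc by (subst cf_append) (use yz in auto)
        ultimately show ?thesis
          unfolding conv r using snoc True * lw len e mult_G0_right(2)[of t m 1] by (simp add: word_coef_def)
      qed
    qed
  qed
qed

lemma conv_diff_left: "pa.conv (\<lambda>b. f b - f' b) g = (\<lambda>b. pa.conv f g b - pa.conv f' g b)"
  by (rule ext) (simp add: pa.conv_def case_prod_unfold left_diff_distrib sum_subtractf)

lemma conv_diff_right: "pa.conv f (\<lambda>b. g b - g' b) = (\<lambda>b. pa.conv f g b - pa.conv f g' b)"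
  by (rule ext) (simp add: pa.conv_def case_prod_unfold right_diff_distrib sum_subtractf)

lemma frag_mult_word:
  assumes v: "v \<in> tensor_words G i" and b: "Poly_Mapping.keys b \<subseteq> tensor_words G j"
  shows "frag_mult R (frag_of v) b \<in> carrier (FG (i + j)) \<and>
    coef (frag_mult R (frag_of v) b) = pa.conv (word_coef v) (coef b)"
  using b
proof (induction b rule: frag_induction)
  case zero
  then show ?case by (simp add: frag_mult_def coef_simps pa.conv_zero)
next
  case (one w)
  then show ?case using word_mult_W[OF v one] word_coef_mult[OF v one] by (simp add: frag_mult_def coef_simps)
next
  case (diff a b)
  have "frag_mult R (frag_of v) (a - b) = frag_mult R (frag_of v) a - frag_mult R (frag_of v) b"
    by (simp add: frag_mult_def frag_extend_diff)
  then show ?case using diff by (simp only: coef_simps conv_diff_right FG_diff)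
qed

lemma frag_mult:
  assumes "a \<in> carrier (FG i)" "b \<in> carrier (FG j)"
  shows "frag_mult R a b \<in> carrier (FG (i + j))" "coef (frag_mult R a b) = pa.conv (coef a) (coef b)"
proof -
  have b: "Poly_Mapping.keys b \<subseteq> tensor_words G j" and a: "Poly_Mapping.keys a \<subseteq> tensor_words G i"
    using assms by auto
  from a have "frag_mult R a b \<in> carrier (FG (i + j)) \<and> coef (frag_mult R a b) = pa.conv (coef a) (coef b)"
  proof (induction a rule: frag_induction)
    case zero
    then show ?case by (simp add: frag_mult_def coef_simps pa.conv_zero)
  next
    case (one w)
    then show ?case using frag_mult_word[OF one b] by (simp add: coef_simps)
  next
    case (diff a a')
    have "frag_mult R (a - a') b = frag_mult R a b - frag_mult R a' b"
      by (simp add: frag_mult_def frag_extend_diff)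
    then show ?case using diff by (simp only: coef_simps conv_diff_left FG_diff)
  qed
  then show "frag_mult R a b \<in> carrier (FG (i + j))" "coef (frag_mult R a b) = pa.conv (coef a) (coef b)"
    by auto
qed

lemma TC_coef:
  assumes "x \<in> TC d f" "f \<in> fsupp paths" shows "coef x = (\<lambda>p. if plen p = d then f p else 0)"
proof
  fix p
  have x: "x \<in> carrier (FG d)" "p \<in> paths \<Longrightarrow> plen p = d \<Longrightarrow> coef x p = f p"
    using assms unfolding TC_def by auto
  show "coef x p = (if plen p = d then f p else 0)"
  proof (cases "p \<in> paths \<and> plen p = d")
    case True
    then show ?thesis using x(2) by simp
  next
    case False
    then have "coef x p = 0"
      using coef_len[OF x(1), of p] fsupp_outside[OF coef_fsupp[OF x(1)], of p] by blast
    then show ?thesis using False fsupp_outside[OF assms(2), of p] by auto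
  qed
qed

lemma TC_nonempty: "f \<in> fsupp paths \<Longrightarrow> nf d f \<in> TC d f"
  using nf_carrier[of f d] by (simp add: TC_def coef_nf del: carrier_free_Abelian_group_iff)

sublocale T: graded_model paths pok pcat plen "tensor_power R G" "tensor_mult R G" TC
proof
  show "plen (pcat x y) = plen x + plen y" for x y :: "'s \<times> 's list" by (simp add: pcat_def)
  show "carrier (tensor_power R G d) = TC d ` fsupp paths" for d
  proof -
    have "carrier (tensor_power R G d) = (\<lambda>x. K d #>\<^bsub>FG d\<^esub> x) ` carrier (FG d)"
      by (auto simp: tensor_power_def FactGroup_def RCOSETS_def)
    also have "\<dots> = TC d ` fsupp paths"
    proof (intro equalityI subsetI)
      fix Z assume "Z \<in> (\<lambda>x. K d #>\<^bsub>FG d\<^esub> x) ` carrier (FG d)"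
      then obtain x where "x \<in> carrier (FG d)" "Z = K d #>\<^bsub>FG d\<^esub> x" by blast
      then show "Z \<in> TC d ` fsupp paths" using coset_TC coef_fsupp by blast
    next
      fix Z assume "Z \<in> TC d ` fsupp paths"
      then show "Z \<in> (\<lambda>x. K d #>\<^bsub>FG d\<^esub> x) ` carrier (FG d)" using TC_nf nf_carrier by blast
    qed
    finally show ?thesis .
  qed
  show "\<one>\<^bsub>tensor_power R G d\<^esub> = TC d (\<lambda>_. 0)" for d
    by (simp add: tensor_power_def FactGroup_def TC_0)
  fix f g :: "'s \<times> 's list \<Rightarrow> 'k" assume fg: "f \<in> fsupp paths" "g \<in> fsupp paths"
  show "TC d f = TC d g \<longleftrightarrow> (\<forall>p\<in>paths. plen p = d \<longrightarrow> f p = g p)" for d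
    by (rule TC_eq_iff[OF fg])
  show "TC d f \<otimes>\<^bsub>tensor_power R G d\<^esub> TC d g = TC d (\<lambda>p. f p + g p)" for d
    using TC_add[OF fg] by (simp add: tensor_power_def FactGroup_def)
  show "tensor_mult R G i j (TC i f) (TC j g) =
    TC (i + j) (pa.conv (\<lambda>p. if plen p = i then f p else 0) (\<lambda>p. if plen p = j then g p else 0))" for i j
  proof -
    \<comment> \<open>The product of cosets is a union over all representatives. Each pair
      contributes the same coset, so the union is that coset.\<close>
    have "K (i + j) #>\<^bsub>FG (i + j)\<^esub> frag_mult R a b =
        TC (i + j) (pa.conv (\<lambda>p. if plen p = i then f p else 0) (\<lambda>p. if plen p = j then g p else 0))"
      if "a \<in> TC i f" "b \<in> TC j g" for a b
    proof -
      have ab: "a \<in> carrier (FG i)" "b \<in> carrier (FG j)" using that unfolding TC_def by auto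
      then show ?thesis
        using frag_mult[OF ab] coset_TC TC_coef[OF that(1) fg(1)] TC_coef[OF that(2) fg(2)] by metis
    qed
    then show ?thesis
      using TC_nonempty[OF fg(1), of i] TC_nonempty[OF fg(2), of j] unfolding tensor_mult_def by blast
  qed
qed

lemma one_G: "\<one>\<^bsub>R\<^esub> \<in> G 0" and co_one: "co \<one>\<^bsub>R\<^esub> = (\<lambda>x. if x \<in> ob then 1 else 0)"
  unfolding R.emb_one using R.e_fsupp ob_S len_0 by (auto intro!: emb_G split: if_splits)

sublocale T: convolution_ring paths pok pcat "tensor_algebra R G" T.emb path_unit
  unfolding tensor_algebra_def
proof (rule T.convolution_ring)
  have "(\<one>\<^bsub>R\<^esub>, []) \<in> tensor_words G 0" by (simp add: tensor_words_def one_G)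
  then have "K 0 #>\<^bsub>FG 0\<^esub> frag_of (\<one>\<^bsub>R\<^esub>, []) = TC 0 (coef (frag_of (\<one>\<^bsub>R\<^esub>, [])))"
    by (intro coset_TC) simp
  also have "\<dots> = TC 0 path_unit"
    by (rule TC_cong) (auto simp: coef_simps word_coef_def path_unit_def co_one nil_paths)
  finally show "K 0 #>\<^bsub>FG 0\<^esub> frag_of (\<one>\<^bsub>R\<^esub>, []) = TC 0 path_unit" .
qed (auto simp: path_unit_fsupp, simp add: path_unit_def split: if_splits)

lemma ring_T: "ring (tensor_algebra R G)"
  by (rule T.ring) (auto simp: pcat_assoc conv_path_unit_left conv_path_unit_right)

lemma push_word_nil:
  assumes "s \<in> G 0" shows "push (word_coef (s, [])) = co s"
proof
  fix z
  show "push (word_coef (s, [])) z = co s z"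
  proof (cases "z \<in> ob")
    case True
    then have "len z = 0" using ob_S len_0 by auto
    then have "paths_to z = {(z, [])}" using True by (auto simp: paths_to_def val_nil nil_paths)
    then show ?thesis using True by (simp add: push_def word_coef_def nil_paths)
  next
    case False
    have "word_coef (s, []) p = 0" if "p \<in> paths_to z" for p
      using that False len_0 val_S[of p] by (auto simp: paths_to_def word_coef_def)
    moreover have "co s z = 0" using False co_len[OF assms, of z] co_fsupp[OF assms] len_0 by (auto simp: fsupp_def)
    ultimately show ?thesis by (simp add: push_def)
  qed
qed

lemma push_word_single:
  assumes "m \<in> G 1" shows "push (word_coef (\<one>\<^bsub>R\<^esub>, [m])) = co m"
proof
  fix z
  show "push (word_coef (\<one>\<^bsub>R\<^esub>, [m])) z = co m z"
  proof (cases "z \<in> S \<and> len z = 1")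
    case True
    have "paths_to z = {(src z, [z])}"
    proof (intro equalityI subsetI)
      fix p assume "p \<in> paths_to z"
      then have p: "p \<in> paths" "val p = z" "plen p = Suc 0" using True by (auto simp: paths_to_def)
      then obtain a x where "p = (a, [x])" by (cases p) (auto simp: length_Suc_conv)
      with p show "p \<in> {(src z, [z])}" using val_single by (auto simp: single_paths)
    qed (use True in \<open>auto simp: paths_to_def single_paths val_single\<close>)
    then show ?thesis using True src_ob by (simp add: push_def word_coef_def single_paths co_one)
  next
    case False
    have "word_coef (\<one>\<^bsub>R\<^esub>, [m]) p = 0" if "p \<in> paths_to z" for p
      using that False val_S[of p] by (auto simp: paths_to_def word_coef_def)
    moreover have "co m z = 0" using False co_len[OF assms, of z] co_fsupp[OF assms] by (auto simp: fsupp_def)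
    ultimately show ?thesis by (simp add: push_def)
  qed
qed

text \<open>In this locale \<open>R\<close> comes only with its product in coordinates, so the unit
  law is read off from the coordinates of the unit.\<close>

lemma mult_one_G: "x \<in> G d \<Longrightarrow> x \<otimes>\<^bsub>R\<^esub> \<one>\<^bsub>R\<^esub> = x"
proof -
  assume x: "x \<in> G d"
  have "co (x \<otimes>\<^bsub>R\<^esub> \<one>\<^bsub>R\<^esub>) = co x"
  proof
    fix z
    show "co (x \<otimes>\<^bsub>R\<^esub> \<one>\<^bsub>R\<^esub>) z = co x z"
      using mult_G0_right(2)[OF one_G x] fsupp_outside[OF co_fsupp[OF x], of z] tgt_ob[of z]
      by (auto simp: co_one)
  qed
  then show ?thesis using emb_co[OF x] emb_co[OF mult_G0_right(1)[OF one_G x]] by simp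
qed

text \<open>Appending the factor \<open>m\<close> is multiplication by the tensor
  \<open>(\<one>, [m])\<close>, and \<open>push\<close> is multiplicative. The unit inserted after
  the last factor disappears by \<open>mult_one_G\<close>.\<close>

lemma foldl_word:
  "s \<in> G 0 \<Longrightarrow> set ms \<subseteq> G 1 \<Longrightarrow> foldl (\<otimes>\<^bsub>R\<^esub>) s ms = emb (push (word_coef (s, ms)))"
proof (induction ms rule: rev_induct)
  case Nil
  then show ?case by (simp add: push_word_nil emb_co)
next
  case (snoc m ms)
  then have W: "(s, ms) \<in> tensor_words G (length ms)" "(\<one>\<^bsub>R\<^esub>, [m]) \<in> tensor_words G 1" "m \<in> G 1"
    by (auto simp: tensor_words_def one_G)
  have "word_mult R (s, ms) (\<one>\<^bsub>R\<^esub>, [m]) = (s, ms @ [m])"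
  proof (cases ms rule: rev_cases)
    case (snoc us n)
    then have "n \<otimes>\<^bsub>R\<^esub> \<one>\<^bsub>R\<^esub> = n" using snoc.prems \<open>set (ms @ [m]) \<subseteq> G 1\<close> by (intro mult_one_G[of _ 1]) auto
    then show ?thesis by (simp add: snoc)
  qed (use snoc.prems in \<open>simp add: mult_one_G\<close>)
  then have "word_coef (s, ms @ [m]) = pa.conv (word_coef (s, ms)) (word_coef (\<one>\<^bsub>R\<^esub>, [m]))"
    using word_coef_mult[OF W(1,2)] by simp
  then have "push (word_coef (s, ms @ [m])) = gr.conv (push (word_coef (s, ms))) (co m)"
    by (simp add: push_conv push_word_single[OF W(3)])
  then show ?case
    using snoc W R.emb_mult[of "push (word_coef (s, ms))" "co m"] word_coef_fsupp[OF W(1)]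
    by (simp add: push_fsupp co_fsupp[OF W(3)] emb_co[OF W(3)])
qed

text \<open>Evaluation factors through the coefficients along paths; hence it is constant on each
  coset of the relations.\<close>

lemma frag_eval:
  assumes "x \<in> carrier (FG d)" shows "frag_eval R x = emb (push (coef x))"
proof -
  have W: "w \<in> tensor_words G d" if "w \<in> Poly_Mapping.keys x" for w using assms that by auto
  have fs: "(\<lambda>z. of_int n * push (word_coef w) z) \<in> fsupp S" if "w \<in> Poly_Mapping.keys x" for n w
    using push_fsupp[OF word_coef_fsupp[OF W[OF that]]]
    by (auto simp: fsupp_def intro: finite_subset[of _ "{z. push (word_coef w) z \<noteq> 0}"])
  have "frag_eval R x = (\<Oplus>\<^bsub>R\<^esub>w\<in>Poly_Mapping.keys x.
      emb (\<lambda>z. of_int (Poly_Mapping.lookup x w) * push (word_coef w) z))"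
    unfolding frag_eval_def
  proof (rule R.finsum_cong')
    fix w assume w: "w \<in> Poly_Mapping.keys x"
    then have "foldl (\<otimes>\<^bsub>R\<^esub>) (fst w) (snd w) = emb (push (word_coef w))"
      using foldl_word[of "fst w" "snd w"] W[OF w] by (auto simp: tensor_words_def)
    then show "add_pow R (Poly_Mapping.lookup x w) (foldl (\<otimes>\<^bsub>R\<^esub>) (fst w) (snd w)) =
        emb (\<lambda>z. of_int (Poly_Mapping.lookup x w) * push (word_coef w) z)"
      using R.emb_add_pow[OF push_fsupp[OF word_coef_fsupp[OF W[OF w]]]] by simp
  qed (use fs in auto)
  also have "\<dots> = emb (\<lambda>z. \<Sum>w\<in>Poly_Mapping.keys x. of_int (Poly_Mapping.lookup x w) * push (word_coef w) z)"
    by (rule R.emb_finsum) (rule fs)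
  also have "(\<lambda>z. \<Sum>w\<in>Poly_Mapping.keys x. of_int (Poly_Mapping.lookup x w) * push (word_coef w) z) = push (coef x)"
    unfolding push_def coef_def frag_lin_def sum_distrib_left by (rule ext) (rule sum.swap)
  finally show ?thesis .
qed

lemma multiplication_map_emb:
  assumes f: "f \<in> fsupp paths"
  shows "multiplication_map R G (T.emb f) = emb (push f)"
proof -
  let ?r = "\<lambda>d p. if plen p = d then f p else 0"
  let ?D = "{d. T.emb f d \<noteq> \<one>\<^bsub>tensor_power R G d\<^esub>}"
  have fin: "finite ?D"
  proof -
    have "T.emb f \<in> carrier (sum_group UNIV (tensor_power R G))" using T.carrier_sum_H f by blast
    then show ?thesis by (simp add: carrier_sum_group[OF T.group_H])
  qed
  have ev: "the_elem (frag_eval R ` T.emb f d) = emb (push (?r d))" for d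
  proof -
    have "frag_eval R ` TC d f = {emb (push (?r d))}"
    proof -
      have "frag_eval R x = emb (push (?r d))" if "x \<in> TC d f" for x
        using frag_eval[of x d] TC_coef[OF that f] that unfolding TC_def by simp
      then have "frag_eval R ` TC d f = (\<lambda>_. emb (push (?r d))) ` TC d f" by (intro image_cong refl)
      then show ?thesis using TC_nonempty[OF f, of d] by auto
    qed
    then show ?thesis by (simp add: T.emb_def)
  qed
  have "multiplication_map R G (T.emb f) = (\<Oplus>\<^bsub>R\<^esub>d\<in>?D. emb (push (?r d)))"
    by (simp add: multiplication_map_def ev)
  also have "\<dots> = emb (\<lambda>z. \<Sum>d\<in>?D. push (?r d) z)"
    by (rule R.emb_finsum) (intro push_fsupp fsupp_restrict f)
  also have "(\<lambda>z. \<Sum>d\<in>?D. push (?r d) z) = push f"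
  proof
    fix z
    \<comment> \<open>The paths that count at \<open>z\<close> all have \<open>len z\<close> arrows,
      so only the component of that degree reaches \<open>z\<close>.\<close>
    have r: "push (?r d) z = (if d = len z then push f z else 0)" for d
      unfolding push_def by (auto simp: paths_to_def intro!: sum.cong sum.neutral)
    \<comment> \<open>The sum over \<open>?D\<close> omits trivial components; at such a
      \<open>z\<close> the function vanishes on all longest paths anyway.\<close>
    have "push f z = 0" if "len z \<notin> ?D"
    proof -
      have "\<forall>p\<in>paths. plen p = len z \<longrightarrow> f p = 0"
        using that TC_eq_iff[OF f fsupp_0, of "len z"] by (simp add: T.emb_def T.C_one)
      then show ?thesis by (auto simp: push_def paths_to_def intro!: sum.neutral)
    qed
    then show "(\<Sum>d\<in>?D. push (?r d) z) = push f z" using fin by (auto simp: r)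
  qed
  finally show ?thesis .
qed

end

section \<open>Quadratic relations and moves of paths\<close>

declare split_paired_All [simp del] split_paired_Ex [simp del]

context length_category
begin

text \<open>
  The product of two arrows \<open>x\<close>, \<open>y\<close> of length 1 vanishes in the graded ring unless \<open>len (cmp x y) = 2\<close>.
\<close>

definition degenerate :: "'s \<times> 's list \<Rightarrow> bool" where
  "degenerate p \<longleftrightarrow> p \<in> paths \<and> (\<exists>us x y vs. snd p = us @ x # y # vs \<and> len (cmp x y) \<noteq> 2)"

text \<open>The binomial quadratic relations, applied inside a path: two composites of two arrows
  that are equal and do not vanish in degree 2. The monomial quadratic relations are the degenerate
  pairs.\<close>

definition move :: "'s \<times> 's list \<Rightarrow> 's \<times> 's list \<Rightarrow> bool" where
  "move p q \<longleftrightarrow> p \<in> paths \<and> q \<in> paths \<and> fst p = fst q \<and>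
    (\<exists>us x y x' y' vs. snd p = us @ x # y # vs \<and> snd q = us @ x' # y' # vs \<and>
      cmp x y = cmp x' y' \<and> len (cmp x y) = 2)"

abbreviation linked :: "'s \<times> 's list \<Rightarrow> 's \<times> 's list \<Rightarrow> bool" where
  "linked \<equiv> move\<^sup>*\<^sup>*"

lemma move_sym: "move p q \<Longrightarrow> move q p"
  unfolding move_def by metis

lemma linked_sym: "linked p q \<Longrightarrow> linked q p"
  by (induction rule: rtranclp_induct) (auto intro: converse_rtranclp_into_rtranclp move_sym)

lemma split_at_two:
  assumes "p \<in> paths" "snd p = us @ x # y # vs"
  defines "u \<equiv> (fst p, us)" and "m \<equiv> (src x, [x, y])" and "v \<equiv> (tgt y, vs)"
  shows "u \<in> paths" "m \<in> paths" "v \<in> paths" "pok u (pcat m v)" "pok m v" "p = pcat u (pcat m v)"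
    "val m = cmp x y" "x \<in> S" "y \<in> S" "len x = 1" "len y = 1" "tgt x = src y"
proof -
  have "(fst p, us @ x # y # vs) \<in> paths" using assms(1,2) by (metis prod.collapse)
  then have 1: "(fst p, us) \<in> paths" "(tgt (val (fst p, us)), x # y # vs) \<in> paths"
    unfolding paths_append by auto
  from 1(2) have 2: "x \<in> S" "y \<in> S" "len x = 1" "len y = 1" "src x = tgt (val (fst p, us))" "src y = tgt x"
      "(tgt y, vs) \<in> paths"
    by (auto simp: paths_def)
  then show "u \<in> paths" "v \<in> paths" "x \<in> S" "y \<in> S" "len x = 1" "len y = 1" "tgt x = src y"
    using 1 by (auto simp: u_def v_def)
  show m: "m \<in> paths" using 2 src_ob[OF 2(1)] by (auto simp: m_def paths_def tgt_ob)
  show vm: "val m = cmp x y" using cmp_src[OF 2(1)] by (simp add: m_def val_def)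
  show "pok m v" using 2 by (simp add: pok_def vm tgt_cmp v_def)
  show "pok u (pcat m v)" using 2 by (simp add: pok_def u_def m_def pcat_def)
  show "p = pcat u (pcat m v)" using assms(2) by (simp add: u_def m_def v_def pcat_def prod_eq_iff)
qed

text \<open>Writes a move as the exchange of a middle factor of length 2, the shape in which a
  degree 2 relation is multiplied from both sides within an ideal.\<close>

lemma move_split:
  assumes "move p q"
  obtains u m m' v where "u \<in> paths" "m \<in> paths" "m' \<in> paths" "v \<in> paths"
    "pok u (pcat m v)" "pok m v" "pok u (pcat m' v)" "pok m' v" "p = pcat u (pcat m v)" "q = pcat u (pcat m' v)"
    "val m = val m'" "len (val m) = 2" "plen m = 2" "plen m' = 2"
proof -
  from assms obtain us x y x' y' vs where e: "p \<in> paths" "q \<in> paths" "fst p = fst q"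
      "snd p = us @ x # y # vs" "snd q = us @ x' # y' # vs" "cmp x y = cmp x' y'" "len (cmp x y) = 2"
    unfolding move_def by blast
  note s = split_at_two[OF e(1,4)] and s' = split_at_two[OF e(2,5)]
  have "tgt y = tgt y'" using tgt_cmp[OF s(8,9,12)] tgt_cmp[OF s'(8,9,12)] e(6) by simp
  with s s' e show thesis
    by (intro that[of "(fst p, us)" "(src x, [x, y])" "(src x', [x', y'])" "(tgt y, vs)"]) simp_all
qed

lemma move_paths: "move p q \<Longrightarrow> p \<in> paths \<and> q \<in> paths"
  by (simp add: move_def)

lemma move_same: assumes "move p q" shows "plen p = plen q" "val p = val q" "fst p = fst q"
proof -
  from move_split[OF assms] obtain u m m' v where e: "u \<in> paths" "m \<in> paths" "m' \<in> paths" "v \<in> paths"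
    "pok u (pcat m v)" "pok m v" "pok u (pcat m' v)" "pok m' v" "p = pcat u (pcat m v)" "q = pcat u (pcat m' v)"
    "val m = val m'" "plen m = 2" "plen m' = 2" by metis
  show "plen p = plen q" using e by (simp add: pcat_def)
  show "val p = val q" using e by (simp add: val_pcat pcat_paths)
  show "fst p = fst q" using assms by (simp add: move_def)
qed

lemma linked_same:
  assumes "linked p q" shows "plen p = plen q" "val p = val q" "fst p = fst q" "p \<in> paths \<Longrightarrow> q \<in> paths"
  using assms by (induction rule: rtranclp_induct) (auto simp: move_same dest: move_paths)

lemma move_pcat_left: "move p q \<Longrightarrow> u \<in> paths \<Longrightarrow> pok u p \<Longrightarrow> move (pcat u p) (pcat u q)"
proof -
  assume m: "move p q" and u: "u \<in> paths" "pok u p"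
  then have "pok u q" by (simp add: pok_def move_same(3))
  moreover obtain us x y x' y' vs where e: "snd p = us @ x # y # vs" "snd q = us @ x' # y' # vs"
      "cmp x y = cmp x' y'" "len (cmp x y) = 2" using m unfolding move_def by blast
  then have "snd (pcat u p) = (snd u @ us) @ x # y # vs" "snd (pcat u q) = (snd u @ us) @ x' # y' # vs"
    by (auto simp: pcat_def)
  ultimately show ?thesis unfolding move_def using m u e pcat_paths move_paths[OF m]
    by (metis fst_conv pcat_def)
qed

lemma move_pcat_right: "move p q \<Longrightarrow> u \<in> paths \<Longrightarrow> pok p u \<Longrightarrow> move (pcat p u) (pcat q u)"
proof -
  assume m: "move p q" and u: "u \<in> paths" "pok p u"
  then have "pok q u" by (simp add: pok_def move_same(2))
  moreover obtain us x y x' y' vs where e: "snd p = us @ x # y # vs" "snd q = us @ x' # y' # vs"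
      "cmp x y = cmp x' y'" "len (cmp x y) = 2" using m unfolding move_def by blast
  then have "snd (pcat p u) = us @ x # y # (vs @ snd u)" "snd (pcat q u) = us @ x' # y' # (vs @ snd u)"
    by (auto simp: pcat_def)
  ultimately show ?thesis unfolding move_def using m u e pcat_paths move_paths[OF m] move_same(3)[OF m]
    by (metis fst_conv pcat_def)
qed

lemma linked_pcat_left: "linked p q \<Longrightarrow> u \<in> paths \<Longrightarrow> pok u p \<Longrightarrow> linked (pcat u p) (pcat u q)"
proof (induction rule: rtranclp_induct)
  case (step q r)
  then have "pok u q" by (simp add: pok_def linked_same(3))
  with step show ?case using move_pcat_left[of q r u] by (meson rtranclp.rtrancl_into_rtrancl)
qed auto

lemma linked_pcat_right: "linked p q \<Longrightarrow> u \<in> paths \<Longrightarrow> pok p u \<Longrightarrow> linked (pcat p u) (pcat q u)"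
proof (induction rule: rtranclp_induct)
  case (step q r)
  then have "pok q u" by (simp add: pok_def linked_same(2))
  with step show ?case using move_pcat_right[of q r u] by (meson rtranclp.rtrancl_into_rtrancl)
qed auto

lemma degenerate_pcat_left: "degenerate p \<Longrightarrow> u \<in> paths \<Longrightarrow> pok u p \<Longrightarrow> degenerate (pcat u p)"
  unfolding degenerate_def using pcat_paths[of u p] by (metis append_assoc pcat_def snd_conv)

lemma degenerate_pcat_right: "degenerate p \<Longrightarrow> u \<in> paths \<Longrightarrow> pok p u \<Longrightarrow> degenerate (pcat p u)"
  unfolding degenerate_def using pcat_paths[of p u] by (metis append_assoc append_Cons pcat_def snd_conv)

text \<open>The two arrows in question span a composite of length greater than 2, and
  superadditivity passes this surplus on to the whole path. So degenerate paths lie in the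
  kernel.\<close>

lemma degenerate_len: "degenerate p \<Longrightarrow> plen p < len (val p)"
proof -
  assume p: "degenerate p"
  then obtain us x y vs where e: "p \<in> paths" "snd p = us @ x # y # vs" "len (cmp x y) \<noteq> 2"
    by (auto simp: degenerate_def)
  define u m v where d: "u = (fst p, us)" "m = (src x, [x, y])" "v = (tgt y, vs)"
  note s = split_at_two[OF e(1,2), folded d]
  have "len (val m) > 2" using len_cmp[OF s(8,9,12)] s(7,10,11) e(3) by simp
  moreover have "len (val u) + (len (val m) + len (val v)) \<le> len (val p)"
  proof -
    have mv: "pcat m v \<in> paths" using s(2,3,5) by (rule pcat_paths)
    have "tgt (val m) = src (val v)" "tgt (val u) = src (val (pcat m v))"
      using s(4,5) pok_src[OF s(3)] pok_src[OF mv] by simp_all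
    then show ?thesis
      using len_cmp[of "val m" "val v"] len_cmp[of "val u" "val (pcat m v)"]
        val_S[OF s(1)] val_S[OF s(2)] val_S[OF s(3)] val_S[OF mv]
        val_pcat[OF s(2,3,5)] val_pcat[OF s(1) mv s(4)] s(6) by simp
  qed
  moreover have "plen u \<le> len (val u)" "plen v \<le> len (val v)" using s len_val by auto
  ultimately show ?thesis using e(2) by (simp add: d)
qed

section \<open>Class sums as a test for membership in the quadratic ideal\<close>

definition good :: "'s \<times> 's list \<Rightarrow> bool" where
  "good p \<longleftrightarrow> p \<in> paths \<and> (\<forall>q. linked p q \<longrightarrow> \<not> degenerate q)"

lemma finite_class: "p \<in> paths \<Longrightarrow> finite {q. linked p q}"
  by (rule finite_subset[OF _ finite_paths_val[of "val p"]]) (auto simp: linked_same)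

text \<open>
  An ideal of the path algebra which contains the quadratic relations and which a relation not
  generated by them can be seen to avoid.
\<close>

definition class_null :: "('s \<times> 's list \<Rightarrow> 'k::field) set" where
  "class_null = {f \<in> fsupp paths. \<forall>p. good p \<longrightarrow> (\<Sum>q | linked p q. f q) = 0}"

lemma class_null_add: "f \<in> class_null \<Longrightarrow> g \<in> class_null \<Longrightarrow> (\<lambda>p. f p + g p) \<in> class_null"
  by (auto simp: class_null_def fsupp_add sum.distrib)

text \<open>A set closed under moves is a disjoint union of classes, which are removed one at a
  time.\<close>

lemma class_null_union:
  assumes f: "f \<in> class_null" and "finite Y" "\<And>y z. y \<in> Y \<Longrightarrow> linked y z \<Longrightarrow> z \<in> Y" "\<And>y. y \<in> Y \<Longrightarrow> good y"
  shows "(\<Sum>y\<in>Y. f y) = 0"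
  using assms(2-)
proof (induction Y rule: finite_psubset_induct)
  case (psubset Y)
  show ?case
  proof (cases "Y = {}")
    case False
    then obtain y where y: "y \<in> Y" by blast
    let ?E = "{q. linked y q}"
    have E: "?E \<subseteq> Y" "y \<in> ?E" using psubset.prems(1)[OF y] by auto
    have "(\<Sum>y\<in>Y - ?E. f y) = 0"
    proof (rule psubset.IH)
      show "Y - ?E \<subset> Y" using y E by blast
      fix z w assume z: "z \<in> Y - ?E" "linked z w"
      then have "\<not> linked y w" using linked_sym[OF z(2)] by (auto dest: rtranclp_trans)
      then show "w \<in> Y - ?E" using psubset.prems(1)[of z w] z by auto
    qed (use psubset.prems(2) in auto)
    moreover have "(\<Sum>y\<in>?E. f y) = 0" using f psubset.prems(2)[OF y] by (auto simp: class_null_def)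
    ultimately show ?thesis using sum.subset_diff[OF E(1) psubset.hyps, of f] by simp
  qed auto
qed

text \<open>The paths \<open>y\<close> for which \<open>pcat u y\<close> lies in the class of
  \<open>p\<close> form a union of classes, since a move of \<open>y\<close> is a move of
  \<open>pcat u y\<close>. These classes are good, since a degenerate \<open>y\<close> would make
  \<open>pcat u y\<close> degenerate.\<close>

lemma class_null_single_left:
  assumes f: "f \<in> class_null" and u: "u \<in> paths"
  shows "pa.conv (single u c) f \<in> class_null"
proof -
  have "(\<Sum>q | linked p q. pa.conv (single u c) f q) = 0" if p: "good p" for p
  proof -
    let ?B = "\<lambda>q. {y. (u, y) \<in> pa.splits q}"
    have fB: "finite (?B q)" for q
      by (rule finite_subset[of _ "snd ` pa.splits q"]) force+
    have 1: "pa.conv (single u c) f q = (\<Sum>y\<in>?B q. c * f y)" for q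
    proof -
      have "(\<Sum>y\<in>?B q. c * f y) = (\<Sum>s\<in>Pair u ` ?B q. case s of (x, y) \<Rightarrow> single u c x * f y)"
        by (subst sum.reindex) (auto simp: inj_on_def single_apply)
      also have "\<dots> = pa.conv (single u c) f q"
        unfolding pa.conv_def by (rule sum.mono_neutral_left) (auto simp: single_apply)
      finally show ?thesis by simp
    qed
    let ?Y = "\<Union>q\<in>{q. linked p q}. ?B q"
    have pp: "p \<in> paths" using p by (simp add: good_def)
    have Y: "y \<in> ?Y \<longleftrightarrow> y \<in> paths \<and> pok u y \<and> linked p (pcat u y)" for y
      using u by (auto simp: pa.splits_def)
    have "(\<Sum>q | linked p q. pa.conv (single u c) f q) = (\<Sum>y\<in>?Y. c * f y)"
      unfolding 1 using finite_class[OF pp] fB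
      by (subst sum.UNION_disjoint) (auto simp: pa.splits_def)
    also have "\<dots> = c * (\<Sum>y\<in>?Y. f y)" by (simp add: sum_distrib_left)
    also have "(\<Sum>y\<in>?Y. f y) = 0"
    proof (rule class_null_union[OF f])
      show "finite ?Y" using finite_class[OF pp] fB by blast
      fix y assume "y \<in> ?Y"
      then have y: "y \<in> paths" "pok u y" "linked p (pcat u y)" unfolding Y by auto
      show z: "z \<in> ?Y" if "linked y z" for z
        unfolding Y using linked_pcat_left[OF that u y(2)] y linked_same[OF that]
        by (auto simp: pok_def intro: rtranclp_trans)
      show "good y"
        unfolding good_def
      proof (intro conjI allI impI notI)
        fix z assume z: "linked y z" "degenerate z"
        then have "linked p (pcat u z)" "pok u z"
          using linked_pcat_left[OF z(1) u y(2)] y linked_same(3)[OF z(1)]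
          by (auto simp: pok_def intro: rtranclp_trans)
        moreover have "degenerate (pcat u z)" using degenerate_pcat_left[OF z(2) u \<open>pok u z\<close>] .
        ultimately show False using p by (auto simp: good_def)
      qed (rule y)
    qed
    finally show ?thesis by simp
  qed
  then show ?thesis using f pa.conv_fsupp[OF fsupp_single[OF u]] by (auto simp: class_null_def)
qed

lemma class_null_single_right:
  assumes f: "f \<in> class_null" and u: "u \<in> paths"
  shows "pa.conv f (single u c) \<in> class_null"
proof -
  have "(\<Sum>q | linked p q. pa.conv f (single u c) q) = 0" if p: "good p" for p
  proof -
    let ?B = "\<lambda>q. {y. (y, u) \<in> pa.splits q}"
    have fB: "finite (?B q)" for q
      by (rule finite_subset[of _ "fst ` pa.splits q"]) force+
    have 1: "pa.conv f (single u c) q = (\<Sum>y\<in>?B q. c * f y)" for q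
    proof -
      have "(\<Sum>y\<in>?B q. c * f y) = (\<Sum>s\<in>(\<lambda>y. (y, u)) ` ?B q. case s of (y, x) \<Rightarrow> f y * single u c x)"
        by (subst sum.reindex) (auto simp: inj_on_def single_apply mult.commute)
      also have "\<dots> = pa.conv f (single u c) q"
        unfolding pa.conv_def by (rule sum.mono_neutral_left) (auto simp: single_apply)
      finally show ?thesis by simp
    qed
    let ?Y = "\<Union>q\<in>{q. linked p q}. ?B q"
    have pp: "p \<in> paths" using p by (simp add: good_def)
    have Y: "y \<in> ?Y \<longleftrightarrow> y \<in> paths \<and> pok y u \<and> linked p (pcat y u)" for y
      using u by (auto simp: pa.splits_def)
    have "(\<Sum>q | linked p q. pa.conv f (single u c) q) = (\<Sum>y\<in>?Y. c * f y)"
      unfolding 1 using finite_class[OF pp] fB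
      by (subst sum.UNION_disjoint) (auto simp: pa.splits_def)
    also have "\<dots> = c * (\<Sum>y\<in>?Y. f y)" by (simp add: sum_distrib_left)
    also have "(\<Sum>y\<in>?Y. f y) = 0"
    proof (rule class_null_union[OF f])
      show "finite ?Y" using finite_class[OF pp] fB by blast
      fix y assume "y \<in> ?Y"
      then have y: "y \<in> paths" "pok y u" "linked p (pcat y u)" unfolding Y by auto
      show z: "z \<in> ?Y" if "linked y z" for z
        unfolding Y using linked_pcat_right[OF that u y(2)] y linked_same[OF that]
        by (auto simp: pok_def intro: rtranclp_trans)
      show "good y"
        unfolding good_def
      proof (intro conjI allI impI notI)
        fix z assume z: "linked y z" "degenerate z"
        then have "linked p (pcat z u)" "pok z u"
          using linked_pcat_right[OF z(1) u y(2)] y linked_same(2)[OF z(1)]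
          by (auto simp: pok_def intro: rtranclp_trans)
        moreover have "degenerate (pcat z u)" using degenerate_pcat_right[OF z(2) u \<open>pok z u\<close>] .
        ultimately show False using p by (auto simp: good_def)
      qed (rule y)
    qed
    finally show ?thesis by simp
  qed
  then show ?thesis using f pa.conv_fsupp[OF _ fsupp_single[OF u]] by (auto simp: class_null_def)
qed

lemma class_null_0: "(\<lambda>_. 0) \<in> class_null"
  by (simp add: class_null_def fsupp_0)

lemma class_null_conv:
  assumes f: "f \<in> class_null" and g: "g \<in> fsupp paths"
  shows "pa.conv g f \<in> class_null" "pa.conv f g \<in> class_null"
proof -
  show "pa.conv g f \<in> class_null" using g
    by (induction rule: fsupp_induct)
      (auto simp: pa.conv_zero class_null_0 pa.conv_add_left intro: class_null_add class_null_single_left f)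
  show "pa.conv f g \<in> class_null" using g
    by (induction rule: fsupp_induct)
      (auto simp: pa.conv_zero class_null_0 pa.conv_add_right intro: class_null_add class_null_single_right f)
qed

lemma push_single:
  "p \<in> paths \<Longrightarrow> push (single p c) = (if plen p = len (val p) then single (val p) c else (\<lambda>_. 0))"
proof
  fix z assume p: "p \<in> paths"
  have "push (single p c) z = (if p \<in> paths_to z then c else 0)" by (simp add: push_def single_apply)
  then show "push (single p c) z = (if plen p = len (val p) then single (val p) c else (\<lambda>_. 0)) z"
    using p by (auto simp: paths_to_def single_apply)
qed

text \<open>For a good path of length 2 the value also has length 2, and one move reaches every
  other longest path with this value. The class sum is thus a coefficient of
  \<open>push f\<close>.\<close>

lemma class_null_degree_2:
  assumes f: "f \<in> fsupp paths" "push f = (\<lambda>_. 0)" "\<And>p. f p \<noteq> 0 \<Longrightarrow> plen p = 2"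
  shows "f \<in> class_null"
proof -
  have "(\<Sum>q | linked p q. f q) = 0" if p: "good p" for p
  proof (cases "plen p = 2")
    case False
    then show ?thesis using f(3) linked_same(1) by (metis (mono_tags, lifting) mem_Collect_eq sum.neutral)
  next
    case True
    then obtain x y where xy: "snd p = [x, y]" by (metis One_nat_def Suc_1 length_0_conv length_Suc_conv)
    have pp: "p \<in> paths" using p by (simp add: good_def)
    have "len (cmp x y) = 2" using p pp xy unfolding good_def degenerate_def by (metis append_Nil rtranclp.rtrancl_refl)
    moreover have v: "val p = cmp x y" using pp xy by (cases p) (auto simp: val_def paths_def cmp_src)
    ultimately have l: "len (val p) = 2" by simp
    have "{q. linked p q} = paths_to (val p)"
    proof (intro equalityI subsetI)
      fix q assume "q \<in> {q. linked p q}"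
      then have c: "linked p q" by simp
      show "q \<in> paths_to (val p)"
        using linked_same(1,2)[OF c] linked_same(4)[OF c pp] l True by (simp add: paths_to_def)
    next
      fix q assume "q \<in> paths_to (val p)"
      then have q: "q \<in> paths" "val q = val p" "plen q = 2" using l by (auto simp: paths_to_def)
      then obtain x' y' where xy': "snd q = [x', y']" by (metis One_nat_def Suc_1 length_0_conv length_Suc_conv)
      have v': "val q = cmp x' y'" using q xy' by (cases q) (auto simp: val_def paths_def cmp_src)
      have "fst p = fst q" using src_val[OF pp] src_val[OF q(1)] q(2) by simp
      then have "move p q"
        unfolding move_def using pp q xy xy' v v' l
        by (intro conjI exI[of _ "[]"] exI[of _ x] exI[of _ y] exI[of _ x'] exI[of _ y']) auto
      then show "q \<in> {q. linked p q}" by auto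
    qed
    then show ?thesis using f(2) by (simp add: push_def fun_eq_iff)
  qed
  then show ?thesis using f by (simp add: class_null_def)
qed

text \<open>The first clause says that paths shorter than their value vanish modulo the quadratic
  relations, the second that all longest paths with one value become equal.\<close>

definition locally_linked :: bool where
  "locally_linked \<longleftrightarrow>
    (\<forall>p\<in>paths. plen p < len (val p) \<longrightarrow> (\<exists>q. linked p q \<and> degenerate q)) \<and>
    (\<forall>p\<in>paths. \<forall>q\<in>paths. val p = val q \<and> plen p = len (val p) \<and> plen q = len (val p) \<longrightarrow> linked p q)"

end

section \<open>Quadraticity as a condition on paths\<close>

context graded_path_ring
begin

lemma kernel_eq: "a_kernel (tensor_algebra R G) R (multiplication_map R G) =
    T.emb ` {f \<in> fsupp paths. push f = (\<lambda>_. 0)}"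
proof -
  have "multiplication_map R G (T.emb f) = \<zero>\<^bsub>R\<^esub> \<longleftrightarrow> push f = (\<lambda>_. 0)" if "f \<in> fsupp paths" for f
    using that by (simp add: multiplication_map_emb R.emb_zero R.emb_eq_iff push_fsupp fsupp_0)
  then show ?thesis unfolding a_kernel_def kernel_def by (auto simp: T.carrier_eq)
qed

lemma component_eq: "tensor_component R G d = T.emb ` {f \<in> fsupp paths. \<forall>p. f p \<noteq> 0 \<longrightarrow> plen p = d}"
  unfolding tensor_component_def by (rule T.homogeneous_eq)

lemma ideal_embI:
  assumes J: "J \<subseteq> fsupp paths" "(\<lambda>_. 0) \<in> J"
    "\<And>f g. f \<in> J \<Longrightarrow> g \<in> J \<Longrightarrow> (\<lambda>p. f p + g p) \<in> J" "\<And>f. f \<in> J \<Longrightarrow> (\<lambda>p. - f p) \<in> J"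
    "\<And>f g. f \<in> J \<Longrightarrow> g \<in> fsupp paths \<Longrightarrow> pa.conv g f \<in> J" "\<And>f g. f \<in> J \<Longrightarrow> g \<in> fsupp paths \<Longrightarrow> pa.conv f g \<in> J"
  shows "ideal (T.emb ` J) (tensor_algebra R G)"
proof (rule idealI[OF ring_T])
  have fs: "f \<in> J \<Longrightarrow> f \<in> fsupp paths" for f using J(1) by auto
  show "subgroup (T.emb ` J) (add_monoid (tensor_algebra R G))"
  proof (rule T.add.subgroupI)
    show "T.emb ` J \<subseteq> carrier (tensor_algebra R G)" using fs by auto
    show "T.emb ` J \<noteq> {}" using J(2) by blast
    fix a assume "a \<in> T.emb ` J"
    then obtain f where f: "f \<in> J" "a = T.emb f" by blast
    show "\<ominus>\<^bsub>tensor_algebra R G\<^esub> a \<in> T.emb ` J"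
      using J(4)[OF f(1)] T.emb_uminus[OF fs[OF f(1)]] by (simp add: f(2))
    fix b assume "b \<in> T.emb ` J"
    then obtain g where g: "g \<in> J" "b = T.emb g" by blast
    show "a \<oplus>\<^bsub>tensor_algebra R G\<^esub> b \<in> T.emb ` J"
      using J(3)[OF f(1) g(1)] T.emb_add[OF fs[OF f(1)] fs[OF g(1)]] by (simp add: f(2) g(2))
  qed
  fix a x assume "a \<in> T.emb ` J" "x \<in> carrier (tensor_algebra R G)"
  then obtain f g where f: "f \<in> J" "a = T.emb f" and g: "g \<in> fsupp paths" "x = T.emb g"
    by (auto simp: T.carrier_eq)
  show "x \<otimes>\<^bsub>tensor_algebra R G\<^esub> a \<in> T.emb ` J" "a \<otimes>\<^bsub>tensor_algebra R G\<^esub> x \<in> T.emb ` J"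
    using J(5,6)[OF f(1) g(1)] T.emb_mult fs[OF f(1)] g(1) by (simp_all add: f(2) g(2))
qed

text \<open>If the kernel is generated in degree 2, it lies in the ideal of functions with vanishing
  class sums, and single paths or differences of two paths serve as test elements. Conversely, an
  element of the kernel is reduced to zero by subtracting elements of the ideal that shrink its
  support.\<close>

theorem quadratic_iff: "quadratic_ring R G \<longleftrightarrow> locally_linked"
proof -
  let ?T = "tensor_algebra R G" and ?\<pi> = "multiplication_map R G"
  let ?N = "{f \<in> fsupp paths. push f = (\<lambda>_. 0 :: 'k)}"
  let ?N2 = "{f \<in> ?N. \<forall>p. f p \<noteq> 0 \<longrightarrow> plen p = 2}"
  have surj: "?\<pi> ` carrier ?T = carrier R"
  proof -
    have "?\<pi> ` carrier ?T = emb ` push ` fsupp paths"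
      by (auto simp: T.carrier_eq multiplication_map_emb image_image)
    also have "push ` fsupp paths = (fsupp S :: ('s \<Rightarrow> 'k) set)"
      using push_fsupp push_surj by blast
    finally show ?thesis by (simp add: R.carrier_eq)
  qed
  have N2: "a_kernel ?T R ?\<pi> \<inter> tensor_component R G 2 = T.emb ` ?N2"
  proof -
    have "T.emb ` ?N \<inter> T.emb ` {f \<in> fsupp paths. \<forall>p. f p \<noteq> 0 \<longrightarrow> plen p = 2} =
        T.emb ` (?N \<inter> {f \<in> fsupp paths. \<forall>p. f p \<noteq> 0 \<longrightarrow> plen p = 2})"
      by (rule inj_on_image_Int[OF T.inj_emb, symmetric]) auto
    also have "?N \<inter> {f \<in> fsupp paths. \<forall>p. f p \<noteq> 0 \<longrightarrow> plen p = 2} = ?N2" by auto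
    finally show ?thesis unfolding kernel_eq component_eq .
  qed
  have ideal_N: "ideal (T.emb ` ?N) ?T"
  proof (rule ideal_embI)
    show "(\<lambda>p. - f p) \<in> ?N" if "f \<in> ?N" for f
      using that by (auto simp: fsupp_uminus push_def sum_negf fun_eq_iff)
  qed (auto simp: fsupp_0 push_0 fsupp_add push_add pa.conv_fsupp push_conv gr.conv_zero)
  have quad: "quadratic_ring R G \<longleftrightarrow> T.emb ` ?N = Idl\<^bsub>?T\<^esub> (T.emb ` ?N2)"
    unfolding quadratic_ring_def Let_def surj N2 unfolding kernel_eq by simp
  show ?thesis
  proof
    assume "quadratic_ring R G"
    then have eq: "T.emb ` ?N = Idl\<^bsub>?T\<^esub> (T.emb ` ?N2)" by (simp only: quad)
    have "ideal (T.emb ` class_null) ?T"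
    proof (rule ideal_embI)
      show "(\<lambda>p. - f p) \<in> class_null" if "f \<in> class_null" for f :: "_ \<Rightarrow> 'k"
        using that by (auto simp: class_null_def fsupp_uminus sum_negf)
      show "class_null \<subseteq> (fsupp paths :: (_ \<Rightarrow> 'k) set)" by (auto simp: class_null_def)
    qed (fact class_null_0 class_null_add class_null_conv)+
    moreover have "T.emb ` ?N2 \<subseteq> T.emb ` class_null"
      using class_null_degree_2 by (intro image_mono) auto
    ultimately have "T.emb ` ?N \<subseteq> T.emb ` class_null"
      unfolding eq genideal_def by blast
    note sub = this
    have N: "f \<in> class_null" if f: "f \<in> ?N" for f
    proof -
      obtain g where g: "g \<in> class_null" "T.emb f = T.emb g" using sub f by blast
      then have "f = g" using f T.emb_eq_iff[of f g] by (simp add: class_null_def)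
      with g show ?thesis by simp
    qed
    show locally_linked
      unfolding locally_linked_def
    proof (intro conjI ballI impI)
      fix p assume p: "p \<in> paths" "plen p < len (val p)"
      show "\<exists>q. linked p q \<and> degenerate q"
      proof (rule ccontr)
        assume "\<not> ?thesis"
        then have "good p" using p by (auto simp: good_def)
        \<comment> \<open>A path shorter than its value is killed by \<open>push\<close>, yet its
          sum over its own class is 1.\<close>
        moreover have "single p (1 :: 'k) \<in> class_null" using p by (intro N) (simp add: fsupp_single push_single)
        ultimately have "(\<Sum>q | linked p q. single p (1 :: 'k) q) = 0" by (simp add: class_null_def)
        then show False using finite_class[OF p(1)] by (simp add: single_apply)
      qed
    next
      fix p q assume p: "p \<in> paths" and q: "q \<in> paths"
        and e: "val p = val q \<and> plen p = len (val p) \<and> plen q = len (val p)"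
      \<comment> \<open>Moves preserve both the number of arrows and the value, whereas degenerate
        paths have fewer arrows than the length of their value.\<close>
      have "good p"
        unfolding good_def using p e degenerate_len linked_same(1,2) by (metis less_irrefl)
      \<comment> \<open>The sum of this kernel element over the class of \<open>p\<close> is 1
        unless \<open>q\<close> belongs to the class.\<close>
      let ?f = "\<lambda>x. single p (1 :: 'k) x + single q (- 1) x"
      have "?f \<in> class_null"
        using p q e by (intro N) (simp add: fsupp_add fsupp_single push_add push_single, simp add: single_apply fun_eq_iff)
      then have "(\<Sum>r | linked p r. ?f r) = 0" using \<open>good p\<close> by (simp add: class_null_def)
      then show "linked p q"
        using finite_class[OF p] by (simp add: single_apply sum.distrib split: if_splits)
    qed
  next
    assume lc: locally_linked
    have "T.emb ` ?N \<subseteq> J" if J: "ideal J ?T" "T.emb ` ?N2 \<subseteq> J" for J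
    proof -
      interpret J: ideal J ?T by fact
      define M where "M = {f \<in> fsupp paths. T.emb f \<in> J}"
      have M_add: "(\<lambda>p. f p + g p) \<in> M" if "f \<in> M" "g \<in> M" for f g
        using that J.a_closed[of "T.emb f" "T.emb g"] by (auto simp: M_def fsupp_add T.emb_add)
      have M_conv: "pa.conv g f \<in> M" "pa.conv f g \<in> M" if "f \<in> M" "g \<in> fsupp paths" for f g
        using that J.I_l_closed[of "T.emb f" "T.emb g"] J.I_r_closed[of "T.emb f" "T.emb g"]
        by (auto simp: M_def pa.conv_fsupp T.emb_mult)
      have M2: "f \<in> M" if "f \<in> ?N2" for f using that J(2) by (auto simp: M_def)
      have sandwich: "pa.conv (single u 1) (pa.conv (single m c) (single v 1)) = single (pcat u (pcat m v)) c"
        if "u \<in> paths" "m \<in> paths" "v \<in> paths" "pok m v" "pok u (pcat m v)" for u m v and c :: 'k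
        using that by (simp add: pa.conv_single pcat_paths)
      have M_move: "(\<lambda>x. single p c x + single q (- c) x) \<in> M" if mv: "move p q" for p q c
      proof -
        obtain u m m' v where s: "u \<in> paths" "m \<in> paths" "m' \<in> paths" "v \<in> paths"
          "pok u (pcat m v)" "pok m v" "pok u (pcat m' v)" "pok m' v" "p = pcat u (pcat m v)" "q = pcat u (pcat m' v)"
          "val m = val m'" "len (val m) = 2" "plen m = 2" "plen m' = 2"
          by (rule move_split[OF mv])
        have "push (\<lambda>x. single m c x + single m' (- c) x) = (\<lambda>_. 0)"
          using s by (simp add: push_add push_single) (simp add: single_apply fun_eq_iff)
        moreover have "single m c x + single m' (- c) x \<noteq> 0 \<longrightarrow> plen x = 2" for x
          using s by (simp add: single_apply)
        moreover have "(\<lambda>x. single m c x + single m' (- c) x) \<in> fsupp paths"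
          using s by (intro fsupp_add fsupp_single)
        ultimately have "(\<lambda>x. single m c x + single m' (- c) x) \<in> ?N2" by blast
        then have "pa.conv (single u 1) (pa.conv (\<lambda>x. single m c x + single m' (- c) x) (single v 1)) \<in> M"
          using s by (intro M_conv M2 fsupp_single)
        then show ?thesis using s sandwich[of u m v c] sandwich[of u m' v "- c"]
          by (simp only: pa.conv_add_left pa.conv_add_right)
      qed
      have M_conn: "(\<lambda>x. single p c x + single q (- c) x) \<in> M" if "linked p q" for p q c
        using that
      proof (induction rule: rtranclp_induct)
        case base
        have "(\<lambda>x. single p c x + single p (- c) x) = (\<lambda>_. 0)" by (auto simp: single_apply)
        then show ?case using M2[of "\<lambda>_. 0"] by (simp add: fsupp_0 push_0)
      next
        case (step q r)
        have "(\<lambda>x. (single p c x + single q (- c) x) + (single q c x + single r (- c) x)) =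
            (\<lambda>x. single p c x + single r (- c) x)" by (auto simp: single_apply fun_eq_iff)
        then show ?case using M_add[OF step.IH M_move[OF step.hyps(2), of c]] by simp
      qed
      have M_deg: "single p c \<in> M" if dg: "degenerate p" for p c
      proof -
        obtain us x y vs where e: "p \<in> paths" "snd p = us @ x # y # vs" "len (cmp x y) \<noteq> 2"
          using dg by (auto simp: degenerate_def)
        define u m v where d: "u = (fst p, us)" "m = (src x, [x, y])" "v = (tgt y, vs)"
        note s = split_at_two[OF e(1,2), folded d]
        have m: "m \<in> paths" "plen m = 2" "len (val m) \<noteq> 2"
          using s(2,7) e(3) by (simp_all add: d(2))
        have "push (single m c) = (\<lambda>_. 0)" using m by (simp add: push_single)
        moreover have "single m c x \<noteq> 0 \<longrightarrow> plen x = 2" for x using m(2) by (simp add: single_apply)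
        ultimately have "single m c \<in> ?N2" using fsupp_single[OF m(1)] by blast
        then have "pa.conv (single u 1) (pa.conv (single m c) (single v 1)) \<in> M"
          using s by (intro M_conv M2 fsupp_single)
        then show ?thesis unfolding sandwich[OF s(1,2,3,5,4)] s(6)[symmetric] .
      qed
      have "f \<in> M" if "f \<in> ?N" for f
        using that
      proof (induction "card {p. f p \<noteq> 0}" arbitrary: f rule: less_induct)
        case (less f)
        then have f: "f \<in> fsupp paths" "push f = (\<lambda>_. 0)" "finite {p. f p \<noteq> 0}" by (auto simp: fsupp_def)
        show ?case
        proof (cases "f = (\<lambda>_. 0)")
          case True
          then show ?thesis by (intro M2) (simp add: fsupp_0 push_0)
        next
          case False
          then obtain p where p: "f p \<noteq> 0" by (metis ext)
          then have pp: "p \<in> paths" using f by (auto simp: fsupp_def)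
          define c where "c = f p"
          \<comment> \<open>Subtracting such an \<open>h\<close> removes \<open>p\<close> from the
            support of \<open>f\<close>, adds no new point, and stays in the kernel.\<close>
          have "\<exists>h\<in>M. push h = (\<lambda>_. 0) \<and> h p = c \<and> (\<forall>x. h x \<noteq> 0 \<longrightarrow> f x \<noteq> 0)"
          proof (cases "plen p < len (val p)")
            case True
            then obtain q where q: "linked p q" "degenerate q" using lc pp by (auto simp: locally_linked_def)
            have "(\<lambda>x. (single p c x + single q (- c) x) + single q c x) = single p c"
              by (auto simp: single_apply fun_eq_iff)
            then have "single p c \<in> M" using M_add[OF M_conn[OF q(1)] M_deg[OF q(2)]] by metis
            then show ?thesis using p pp True
              by (intro bexI[of _ "single p c"]) (auto simp: push_single single_apply split: if_splits)
          next
            case False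
            then have l: "plen p = len (val p)" using len_val[OF pp] by simp
            \<comment> \<open>The coefficients of \<open>f\<close> on the longest paths with this
              value sum to 0, so \<open>p\<close> cannot be the only one that occurs.\<close>
            have "\<exists>q\<in>paths_to (val p) - {p}. f q \<noteq> 0"
            proof (rule ccontr)
              assume "\<not> ?thesis"
              moreover have p_to: "p \<in> paths_to (val p)" using pp l by (simp add: paths_to_def)
              ultimately have "push f (val p) = f p"
                unfolding push_def using pp l by (subst sum.remove[of _ p]) (simp_all add: p_to)
              then show False using f p by simp
            qed
            then obtain q where q: "q \<in> paths" "val q = val p" "plen q = len (val p)" "q \<noteq> p" "f q \<noteq> 0"
              by (auto simp: paths_to_def)
            then have "linked p q" using lc pp l by (auto simp: locally_linked_def)
            then have "(\<lambda>x. single p c x + single q (- c) x) \<in> M" by (rule M_conn)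
            moreover have "push (\<lambda>x. single p c x + single q (- c) x) = (\<lambda>_. 0)"
              using pp q l by (simp add: push_add push_single) (simp add: single_apply fun_eq_iff)
            ultimately show ?thesis using p q
              by (intro bexI[of _ "\<lambda>x. single p c x + single q (- c) x"]) (auto simp: single_apply split: if_splits)
          qed
          then obtain h where h: "h \<in> M" "push h = (\<lambda>_. 0)" "h p = c" "\<And>x. h x \<noteq> 0 \<Longrightarrow> f x \<noteq> 0" by blast
          have hf: "h \<in> fsupp paths" using h by (simp add: M_def)
          let ?g = "\<lambda>x. f x + - h x"
          have "{x. ?g x \<noteq> 0} \<subset> {x. f x \<noteq> 0}"
          proof
            show "{x. ?g x \<noteq> 0} \<subseteq> {x. f x \<noteq> 0}" using h(4) by force
            have "p \<notin> {x. ?g x \<noteq> 0}" "p \<in> {x. f x \<noteq> 0}" using p h(3) by (simp_all add: c_def)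
            then show "{x. ?g x \<noteq> 0} \<noteq> {x. f x \<noteq> 0}" by metis
          qed
          then have "card {x. ?g x \<noteq> 0} < card {x. f x \<noteq> 0}" using f(3) by (intro psubset_card_mono)
          moreover have "push (\<lambda>x. - h x) = (\<lambda>_. 0)" using h(2) by (auto simp: push_def sum_negf fun_eq_iff)
          then have "?g \<in> ?N"
            using f fsupp_add[OF f(1) fsupp_uminus[OF hf]] push_add[of f "\<lambda>x. - h x"] by simp
          ultimately have "?g \<in> M" by (rule less.hyps)
          from M_add[OF this h(1)] show ?thesis by simp
        qed
      qed
      then show ?thesis by (auto simp: M_def)
    qed
    moreover have "T.emb ` ?N2 \<subseteq> T.emb ` ?N" by auto
    ultimately have "T.emb ` ?N = Idl\<^bsub>?T\<^esub> (T.emb ` ?N2)"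
      unfolding genideal_def using ideal_N by blast
    then show "quadratic_ring R G" by (simp only: quad)
  qed
qed

end

section \<open>The category of interval types\<close>

locale invariant_poset =
  fixes P :: "'p::order set" and r :: "(('p \<times> 'p) \<times> ('p \<times> 'p)) set"
  assumes intervals_finite: "interval_finite P"
    and equiv_r: "equiv (intervals P) r"
    and compatible: "order_compatible r"
    and invariant: "interval_invariant P r"
    and finite_points: "finite (point_classes P r)"
    and concatenation: "concatenation_closed P r"
begin

definition iv :: "'p \<Rightarrow> 'p \<Rightarrow> bool" where
  "iv x y \<longleftrightarrow> (x, y) \<in> intervals P"

lemma iv_iff: "iv x y \<longleftrightarrow> x \<in> P \<and> y \<in> P \<and> x \<le> y"
  by (simp add: iv_def intervals_def)

definition cls :: "'p \<Rightarrow> 'p \<Rightarrow> ('p \<times> 'p) set" where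
  "cls x y = r `` {(x, y)}"

definition types :: "('p \<times> 'p) set set" where
  "types = intervals P // r"

lemma cls_eq_iff: "iv x y \<Longrightarrow> iv x' y' \<Longrightarrow> cls x y = cls x' y' \<longleftrightarrow> ((x, y), (x', y')) \<in> r"
  using eq_equiv_class_iff[OF equiv_r, of "(x, y)" "(x', y')"] by (simp add: iv_def cls_def)

lemma cls_types: "iv x y \<Longrightarrow> cls x y \<in> types"
  by (simp add: iv_def cls_def types_def quotientI)

lemma typesE: assumes "\<alpha> \<in> types" obtains x y where "iv x y" "\<alpha> = cls x y"
  using assms unfolding types_def iv_def cls_def by (auto elim!: quotientE)

lemma finite_interval: "iv x y \<Longrightarrow> finite (closed_interval P x y)"
  using intervals_finite by (auto simp: interval_finite_def iv_def)

text \<open>The existence half of invariance, applied to one point of the interval.\<close>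

lemma transfer:
  assumes e: "cls x y = cls x' y'" and iv: "iv x y" "iv x' y'" and z: "iv x z" "iv z y"
  obtains z' where "iv x' z'" "iv z' y'" "cls x' z' = cls x z" "cls z' y' = cls z y"
proof -
  have "((x, y), (x', y')) \<in> r" using e iv cls_eq_iff[of x y x' y'] by simp
  from invariant[unfolded interval_invariant_def, rule_format, OF this]
  obtain \<tau> where t: "\<tau> \<in> closed_interval P x y \<rightarrow>\<^sub>E closed_interval P x' y'"
      "\<forall>z \<in> closed_interval P x y. interval_types r x' y' (\<tau> z) = interval_types r x y z"
    by (auto elim: ex1E)
  have "z \<in> closed_interval P x y" using z by (auto simp: closed_interval_def iv_iff)
  then have "\<tau> z \<in> closed_interval P x' y'" "interval_types r x' y' (\<tau> z) = interval_types r x y z"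
    using t by auto
  then show thesis
    using iv by (intro that[of "\<tau> z"]) (auto simp: closed_interval_def iv_iff interval_types_def cls_def)
qed

text \<open>The uniqueness half of invariance: otherwise the identity of \<open>[x,y]\<close> and
  the identity redirected at \<open>z\<close> to \<open>w\<close> would be two type-preserving maps
  of the interval to itself.\<close>

lemma unique:
  assumes iv: "iv x z" "iv z y" "iv x w" "iv w y" and e: "cls x z = cls x w" "cls z y = cls w y"
  shows "z = w"
proof -
  let ?I = "closed_interval P x y"
  have "iv x y" using iv by (auto simp: iv_iff)
  then have "((x, y), (x, y)) \<in> r" using cls_eq_iff[of x y x y] by simp
  define Q where "Q \<sigma> \<longleftrightarrow> \<sigma> \<in> ?I \<rightarrow>\<^sub>E ?I \<and>
    (\<forall>z \<in> ?I. interval_types r x y (\<sigma> z) = interval_types r x y z)" for \<sigma>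
  have ex1: "\<exists>!\<sigma>. Q \<sigma>"
    using invariant[unfolded interval_invariant_def, rule_format, OF \<open>((x, y), (x, y)) \<in> r\<close>]
    unfolding Q_def .
  have zw: "z \<in> ?I" "w \<in> ?I" using iv by (auto simp: closed_interval_def iv_iff)
  let ?id = "\<lambda>u\<in>?I. u"
  have "Q ?id" by (auto simp: Q_def)
  moreover have "Q (?id(z := w))"
    using zw e by (auto simp: Q_def interval_types_def cls_def)
  ultimately have "?id = ?id(z := w)" using ex1 by auto
  then have "?id z = (?id(z := w)) z" by simp
  then show ?thesis using zw by simp
qed

lemma iv_refl: "x \<in> P \<Longrightarrow> iv x x"
  by (simp add: iv_iff)

text \<open>Any \<open>u\<close> in \<open>[x,z]\<close> transfers into the one-point interval of
  \<open>w\<close>, so both parts of \<open>[x,z]\<close> at \<open>u\<close> have the class of that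
  point. The two ends \<open>x\<close> and \<open>z\<close> then have equal types in
  \<open>[x,z]\<close>, and \<open>unique\<close> identifies them.\<close>

lemma point_cls: assumes e: "cls x z = cls w w" and iv: "iv x z" "w \<in> P" shows "x = z"
proof -
  have *: "cls x u = cls w w \<and> cls u z = cls w w" if u: "iv x u" "iv u z" for u
  proof -
    obtain u' where u': "iv w u'" "iv u' w" "cls w u' = cls x u" "cls u' w = cls u z"
      using transfer[OF e iv(1) iv_refl[OF iv(2)] u] by blast
    then have "u' = w" by (auto simp: iv_iff)
    with u' show ?thesis by simp
  qed
  have x: "iv x x" "iv z z" using iv by (auto simp: iv_iff)
  show ?thesis
    using *[OF x(1) iv(1)] *[OF iv(1) x(2)] by (intro unique[OF x(1) iv(1) iv(1) x(2)]) auto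
qed

text \<open>An end point of one interval is transferred to the other; the part of the interval that
  has the class of a point can only be a point.\<close>

lemma cls_ends:
  assumes e: "cls x y = cls x' y'" and iv: "iv x y" "iv x' y'"
  shows "cls x x = cls x' x'" "cls y y = cls y' y'"
proof -
  have x: "iv x x" "iv y y" "x \<in> P" "y \<in> P" using iv by (auto simp: iv_iff)
  obtain z where z: "iv x' z" "cls x' z = cls x x" by (rule transfer[OF e iv x(1) iv(1)])
  with point_cls[OF z(2,1) x(3)] show "cls x x = cls x' x'" by simp
  obtain z where z: "iv z y'" "cls z y' = cls y y" by (rule transfer[OF e iv iv(1) x(2)])
  with point_cls[OF z(2,1) x(4)] show "cls y y = cls y' y'" by simp
qed

lemma cls_cmp:
  assumes "iv x y" "iv y z" "iv x' y'" "iv y' z'" "cls x y = cls x' y'" "cls y z = cls y' z'"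
  shows "cls x z = cls x' z'"
proof -
  have "((x, y), (x', y')) \<in> r" "((y, z), (y', z')) \<in> r" using assms cls_eq_iff by blast+
  then have "((x, z), (x', z')) \<in> r" using compatible unfolding order_compatible_def by blast
  moreover have "iv x z" "iv x' z'" using assms by (auto simp: iv_iff)
  ultimately show ?thesis using cls_eq_iff by blast
qed

lemma concat:
  assumes "iv x y1" "iv y2 z" "cls y1 y1 = cls y2 y2"
  obtains x' y' z' where "iv x' y'" "iv y' z'" "cls x' y' = cls x y1" "cls y' z' = cls y2 z"
proof -
  have "((y1, y1), (y2, y2)) \<in> r" using assms cls_eq_iff[of y1 y1 y2 y2] by (auto simp: iv_iff)
  then have "\<exists>x' y' z'. (x', y') \<in> intervals P \<and> (y', z') \<in> intervals P \<and>
           ((x', y'), (x, y1)) \<in> r \<and> ((y', z'), (y2, z)) \<in> r"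
    using concatenation[unfolded concatenation_closed_def, rule_format, of x y1 y2 z] assms
    by (auto simp: iv_def)
  then obtain x' y' z' where "iv x' y'" "iv y' z'" "((x', y'), (x, y1)) \<in> r" "((y', z'), (y2, z)) \<in> r"
    by (auto simp: iv_def)
  then show thesis using that cls_eq_iff assms by metis
qed

section \<open>Composition of interval classes\<close>

definition src :: "('p \<times> 'p) set \<Rightarrow> ('p \<times> 'p) set" where
  "src \<alpha> = (THE a. \<exists>x y. iv x y \<and> \<alpha> = cls x y \<and> a = cls x x)"

definition tgt :: "('p \<times> 'p) set \<Rightarrow> ('p \<times> 'p) set" where
  "tgt \<alpha> = (THE a. \<exists>x y. iv x y \<and> \<alpha> = cls x y \<and> a = cls y y)"

definition cmp :: "('p \<times> 'p) set \<Rightarrow> ('p \<times> 'p) set \<Rightarrow> ('p \<times> 'p) set" where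
  "cmp \<alpha> \<beta> = (THE \<gamma>. \<exists>x y z. iv x y \<and> iv y z \<and> \<alpha> = cls x y \<and> \<beta> = cls y z \<and> \<gamma> = cls x z)"

lemma src_cls: "iv x y \<Longrightarrow> src (cls x y) = cls x x"
  unfolding src_def by (rule the_equality) (use cls_ends in blast)+

lemma tgt_cls: "iv x y \<Longrightarrow> tgt (cls x y) = cls y y"
  unfolding tgt_def by (rule the_equality) (use cls_ends in blast)+

lemma cmp_cls: "iv x y \<Longrightarrow> iv y z \<Longrightarrow> cmp (cls x y) (cls y z) = cls x z"
  unfolding cmp_def by (rule the_equality) (use cls_cmp in blast)+

text \<open>The concatenation axiom realises two classes with matching ends by two adjacent
  intervals.\<close>

lemma composableE:
  assumes "\<alpha> \<in> types" "\<beta> \<in> types" "tgt \<alpha> = src \<beta>"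
  obtains x y z where "iv x y" "iv y z" "\<alpha> = cls x y" "\<beta> = cls y z"
proof -
  obtain x y1 where a: "iv x y1" "\<alpha> = cls x y1" using assms(1) by (rule typesE)
  obtain y2 z where b: "iv y2 z" "\<beta> = cls y2 z" using assms(2) by (rule typesE)
  have "cls y1 y1 = cls y2 y2" using assms(3) a b by (simp add: src_cls tgt_cls)
  from concat[OF a(1) b(1) this] show thesis using that a b by metis
qed

lemma composable_iff:
  "composable P r \<alpha> \<beta> \<gamma> \<longleftrightarrow> \<alpha> \<in> types \<and> \<beta> \<in> types \<and> tgt \<alpha> = src \<beta> \<and> cmp \<alpha> \<beta> = \<gamma>"
proof
  assume "composable P r \<alpha> \<beta> \<gamma>"
  then obtain x y z where "iv x y" "iv y z" "cls x y = \<alpha>" "cls y z = \<beta>" "cls x z = \<gamma>"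
    by (auto simp: composable_def iv_def cls_def)
  then show "\<alpha> \<in> types \<and> \<beta> \<in> types \<and> tgt \<alpha> = src \<beta> \<and> cmp \<alpha> \<beta> = \<gamma>"
    by (auto simp: cls_types tgt_cls src_cls cmp_cls)
next
  assume *: "\<alpha> \<in> types \<and> \<beta> \<in> types \<and> tgt \<alpha> = src \<beta> \<and> cmp \<alpha> \<beta> = \<gamma>"
  then obtain x y z where "iv x y" "iv y z" "\<alpha> = cls x y" "\<beta> = cls y z" by (auto elim: composableE)
  with * show "composable P r \<alpha> \<beta> \<gamma>"
    unfolding composable_def cls_def[symmetric] iv_def[symmetric] using cmp_cls by metis
qed

text \<open>A factorisation is realised in some interval of the right class, and
  \<open>transfer\<close> moves its middle point into the given representative
  \<open>[x,y]\<close>.\<close>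

lemma factor_at:
  assumes "\<alpha> \<in> types" "\<beta> \<in> types" "tgt \<alpha> = src \<beta>" "cmp \<alpha> \<beta> = cls x y" "iv x y"
  obtains z where "iv x z" "iv z y" "\<alpha> = cls x z" "\<beta> = cls z y"
proof -
  obtain x' z' y' where a: "iv x' z'" "iv z' y'" "\<alpha> = cls x' z'" "\<beta> = cls z' y'"
    using assms(1-3) by (rule composableE)
  then have "cls x' y' = cls x y" "iv x' y'" using assms(4) by (auto simp: cmp_cls iv_iff)
  from transfer[OF this assms(5) a(1,2)] show thesis using that a by metis
qed

text \<open>Concatenation realises the composite of the first two classes next to the third; the
  middle point of the composite is then transferred into the new interval. This reduces
  associativity to one chain of four points.\<close>

lemma triple:
  assumes "\<alpha> \<in> types" "\<beta> \<in> types" "\<gamma> \<in> types" "tgt \<alpha> = src \<beta>" "tgt \<beta> = src \<gamma>"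
  obtains w x y z where "iv w x" "iv x y" "iv y z" "\<alpha> = cls w x" "\<beta> = cls x y" "\<gamma> = cls y z"
proof -
  obtain x y z where b: "iv x y" "iv y z" "\<alpha> = cls x y" "\<beta> = cls y z"
    using assms(1,2,4) by (rule composableE)
  then have xz: "iv x z" "cmp \<alpha> \<beta> = cls x z" by (auto simp: cmp_cls iv_iff)
  moreover have "tgt (cls x z) = src \<gamma>" using assms(5) b xz by (simp add: tgt_cls)
  ultimately obtain x' z' w' where c: "iv x' z'" "iv z' w'" "cls x z = cls x' z'" "\<gamma> = cls z' w'"
    using composableE[of "cls x z" \<gamma>] assms(3) by (metis cls_types)
  obtain y' where "iv x' y'" "iv y' z'" "cls x' y' = cls x y" "cls y' z' = cls y z"
    using transfer[OF c(3) xz(1) c(1) b(1,2)] by blast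
  with b c show thesis by (intro that[of x' y' z' w']) simp_all
qed

lemma point_classes_eq: "point_classes P r = {cls x x | x. x \<in> P}"
  by (simp add: point_classes_def cls_def)

text \<open>\<open>chn x zs y\<close> lists the chain \<open>x < z\<^sub>1 < \<dots> < z\<^sub>n = y\<close> without its first element.\<close>

fun chn :: "'p \<Rightarrow> 'p list \<Rightarrow> 'p \<Rightarrow> bool" where
  "chn x [] y \<longleftrightarrow> x = y"
| "chn x (z # zs) y \<longleftrightarrow> z \<in> P \<and> x < z \<and> chn z zs y"

fun tps :: "'p \<Rightarrow> 'p list \<Rightarrow> ('p \<times> 'p) set list" where
  "tps x [] = []"
| "tps x (z # zs) = cls x z # tps z zs"

lemma length_tps [simp]: "length (tps x zs) = length zs"
  by (induction zs arbitrary: x) auto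

lemma chn_iv: "chn x zs y \<Longrightarrow> x \<in> P \<Longrightarrow> iv x y"
proof (induction zs arbitrary: x)
  case (Cons z zs)
  then have "iv z y" by auto
  with Cons.prems show ?case by (auto simp: iv_iff)
qed (auto simp: iv_iff)

lemma chn_set: "chn x zs y \<Longrightarrow> x \<in> P \<Longrightarrow> set zs \<subseteq> {z \<in> P. x < z \<and> z \<le> y} \<and> distinct zs"
proof (induction zs arbitrary: x)
  case (Cons z zs)
  then have "set zs \<subseteq> {w \<in> P. z < w \<and> w \<le> y} \<and> distinct zs" "iv z y" using chn_iv by auto
  with Cons.prems show ?case by (fastforce simp: iv_iff)
qed auto

lemma chn_append: "chn x (us @ vs) y \<longleftrightarrow> chn x us (last (x # us)) \<and> chn (last (x # us)) vs y"
  by (induction us arbitrary: x) auto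

lemma chn_last: "chn x zs y \<Longrightarrow> last (x # zs) = y"
  by (induction zs arbitrary: x) auto

lemma chn_join: "chn x us y \<Longrightarrow> chn y vs z \<Longrightarrow> chn x (us @ vs) z"
  using chn_last[of x us y] by (simp add: chn_append)

lemma tps_append: "tps x (us @ vs) = tps x us @ tps (last (x # us)) vs"
  by (induction us arbitrary: x) auto

text \<open>The points are transferred one at a time; by \<open>point_cls\<close> a proper step does
  not collapse. It follows that heights depend only on the class of an interval.\<close>

lemma chn_lift:
  assumes "chn x zs y" "cls x y = cls x' y'" "x \<in> P" "iv x' y'"
  obtains zs' where "chn x' zs' y'" "tps x' zs' = tps x zs"
  using assms
proof (induction zs arbitrary: x x' thesis)
  case Nil
  then have "cls x' y' = cls y y" "y \<in> P" by auto
  then have "x' = y'" using Nil.prems(5) by (intro point_cls) auto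
  then show ?case by (intro Nil.prems(1)[of "[]"]) auto
next
  case (Cons z zs)
  then have z: "z \<in> P" "x < z" "chn z zs y" "x \<in> P" by auto
  have iv: "iv x z" "iv z y" "iv x y" using z chn_iv[OF z(3,1)] by (auto simp: iv_iff)
  obtain z' where z': "iv x' z'" "iv z' y'" "cls x' z' = cls x z" "cls z' y' = cls z y"
    using transfer[OF Cons.prems(3) iv(3) Cons.prems(5) iv(1,2)] by blast
  obtain zs' where zs': "chn z' zs' y'" "tps z' zs' = tps z zs"
    using Cons.IH[OF _ z(3) z'(4)[symmetric] z(1) z'(2)] by blast
  have "x' \<noteq> z'"
  proof
    assume "x' = z'"
    then have "cls x z = cls x' x'" "x' \<in> P" using z' by (auto simp: iv_iff)
    then show False using point_cls[of x z x'] iv z by auto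
  qed
  then have "chn x' (z' # zs') y'" using zs' z' by (auto simp: iv_iff)
  then show ?case using zs' z' by (intro Cons.prems(1)[of "z' # zs'"]) auto
qed

text \<open>The lists of \<open>chn\<close> omit the starting point, so their length counts steps
  and not elements.\<close>

definition ht :: "'p \<Rightarrow> 'p \<Rightarrow> nat" where
  "ht x y = Max {length zs | zs. chn x zs y}"

lemma finite_chn_lengths: assumes "x \<in> P" shows "finite {length zs | zs. chn x zs y}"
proof -
  have "length zs \<le> card (closed_interval P x y)" if "chn x zs y" for zs
  proof -
    have "set zs \<subseteq> closed_interval P x y" "distinct zs"
      using chn_set[OF that assms] by (auto simp: closed_interval_def)
    then show ?thesis
      using card_mono[OF finite_interval[OF chn_iv[OF that assms]], of "set zs"] by (simp add: distinct_card)
  qed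
  then have "{length zs | zs. chn x zs y} \<subseteq> {..card (closed_interval P x y)}" by blast
  then show ?thesis by (rule finite_subset) simp
qed

lemma length_ht: "chn x zs y \<Longrightarrow> x \<in> P \<Longrightarrow> length zs \<le> ht x y"
  unfolding ht_def by (rule Max_ge) (use finite_chn_lengths in auto)

lemma chn_trivial: "iv x y \<Longrightarrow> chn x (if x = y then [] else [y]) y"
  by (auto simp: iv_iff)

lemma ht_attained: assumes "iv x y" obtains zs where "chn x zs y" "length zs = ht x y"
proof -
  have "ht x y \<in> {length zs | zs. chn x zs y}"
    unfolding ht_def using assms chn_trivial[OF assms]
    by (intro Max_in finite_chn_lengths) (auto simp: iv_iff)
  then show thesis using that by auto
qed

lemma ht_le: "iv x y \<Longrightarrow> iv x' y' \<Longrightarrow> cls x y = cls x' y' \<Longrightarrow> ht x y \<le> ht x' y'"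
proof -
  assume iv: "iv x y" "iv x' y'" "cls x y = cls x' y'"
  obtain zs where zs: "chn x zs y" "length zs = ht x y" using ht_attained[OF iv(1)] by blast
  obtain zs' where zs': "chn x' zs' y'" "tps x' zs' = tps x zs"
    using chn_lift[OF zs(1) iv(3) _ iv(2)] iv by (auto simp: iv_iff)
  have "length zs' = length zs" using arg_cong[OF zs'(2), of length] by simp
  then show ?thesis using length_ht[OF zs'(1)] zs(2) iv(2) by (auto simp: iv_iff)
qed

definition len :: "('p \<times> 'p) set \<Rightarrow> nat" where
  "len \<alpha> = (THE n. \<exists>x y. iv x y \<and> \<alpha> = cls x y \<and> n = ht x y)"

lemma len_cls: "iv x y \<Longrightarrow> len (cls x y) = ht x y"
  unfolding len_def by (rule the_equality) (use ht_le in \<open>blast intro: antisym\<close>)+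

lemma ht_0: "iv x y \<Longrightarrow> ht x y = 0 \<longleftrightarrow> x = y"
proof
  assume iv: "iv x y" and "ht x y = 0"
  then show "x = y"
    using length_ht[OF chn_trivial[OF iv]] by (auto simp: iv_iff split: if_splits)
next
  assume iv: "iv x y" and xy: "x = y"
  obtain zs where zs: "chn x zs y" "length zs = ht x y" using ht_attained[OF iv] by blast
  have "zs = []" using chn_set[OF zs(1)] iv xy by (cases zs) (auto simp: iv_iff)
  with zs show "ht x y = 0" by simp
qed

lemma ht_add: "iv x y \<Longrightarrow> iv y z \<Longrightarrow> ht x y + ht y z \<le> ht x z"
proof -
  assume iv: "iv x y" "iv y z"
  obtain us vs where "chn x us y" "length us = ht x y" "chn y vs z" "length vs = ht y z"
    using ht_attained[OF iv(1)] ht_attained[OF iv(2)] by metis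
  then show ?thesis using length_ht[OF chn_join[of x us y vs z]] iv by (auto simp: iv_iff)
qed

text \<open>Cut off the last step of a longest chain. The first part has height at least
  \<open>n\<close>, the step has height at least 1, and superadditivity leaves no room for
  more.\<close>

lemma ht_Suc:
  assumes "iv x y" "ht x y = Suc n"
  obtains w where "iv x w" "iv w y" "ht x w = n" "ht w y = 1"
proof -
  obtain zs where zs: "chn x zs y" "length zs = Suc n" using ht_attained[OF assms(1)] assms(2) by metis
  then obtain ws where ws: "zs = ws @ [y]" using chn_last[OF zs(1)] by (cases zs rule: rev_cases) auto
  let ?w = "last (x # ws)"
  have w: "chn x ws ?w" "?w < y" using zs(1) unfolding ws chn_append by auto
  have x: "x \<in> P" using assms by (simp add: iv_iff)
  have iv: "iv x ?w" using chn_iv[OF w(1) x] .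
  then have iv': "iv ?w y" using w(2) assms by (auto simp: iv_iff)
  have "n \<le> ht x ?w" using length_ht[OF w(1) x] zs(2) ws by simp
  moreover have "ht ?w y \<noteq> 0" using ht_0[OF iv'] w(2) by simp
  moreover have "ht x ?w + ht ?w y \<le> Suc n" using ht_add[OF iv iv'] assms(2) by simp
  ultimately show thesis using that[OF iv iv'] by simp
qed

sublocale length_category types "point_classes P r" src tgt cmp len
proof
  show "finite (point_classes P r)" by (rule finite_points)
  show "point_classes P r \<subseteq> types" by (auto simp: point_classes_eq intro: cls_types iv_refl)
  show "src \<alpha> \<in> point_classes P r" "tgt \<alpha> \<in> point_classes P r" if "\<alpha> \<in> types" for \<alpha>
    using that by (auto elim!: typesE simp: src_cls tgt_cls point_classes_eq iv_iff)
  show "src \<alpha> = \<alpha>" "tgt \<alpha> = \<alpha>" if "\<alpha> \<in> point_classes P r" for \<alpha>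
    using that by (auto simp: point_classes_eq src_cls tgt_cls iv_refl)
  show "cmp (src \<alpha>) \<alpha> = \<alpha>" "cmp \<alpha> (tgt \<alpha>) = \<alpha>" if "\<alpha> \<in> types" for \<alpha>
    using that by (auto elim!: typesE simp: src_cls tgt_cls cmp_cls iv_iff)
  show "len \<alpha> = 0 \<longleftrightarrow> \<alpha> \<in> point_classes P r" if a: "\<alpha> \<in> types" for \<alpha>
  proof -
    obtain x y where xy: "iv x y" "\<alpha> = cls x y" using a by (rule typesE)
    have "x = y" if "cls x y = cls w w" "w \<in> P" for w using point_cls[OF that(1) xy(1) that(2)] .
    then show ?thesis using xy by (auto simp: len_cls ht_0 point_classes_eq iv_iff)
  qed
  show "\<exists>\<alpha>\<in>types. \<exists>\<beta>\<in>types. tgt \<alpha> = src \<beta> \<and> cmp \<alpha> \<beta> = \<gamma> \<and> len \<alpha> = n \<and> len \<beta> = 1"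
    if "\<gamma> \<in> types" "len \<gamma> = Suc n" for \<gamma> n
  proof -
    obtain x y where xy: "iv x y" "\<gamma> = cls x y" using \<open>\<gamma> \<in> types\<close> by (rule typesE)
    then have "ht x y = Suc n" using that len_cls by simp
    then obtain w where "iv x w" "iv w y" "ht x w = n" "ht w y = 1" using ht_Suc[OF xy(1)] by blast
    then show ?thesis using xy
      by (intro bexI[of _ "cls x w"] bexI[of _ "cls w y"]) (auto simp: tgt_cls src_cls cmp_cls len_cls cls_types)
  qed
  show "finite {(\<alpha>, \<beta>). \<alpha> \<in> types \<and> \<beta> \<in> types \<and> tgt \<alpha> = src \<beta> \<and> cmp \<alpha> \<beta> = \<gamma>}" (is "finite ?F") for \<gamma>
  proof (cases "?F = {}")
    case False
    then obtain \<alpha> \<beta> where "\<alpha> \<in> types" "\<beta> \<in> types" "tgt \<alpha> = src \<beta>" "cmp \<alpha> \<beta> = \<gamma>" by auto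
    from composableE[OF this(1-3)] obtain x z y where "iv x z" "iv z y" "\<alpha> = cls x z" "\<beta> = cls z y" .
    with \<open>cmp \<alpha> \<beta> = \<gamma>\<close> have xy: "iv x y" "\<gamma> = cls x y" by (auto simp: iv_iff cmp_cls)
    \<comment> \<open>One representing interval suffices: every factorisation of its class is cut
      out by one of its finitely many points.\<close>
    have "?F \<subseteq> (\<lambda>z. (cls x z, cls z y)) ` closed_interval P x y"
    proof clarify
      fix \<alpha> \<beta> assume a: "\<alpha> \<in> types" "\<beta> \<in> types" "tgt \<alpha> = src \<beta>" "\<gamma> = cmp \<alpha> \<beta>"
      then have "cmp \<alpha> \<beta> = cls x y" using xy by simp
      from factor_at[OF a(1-3) this xy(1)]
      obtain z where "iv x z" "iv z y" "\<alpha> = cls x z" "\<beta> = cls z y" .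
      then show "(\<alpha>, \<beta>) \<in> (\<lambda>z. (cls x z, cls z y)) ` closed_interval P x y"
        by (auto simp: closed_interval_def iv_iff)
    qed
    then show ?thesis using finite_interval[OF xy(1)] finite_surj by blast
  next
    case True
    then show ?thesis by (simp only: finite.emptyI)
  qed
  fix \<alpha> \<beta> assume ab: "\<alpha> \<in> types" "\<beta> \<in> types" "tgt \<alpha> = src \<beta>"
  then obtain x y z where c: "iv x y" "iv y z" "\<alpha> = cls x y" "\<beta> = cls y z" by (rule composableE)
  then have xz: "iv x z" by (auto simp: iv_iff)
  show "cmp \<alpha> \<beta> \<in> types" "src (cmp \<alpha> \<beta>) = src \<alpha>" "tgt (cmp \<alpha> \<beta>) = tgt \<beta>" "len \<alpha> + len \<beta> \<le> len (cmp \<alpha> \<beta>)"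
    using c xz ht_add by (auto simp: cmp_cls cls_types src_cls tgt_cls len_cls)
  fix \<gamma> assume g: "\<gamma> \<in> types" "tgt \<beta> = src \<gamma>"
  from triple[OF ab(1,2) g(1) ab(3) g(2)] obtain w x y z
    where d: "iv w x" "iv x y" "iv y z" "\<alpha> = cls w x" "\<beta> = cls x y" "\<gamma> = cls y z" .
  then have "iv w y" "iv x z" by (auto simp: iv_iff)
  with d show "cmp (cmp \<alpha> \<beta>) \<gamma> = cmp \<alpha> (cmp \<beta> \<gamma>)" by (simp add: cmp_cls)
qed

end

section \<open>The associated graded ring of the reduced incidence algebra\<close>

locale incidence_ring = invariant_poset P r
  for P :: "'p::order set" and r +
  fixes A :: "(('p \<times> 'p) set \<Rightarrow> 'k::field) ring" and I :: "(('p \<times> 'p) set \<Rightarrow> 'k) set"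
  assumes A_eq: "A = reduced_incidence_algebra P r"
    and I_eq: "I = incidence_ideal P r"
begin

sublocale ic: partial_semigroup types "\<lambda>x y. tgt x = src y" cmp
  by (rule partial_semigroup_cmp)

lemma carrier_A: "carrier A = fsupp types"
  by (simp add: A_eq reduced_incidence_algebra_def fsupp_def types_def)

lemma add_A: "f \<oplus>\<^bsub>A\<^esub> g = (\<lambda>\<alpha>. f \<alpha> + g \<alpha>)"
  by (simp add: A_eq reduced_incidence_algebra_def)

lemma one_A: "\<one>\<^bsub>A\<^esub> = (\<lambda>\<alpha>. if \<alpha> \<in> point_classes P r then 1 else 0)"
  by (simp add: A_eq reduced_incidence_algebra_def)

lemma mult_A:
  assumes f: "f \<in> fsupp types" and g: "g \<in> fsupp types"
  shows "f \<otimes>\<^bsub>A\<^esub> g = ic.conv f g"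
proof
  fix \<gamma>
  let ?F = "{\<alpha>. f \<alpha> \<noteq> 0}" and ?G = "{\<beta>. g \<beta> \<noteq> 0}"
  have fin: "finite ?F" "finite ?G" and sub: "?F \<subseteq> types" "?G \<subseteq> types"
    using f g by (auto simp: fsupp_def)
  have "(f \<otimes>\<^bsub>A\<^esub> g) \<gamma> = (\<Sum>\<alpha>\<in>?F. \<Sum>\<beta>\<in>?G. if composable P r \<alpha> \<beta> \<gamma> then f \<alpha> * g \<beta> else 0)"
    by (simp add: A_eq reduced_incidence_algebra_def)
  also have "\<dots> = (\<Sum>p\<in>?F \<times> ?G. if p \<in> ic.splits \<gamma> then f (fst p) * g (snd p) else 0)"
    unfolding sum.cartesian_product
    by (rule sum.cong) (simp_all add: composable_iff ic.splits_def case_prod_unfold)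
  also have "\<dots> = (\<Sum>p\<in>(?F \<times> ?G) \<inter> ic.splits \<gamma>. f (fst p) * g (snd p))"
    using fin by (subst sum.inter_restrict) auto
  also have "\<dots> = (\<Sum>p\<in>ic.splits \<gamma>. f (fst p) * g (snd p))"
    by (rule sum.mono_neutral_left) auto
  also have "\<dots> = ic.conv f g \<gamma>" by (simp add: ic.conv_def case_prod_unfold)
  finally show "(f \<otimes>\<^bsub>A\<^esub> g) \<gamma> = ic.conv f g \<gamma>" .
qed

definition level :: "nat \<Rightarrow> (('p \<times> 'p) set \<Rightarrow> 'k) set" where
  "level d = {f \<in> fsupp types. \<forall>\<gamma>. f \<gamma> \<noteq> 0 \<longrightarrow> d \<le> len \<gamma>}"

lemma level_0: "(\<lambda>_. 0) \<in> level d"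
  by (simp add: level_def fsupp_0)

lemma level_fsupp: "f \<in> level d \<Longrightarrow> f \<in> fsupp types"
  by (simp add: level_def)

lemma level_add: "f \<in> level d \<Longrightarrow> g \<in> level d \<Longrightarrow> (\<lambda>\<alpha>. f \<alpha> + g \<alpha>) \<in> level d"
proof -
  assume f: "f \<in> level d" and g: "g \<in> level d"
  have "d \<le> len \<gamma>" if "f \<gamma> + g \<gamma> \<noteq> 0" for \<gamma>
  proof -
    have "f \<gamma> \<noteq> 0 \<or> g \<gamma> \<noteq> 0" using that by auto
    then show ?thesis using f g by (auto simp: level_def)
  qed
  then show ?thesis using f g by (auto simp: level_def fsupp_add)
qed

lemma level_uminus: "f \<in> level d \<Longrightarrow> (\<lambda>\<alpha>. - f \<alpha>) \<in> level d"
  by (simp add: level_def fsupp_uminus)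

lemma I_level: "I = level 1"
proof -
  have *: "(\<exists>(x, y)\<in>intervals P. x < y \<and> \<alpha> = r `` {(x, y)}) \<longleftrightarrow> 1 \<le> len \<alpha>" if a: "\<alpha> \<in> types" for \<alpha>
  proof
    assume "\<exists>(x, y)\<in>intervals P. x < y \<and> \<alpha> = r `` {(x, y)}"
    then obtain x y where "iv x y" "x < y" "\<alpha> = cls x y" by (auto simp: iv_def cls_def)
    then show "1 \<le> len \<alpha>" using ht_0[of x y] by (cases "ht x y") (auto simp: len_cls)
  next
    assume l: "1 \<le> len \<alpha>"
    obtain x y where xy: "iv x y" "\<alpha> = cls x y" using a by (rule typesE)
    then have "x \<noteq> y" using l ht_0[of x y] by (auto simp: len_cls)
    then have "x < y" using xy by (auto simp: iv_iff)
    with xy show "\<exists>(x, y)\<in>intervals P. x < y \<and> \<alpha> = r `` {(x, y)}" by (auto simp: iv_def cls_def)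
  qed
  have "(\<forall>\<alpha>. f \<alpha> \<noteq> 0 \<longrightarrow> (\<exists>(x, y)\<in>intervals P. x < y \<and> \<alpha> = r `` {(x, y)})) \<longleftrightarrow>
      (\<forall>\<alpha>. f \<alpha> \<noteq> 0 \<longrightarrow> 1 \<le> len \<alpha>)" if "f \<in> fsupp types" for f :: "('p \<times> 'p) set \<Rightarrow> 'k"
  proof -
    have "(f \<alpha> \<noteq> 0 \<longrightarrow> (\<exists>(x, y)\<in>intervals P. x < y \<and> \<alpha> = r `` {(x, y)})) \<longleftrightarrow>
        (f \<alpha> \<noteq> 0 \<longrightarrow> 1 \<le> len \<alpha>)" for \<alpha>
    proof (cases "f \<alpha> = 0")
      case False
      then have "\<alpha> \<in> types" using fsupp_outside[OF that] by metis
      from *[OF this] show ?thesis by (simp only:)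
    next
      case True
      then show ?thesis by (simp only: not_True_eq_False simp_thms)
    qed
    then show ?thesis by (simp only:)
  qed
  then show ?thesis
    unfolding I_eq incidence_ideal_def A_eq[symmetric] carrier_A level_def by (intro Collect_cong conj_cong refl)
qed

lemma conv_nonzero:
  assumes "ic.conv f g \<gamma> \<noteq> 0"
  obtains \<alpha> \<beta> where "(\<alpha>, \<beta>) \<in> ic.splits \<gamma>" "f \<alpha> \<noteq> 0" "g \<beta> \<noteq> 0"
proof -
  obtain p where "p \<in> ic.splits \<gamma>" "(case p of (\<alpha>, \<beta>) \<Rightarrow> f \<alpha> * g \<beta>) \<noteq> 0"
    using assms unfolding ic.conv_def by (meson sum.not_neutral_contains_not_neutral)
  then show thesis by (cases p) (auto intro: that)
qed

lemma level_mult: "f \<in> level i \<Longrightarrow> g \<in> level j \<Longrightarrow> f \<otimes>\<^bsub>A\<^esub> g \<in> level (i + j)"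
proof -
  assume f: "f \<in> level i" and g: "g \<in> level j"
  have "i + j \<le> len \<gamma>" if nz: "ic.conv f g \<gamma> \<noteq> 0" for \<gamma>
  proof -
    obtain \<alpha> \<beta> where s: "(\<alpha>, \<beta>) \<in> ic.splits \<gamma>" "f \<alpha> \<noteq> 0" "g \<beta> \<noteq> 0" using conv_nonzero[OF nz] .
    then have "i \<le> len \<alpha>" "j \<le> len \<beta>" using f g by (auto simp: level_def)
    then show ?thesis using len_cmp[of \<alpha> \<beta>] s(1) by (auto simp: ic.splits_def)
  qed
  then show ?thesis using f g by (simp add: mult_A level_def ic.conv_fsupp)
qed

text \<open>A class of length \<open>Suc n\<close> with \<open>d \<le> n\<close> is the composite of
  classes of lengths \<open>n\<close> and 1, so its basis element is itself a product. The other
  inclusion is superadditivity of lengths.\<close>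

lemma ideal_prod_level: "ideal_prod A (level d) (level 1) = level (Suc d)"
proof (intro equalityI subsetI)
  fix f assume "f \<in> ideal_prod A (level d) (level 1)"
  then show "f \<in> level (Suc d)"
  proof (induction rule: ideal_prod.induct)
    case (prod f g)
    then show ?case using level_mult[of f d g 1] by simp
  qed (simp add: add_A level_add)
next
  fix f assume f: "f \<in> level (Suc d)"
  show "f \<in> ideal_prod A (level d) (level 1)"
    using level_fsupp[OF f]
  proof (induction rule: fsupp_induct)
    case zero
    have "(\<lambda>_. 0) \<otimes>\<^bsub>A\<^esub> (\<lambda>_. 0) \<in> ideal_prod A (level d) (level 1)"
      by (intro ideal_prod.prod level_0)
    then show ?case by (simp add: mult_A fsupp_0 ic.conv_zero)
  next
    case (add b c g)
    then have "Suc d \<le> len b" using f by (auto simp: level_def)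
    then obtain n where "len b = Suc n" "d \<le> n" by (cases "len b") auto
    then obtain \<alpha> \<beta> where ab: "\<alpha> \<in> types" "\<beta> \<in> types" "tgt \<alpha> = src \<beta>" "cmp \<alpha> \<beta> = b" "len \<alpha> = n" "len \<beta> = 1"
      using len_Suc[OF add(1)] by blast
    have "single \<alpha> c \<otimes>\<^bsub>A\<^esub> single \<beta> 1 \<in> ideal_prod A (level d) (level 1)"
      using ab \<open>d \<le> n\<close>
      by (intro ideal_prod.prod) (auto simp: level_def fsupp_single single_apply split: if_splits)
    then have "single b c \<in> ideal_prod A (level d) (level 1)"
      using ab by (simp add: mult_A fsupp_single ic.conv_single)
    from ideal_prod.sum[OF this add.IH] show ?case by (simp add: add_A)
  qed
qed

lemma ideal_power_level: "ideal_power A I d = level d"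
  by (induction d) (simp_all add: carrier_A I_level ideal_prod_level level_def[of 0] del: One_nat_def)

text \<open>A coset of \<open>level (Suc d)\<close> in \<open>level d\<close>, described by its
  leading coordinates, those at the classes of length exactly \<open>d\<close>.\<close>

definition GC :: "nat \<Rightarrow> (('p \<times> 'p) set \<Rightarrow> 'k) \<Rightarrow> (('p \<times> 'p) set \<Rightarrow> 'k) set" where
  "GC d f = {g \<in> level d. \<forall>\<gamma>\<in>types. len \<gamma> = d \<longrightarrow> g \<gamma> = f \<gamma>}"

abbreviation deg_part :: "nat \<Rightarrow> (('p \<times> 'p) set \<Rightarrow> 'k) \<Rightarrow> ('p \<times> 'p) set \<Rightarrow> 'k" where
  "deg_part d f \<equiv> (\<lambda>\<gamma>. if len \<gamma> = d then f \<gamma> else 0)"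

lemma GC_cong: "(\<And>\<gamma>. \<gamma> \<in> types \<Longrightarrow> len \<gamma> = d \<Longrightarrow> f \<gamma> = g \<gamma>) \<Longrightarrow> GC d f = GC d g"
  by (auto simp: GC_def)

lemma deg_part_level: "f \<in> fsupp types \<Longrightarrow> deg_part d f \<in> level d"
  by (simp add: level_def fsupp_restrict)

lemma deg_part_GC: "f \<in> fsupp types \<Longrightarrow> deg_part d f \<in> GC d f"
  using deg_part_level[of f d] by (simp add: GC_def)

lemma coset_GC:
  assumes f: "f \<in> level d" shows "(\<Union>h\<in>level (Suc d). {h \<oplus>\<^bsub>A\<^esub> f}) = GC d f"
proof (intro equalityI subsetI)
  fix g assume "g \<in> (\<Union>h\<in>level (Suc d). {h \<oplus>\<^bsub>A\<^esub> f})"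
  then obtain h where h: "h \<in> level (Suc d)" "g = (\<lambda>\<alpha>. h \<alpha> + f \<alpha>)" by (auto simp: add_A)
  have "h \<in> level d" using h(1) unfolding level_def by (auto dest: Suc_leD)
  then have "g \<in> level d" using h f by (simp add: level_add)
  moreover have "h \<gamma> = 0" if "len \<gamma> = d" for \<gamma>
  proof (rule ccontr)
    assume "h \<gamma> \<noteq> 0"
    then have "Suc d \<le> len \<gamma>" using h(1) by (simp add: level_def)
    then show False using that by simp
  qed
  ultimately show "g \<in> GC d f" by (simp add: GC_def h)
next
  fix g assume g: "g \<in> GC d f"
  let ?h = "\<lambda>\<alpha>. g \<alpha> + - f \<alpha>"
  have "?h \<in> level d" using g f by (intro level_add level_uminus) (auto simp: GC_def)
  moreover have "len \<gamma> \<noteq> d" if "?h \<gamma> \<noteq> 0" for \<gamma>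
    using that g f by (cases "\<gamma> \<in> types") (auto simp: GC_def level_def fsupp_outside)
  ultimately have "?h \<in> level (Suc d)" unfolding level_def by (auto intro: le_neq_implies_less simp: Suc_le_eq)
  moreover have "g = ?h \<oplus>\<^bsub>A\<^esub> f" by (simp add: add_A)
  ultimately show "g \<in> (\<Union>h\<in>level (Suc d). {h \<oplus>\<^bsub>A\<^esub> f})" by blast
qed

lemma gr_piece_eq:
  "carrier (gr_piece A I d) = GC d ` level d"
  "U \<otimes>\<^bsub>gr_piece A I d\<^esub> V = (\<Union>f\<in>U. \<Union>g\<in>V. {f \<oplus>\<^bsub>A\<^esub> g})"
  "\<one>\<^bsub>gr_piece A I d\<^esub> = level (Suc d)"
  using coset_GC[of _ d]
  by (auto simp: gr_piece_def FactGroup_def RCOSETS_def r_coset_def set_mult_def ideal_power_level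
      simp del: ideal_power.simps)

sublocale gr_model: graded_model types gok cmp len "gr_piece A I"
  "\<lambda>i j. rcoset_mult A (ideal_power A I (Suc (i + j)))" GC
proof
  show "len (cmp x y) = len x + len y" if "gok x y" for x y
    using that by (simp add: gok_def)
  show "carrier (gr_piece A I d) = GC d ` fsupp types" for d
  proof -
    have "GC d f \<in> GC d ` level d" if "f \<in> fsupp types" for f
      using deg_part_level[OF that, of d] GC_cong[of d f "deg_part d f"] by simp
    then show ?thesis unfolding gr_piece_eq using level_fsupp by blast
  qed
  show "\<one>\<^bsub>gr_piece A I d\<^esub> = GC d (\<lambda>_. 0)" for d
    using coset_GC[OF level_0, of d] by (simp add: gr_piece_eq add_A)
  fix f g :: "('p \<times> 'p) set \<Rightarrow> 'k" assume fg: "f \<in> fsupp types" "g \<in> fsupp types"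
  show "GC d f = GC d g \<longleftrightarrow> (\<forall>b\<in>types. len b = d \<longrightarrow> f b = g b)" for d
  proof
    assume "GC d f = GC d g"
    then have "deg_part d f \<in> GC d g" using deg_part_GC[OF fg(1), of d] by simp
    then show "\<forall>b\<in>types. len b = d \<longrightarrow> f b = g b" by (auto simp: GC_def)
  qed (rule GC_cong, blast)
  show "GC d f \<otimes>\<^bsub>gr_piece A I d\<^esub> GC d g = GC d (\<lambda>b. f b + g b)" for d
  proof (intro equalityI subsetI)
    fix h assume "h \<in> GC d f \<otimes>\<^bsub>gr_piece A I d\<^esub> GC d g"
    then show "h \<in> GC d (\<lambda>b. f b + g b)" by (auto simp: gr_piece_eq add_A GC_def level_add)
  next
    fix h assume h: "h \<in> GC d (\<lambda>b. f b + g b)"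
    let ?g = "\<lambda>b. h b + - deg_part d f b"
    have "?g \<in> level d" using h deg_part_level[OF fg(1), of d] by (intro level_add level_uminus) (auto simp: GC_def)
    then have "?g \<in> GC d g" using h by (auto simp: GC_def)
    moreover have "h = deg_part d f \<oplus>\<^bsub>A\<^esub> ?g" by (simp add: add_A)
    ultimately show "h \<in> GC d f \<otimes>\<^bsub>gr_piece A I d\<^esub> GC d g"
      unfolding gr_piece_eq using deg_part_GC[OF fg(1), of d] by blast
  qed
  fix i j
  let ?t = "GC (i + j) (gr.conv (deg_part i f) (deg_part j g))"
  have "(\<Union>h\<in>level (Suc (i + j)). {h \<oplus>\<^bsub>A\<^esub> (a \<otimes>\<^bsub>A\<^esub> b)}) = ?t" if ab: "a \<in> GC i f" "b \<in> GC j g" for a b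
  proof -
    have l: "a \<in> level i" "b \<in> level j" using ab by (auto simp: GC_def)
    have "(\<Union>h\<in>level (Suc (i + j)). {h \<oplus>\<^bsub>A\<^esub> (a \<otimes>\<^bsub>A\<^esub> b)}) = GC (i + j) (a \<otimes>\<^bsub>A\<^esub> b)"
      by (rule coset_GC[OF level_mult[OF l]])
    also have "\<dots> = ?t"
    proof (rule GC_cong)
      fix \<gamma> assume \<gamma>: "\<gamma> \<in> types" "len \<gamma> = i + j"
      have "(a \<otimes>\<^bsub>A\<^esub> b) \<gamma> = (\<Sum>(x, y)\<in>ic.splits \<gamma>. a x * b y)"
        using l by (simp add: mult_A level_fsupp ic.conv_def)
      also have "\<dots> = (\<Sum>(x, y)\<in>gr.splits \<gamma>. deg_part i f x * deg_part j g y)"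
      proof (rule sum.mono_neutral_cong_right)
        show "gr.splits \<gamma> \<subseteq> ic.splits \<gamma>" by (auto simp: gr.splits_def ic.splits_def gok_def)
        \<comment> \<open>If lengths do not add up, their sum is below \<open>i + j\<close> by
          superadditivity, so one of the two factors is evaluated below its level and
          vanishes.\<close>
        show "\<forall>p\<in>ic.splits \<gamma> - gr.splits \<gamma>. (case p of (x, y) \<Rightarrow> a x * b y) = 0"
        proof
          fix p assume p: "p \<in> ic.splits \<gamma> - gr.splits \<gamma>"
          obtain x y where xy: "p = (x, y)" by (cases p)
          then have s: "x \<in> types" "y \<in> types" "tgt x = src y" "cmp x y = \<gamma>" "len \<gamma> \<noteq> len x + len y"
            using p by (auto simp: gr.splits_def ic.splits_def gok_def)
          then have "len x + len y < i + j" using len_cmp[of x y] \<gamma> by simp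
          then have "a x = 0 \<or> b y = 0" using l by (force simp: level_def)
          then show "(case p of (x, y) \<Rightarrow> a x * b y) = 0" by (auto simp: xy)
        qed
        fix p assume p: "p \<in> gr.splits \<gamma>"
        obtain x y where xy: "p = (x, y)" by (cases p)
        then have s: "x \<in> types" "y \<in> types" "len x + len y = i + j"
          using p \<gamma> by (auto simp: gr.splits_def gok_def)
        \<comment> \<open>Lengths add up to \<open>i + j\<close> here: either they are exactly
          \<open>i\<close> and \<open>j\<close>, where only leading coordinates enter, or one of
          them is too small and both sides vanish.\<close>
        show "(case p of (x, y) \<Rightarrow> a x * b y) = (case p of (x, y) \<Rightarrow> deg_part i f x * deg_part j g y)"
        proof (cases "len x = i")
          case True
          then have "len y = j" using s by simp
          then show ?thesis using True ab s by (simp add: xy GC_def)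
        next
          case False
          then have "len x < i \<or> len y < j" using s by auto
          then have "a x = 0 \<or> b y = 0" using l by (force simp: level_def)
          then show ?thesis using False by (auto simp: xy)
        qed
      qed simp
      finally show "(a \<otimes>\<^bsub>A\<^esub> b) \<gamma> = gr.conv (deg_part i f) (deg_part j g) \<gamma>" by (simp add: gr.conv_def)
    qed
    finally show ?thesis .
  qed
  then show "rcoset_mult A (ideal_power A I (Suc (i + j))) (GC i f) (GC j g) = ?t"
    unfolding rcoset_mult_def a_r_coset_def r_coset_def ideal_power_level
    using deg_part_GC[OF fg(1), of i] deg_part_GC[OF fg(2), of j] by auto
qed

sublocale graded_path_ring types "point_classes P r" src tgt cmp len
  "assoc_graded_ring A I" gr_model.emb "assoc_graded_component A I"
proof (intro graded_path_ring.intro graded_path_ring_axioms.intro length_category_axioms)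
  let ?e = "\<lambda>x. if x \<in> point_classes P r then 1 else (0 :: 'k)"
  have e: "?e \<in> fsupp types"
    using finite_points ob_S by (auto simp: fsupp_def)
  show "convolution_ring types gok cmp (assoc_graded_ring A I) gr_model.emb ?e"
    unfolding assoc_graded_ring_def
  proof (rule gr_model.convolution_ring[OF _ e])
    have "?e \<in> level 0" using e by (simp add: level_def)
    from coset_GC[OF this] show "ideal_power A I 1 +>\<^bsub>A\<^esub> \<one>\<^bsub>A\<^esub> = GC 0 ?e"
      by (simp add: ideal_power_level a_r_coset_def r_coset_def one_A del: ideal_power.simps)
  qed (use ob_S len_0 in \<open>auto split: if_splits\<close>)
  show "assoc_graded_component A I d = gr_model.emb ` {f \<in> fsupp types. \<forall>x. f x \<noteq> 0 \<longrightarrow> len x = d}" for d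
    unfolding assoc_graded_component_def by (rule gr_model.homogeneous_eq)
qed

end

section \<open>Maximal chains and galleries\<close>

context invariant_poset
begin

text \<open>Saturation phrased through heights: a step has height 1 exactly when no point of
  \<open>P\<close> lies strictly inside it. In this form it matches the arrows of length 1.\<close>

fun sat :: "'p \<Rightarrow> 'p list \<Rightarrow> bool" where
  "sat x [] \<longleftrightarrow> True"
| "sat x (z # zs) \<longleftrightarrow> ht x z = 1 \<and> sat z zs"

abbreviation chain_path :: "'p \<Rightarrow> 'p list \<Rightarrow> ('p \<times> 'p) set \<times> ('p \<times> 'p) set list" where
  "chain_path x zs \<equiv> (cls x x, tps x zs)"

lemma sat_append: "sat x (us @ vs) \<longleftrightarrow> sat x us \<and> sat (last (x # us)) vs"
  by (induction us arbitrary: x) auto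

lemma point_in: "x \<in> P \<Longrightarrow> cls x x \<in> point_classes P r"
  by (auto simp: point_classes_eq)

lemma chain_path_paths: "chn x zs y \<Longrightarrow> sat x zs \<Longrightarrow> x \<in> P \<Longrightarrow> chain_path x zs \<in> paths"
proof -
  assume "chn x zs y" "sat x zs" "x \<in> P"
  then have "path_from (cls x x) (tps x zs)"
  proof (induction zs arbitrary: x)
    case (Cons z zs)
    then have "iv x z" by (auto simp: iv_iff)
    with Cons show ?case by (auto simp: point_in cls_types len_cls src_cls tgt_cls)
  qed (simp add: point_in)
  then show ?thesis by (simp add: paths_def)
qed

lemma foldl_tps: "chn x zs y \<Longrightarrow> iv w x \<Longrightarrow> foldl cmp (cls w x) (tps x zs) = cls w y"
proof (induction zs arbitrary: x)
  case (Cons z zs)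
  then have "iv x z" "iv w z" by (auto simp: iv_iff)
  with Cons show ?case by (simp add: cmp_cls)
qed auto

lemma val_chain_path: "chn x zs y \<Longrightarrow> x \<in> P \<Longrightarrow> val (chain_path x zs) = cls x y"
  by (simp add: val_def foldl_tps iv_refl)

text \<open>The first arrow is a left factor of the class of \<open>[x,y]\<close>, so
  \<open>factor_at\<close> turns it into a point \<open>z\<close> of this very interval. The rest is
  a path with the class of \<open>[z,y]\<close> as its value.\<close>

lemma path_as_chain:
  assumes p: "p \<in> paths" and v: "val p = cls x y" and iv: "iv x y"
  obtains zs where "chn x zs y" "sat x zs" "p = chain_path x zs"
proof -
  have f: "fst p = cls x x" using src_val[OF p] v iv by (simp add: src_cls)
  have "\<exists>zs. chn x zs y \<and> sat x zs \<and> tps x zs = as"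
    if "path_from (cls x x) as" "foldl cmp (cls x x) as = cls x y" "iv x y" for as
    using that
  proof (induction as arbitrary: x)
    case Nil
    then have "x = y" using point_cls[of x y x] by (auto simp: iv_iff)
    then show ?case by (intro exI[of _ "[]"]) auto
  next
    case (Cons a as)
    then have a: "a \<in> types" "len a = 1" "src a = cls x x" "path_from (tgt a) as" by auto
    have "cmp (cls x x) a = a" using cmp_src[OF a(1)] a(3) by simp
    then have "cls x y = foldl cmp a as" using Cons.prems(2) by simp
    also have "\<dots> = cmp a (foldl cmp (tgt a) as)" using foldl_cmp_path[OF a(4,1)] by simp
    finally have e: "cmp a (foldl cmp (tgt a) as) = cls x y" by simp
    have b: "foldl cmp (tgt a) as \<in> types" "tgt a = src (foldl cmp (tgt a) as)"
      using foldl_cmp_path[OF a(4,1)] by simp_all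
    from factor_at[OF a(1) b e Cons.prems(3)]
    obtain z where z: "iv x z" "iv z y" "a = cls x z" "foldl cmp (tgt a) as = cls z y" .
    have t: "tgt a = cls z z" using z by (simp add: tgt_cls)
    obtain zs where zs: "chn z zs y" "sat z zs" "tps z zs = as"
      using Cons.IH[of z] a(4) z(2,4) unfolding t by blast
    have "ht x z = 1" using a(2) z by (simp add: len_cls)
    moreover from this have "x < z" using ht_0[OF z(1)] z(1) by (auto simp: iv_iff)
    ultimately show ?case using zs z by (intro exI[of _ "z # zs"]) (auto simp: iv_iff)
  qed
  from this[of "snd p"] obtain zs where "chn x zs y" "sat x zs" "tps x zs = snd p"
    using p v iv f by (auto simp: paths_def val_def)
  with f show thesis by (intro that) (auto simp: prod_eq_iff)
qed

text \<open>The first points have the same type seen from \<open>x\<close>; the remaining types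
  compose to the same class, so they also have the same type seen from \<open>y\<close>. Then
  \<open>unique\<close> makes them equal.\<close>

lemma tps_inj: "chn x zs y \<Longrightarrow> chn x zs' y \<Longrightarrow> x \<in> P \<Longrightarrow> tps x zs = tps x zs' \<Longrightarrow> zs = zs'"
proof (induction zs arbitrary: x zs')
  case Nil
  then show ?case by (metis length_0_conv length_tps)
next
  case (Cons z zs)
  then obtain z' ws where zs': "zs' = z' # ws" by (cases zs') auto
  have c: "chn z zs y" "chn z' ws y" "z \<in> P" "z' \<in> P" "x < z" "x < z'" "cls x z = cls x z'" "tps z zs = tps z' ws"
    using Cons.prems zs' by auto
  have iv: "iv x z" "iv x z'" "iv z y" "iv z' y" using c Cons.prems(3) chn_iv by (auto simp: iv_iff)
  have "cls z z = cls z' z'" using cls_ends(2)[OF c(7) iv(1,2)] .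
  then have "cls z y = cls z' y"
    using foldl_tps[OF c(1) iv_refl[OF c(3)]] foldl_tps[OF c(2) iv_refl[OF c(4)]] c(8) by simp
  then have "z = z'" using unique[OF iv(1,3,2,4) c(7)] by simp
  then show ?case using Cons.IH[of z ws] c zs' by simp
qed


text \<open>A list of \<open>chn\<close> ends in \<open>y\<close>, which is not a vertex of the
  order complex of the open interval; the list is therefore one longer than the face.\<close>

definition face :: "'p \<Rightarrow> 'p list \<Rightarrow> 'p set" where
  "face y zs = set zs - {y}"

lemma chn_comparable: "chn x zs y \<Longrightarrow> x \<in> P \<Longrightarrow> a \<in> set zs \<Longrightarrow> b \<in> set zs \<Longrightarrow> a \<le> b \<or> b \<le> a"
proof (induction zs arbitrary: x)
  case (Cons z zs)
  then have "set zs \<subseteq> {w \<in> P. z < w \<and> w \<le> y}" using chn_set[of z zs y] by auto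
  with Cons show ?case by auto
qed auto

lemma chn_ends: "chn x zs y \<Longrightarrow> x \<noteq> y \<Longrightarrow> y \<in> set zs"
  using chn_last[of x zs y] by (cases zs) (auto split: if_splits)

lemma face_complex: "chn x zs y \<Longrightarrow> x \<in> P \<Longrightarrow> face y zs \<in> order_complex (open_interval P x y)"
  using chn_set[of x zs y] chn_comparable[of x zs y]
  by (auto simp: face_def order_complex_def open_interval_def)

lemma card_face: "chn x zs y \<Longrightarrow> x \<in> P \<Longrightarrow> x \<noteq> y \<Longrightarrow> Suc (card (face y zs)) = length zs"
  using chn_set[of x zs y] chn_ends[of x zs y] length_pos_if_in_set[of y zs]
  by (auto simp: face_def distinct_card card_Diff_singleton)

text \<open>Peel off the least element \<open>m\<close> of the face; the rest is a face of the
  complex of the open interval from \<open>m\<close> to \<open>y\<close>.\<close>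

lemma face_list:
  assumes "F \<in> order_complex (open_interval P x y)" "iv x y" "x \<noteq> y"
  obtains zs where "chn x zs y" "set zs = insert y F" "face y zs = F"
proof -
  have "\<exists>zs. chn x zs y \<and> set zs = insert y F"
    using assms
  proof (induction "card F" arbitrary: F x)
    case 0
    then have "F = {}" by (auto simp: order_complex_def)
    then show ?case using 0 by (intro exI[of _ "[y]"]) (auto simp: iv_iff)
  next
    case (Suc n)
    then have F: "finite F" "F \<noteq> {}" "F \<subseteq> open_interval P x y" "\<And>a b. a \<in> F \<Longrightarrow> b \<in> F \<Longrightarrow> a \<le> b \<or> b \<le> a"
      by (auto simp: order_complex_def)
    obtain m where m: "m \<in> F" "\<And>b. b \<in> F \<Longrightarrow> b \<le> m \<Longrightarrow> m = b"
      using finite_has_minimal[OF F(1,2)] by auto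
    have mp: "m \<in> P" "x < m" "m < y" using m(1) F(3) by (auto simp: open_interval_def)
    have "F - {m} \<in> order_complex (open_interval P m y)"
      using F m by (fastforce simp: order_complex_def open_interval_def)
    moreover have "n = card (F - {m})" using Suc.hyps(2) F(1) m(1) by simp
    moreover have "iv m y" "m \<noteq> y" using mp Suc.prems(2) by (auto simp: iv_iff)
    ultimately obtain zs where "chn m zs y" "set zs = insert y (F - {m})" using Suc.hyps(1) by blast
    then show ?case using mp m(1) by (intro exI[of _ "m # zs"]) auto
  qed
  then obtain zs where "chn x zs y" "set zs = insert y F" by blast
  moreover from this have "face y zs = F" using assms(1) by (auto simp: face_def order_complex_def open_interval_def)
  ultimately show thesis by (rule that)
qed

lemma chn_unique: "chn x zs y \<Longrightarrow> chn x zs' y \<Longrightarrow> x \<in> P \<Longrightarrow> set zs = set zs' \<Longrightarrow> zs = zs'"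
proof (induction zs arbitrary: x zs')
  case (Cons z zs)
  then obtain z' ws where zs': "zs' = z' # ws" by (cases zs') auto
  have 1: "set zs \<subseteq> {w \<in> P. z < w \<and> w \<le> y} \<and> distinct zs" using chn_set[of z zs y] Cons.prems by auto
  have 2: "set ws \<subseteq> {w \<in> P. z' < w \<and> w \<le> y} \<and> distinct ws" using chn_set[of z' ws y] Cons.prems zs' by auto
  have s: "insert z (set zs) = insert z' (set ws)" using Cons.prems(4) zs' by simp
  have zz: "z = z'"
  proof (rule ccontr)
    assume "z \<noteq> z'"
    then have "z \<in> set ws" "z' \<in> set zs" using s by auto
    then have "z' < z" "z < z'" using 1 2 by auto
    then show False by (rule less_asym)
  qed
  then have "set zs = set ws" using s 1 2 by auto
  then show ?case using Cons zs' zz by auto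
qed auto

lemma face_unique:
  assumes "chn x zs y" "chn x zs' y" "x \<in> P" "x \<noteq> y" "face y zs = face y zs'" shows "zs = zs'"
proof (rule chn_unique[OF assms(1-3)])
  show "set zs = set zs'"
    using assms(5) chn_ends[OF assms(1,4)] chn_ends[OF assms(2,4)] by (auto simp: face_def)
qed

lemma ht_1_between: "ht x z = 1 \<Longrightarrow> x \<in> P \<Longrightarrow> b \<in> P \<Longrightarrow> z \<in> P \<Longrightarrow> x < b \<Longrightarrow> b < z \<Longrightarrow> False"
  using length_ht[of x "[b, z]" z] by simp

text \<open>A point comparable with all members of the chain would otherwise fall strictly inside
  one of its steps, which height 1 forbids.\<close>

lemma sat_maximal:
  "chn x zs y \<Longrightarrow> sat x zs \<Longrightarrow> x \<in> P \<Longrightarrow> x < b \<Longrightarrow> b < y \<Longrightarrow> b \<in> P \<Longrightarrow>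
    (\<And>z. z \<in> set zs \<Longrightarrow> b \<le> z \<or> z \<le> b) \<Longrightarrow> b \<in> set zs"
proof (induction zs arbitrary: x)
  case (Cons z zs)
  then have z: "z \<in> P" "ht x z = 1" "b \<le> z \<or> z \<le> b" by auto
  then consider "b = z" | "b < z" | "z < b" by fastforce
  then show ?case
  proof cases
    case 2
    then show ?thesis using ht_1_between[OF z(2) Cons.prems(3,6) z(1) Cons.prems(4)] by simp
  next
    case 3
    then show ?thesis using Cons.IH[of z] Cons.prems z by simp
  qed simp
qed auto

lemma not_sat:
  "chn x zs y \<Longrightarrow> x \<in> P \<Longrightarrow> \<not> sat x zs \<Longrightarrow>
    \<exists>u z v c. zs = u @ z # v \<and> c \<in> P \<and> last (x # u) < c \<and> c < z"
proof (induction zs arbitrary: x)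
  case (Cons z zs)
  show ?case
  proof (cases "ht x z = 1")
    case True
    then obtain u z' v c where *: "zs = u @ z' # v \<and> c \<in> P \<and> last (z # u) < c \<and> c < z'"
      using Cons.IH[of z] Cons.prems by auto
    then show ?thesis by (intro exI[of _ "z # u"] exI[of _ z'] exI[of _ v] exI[of _ c]) auto
  next
    case False
    have iv: "iv x z" using Cons.prems by (auto simp: iv_iff)
    then obtain ws where ws: "chn x ws z" "length ws = ht x z" using ht_attained by blast
    moreover have "ht x z \<noteq> 0" using ht_0[OF iv] Cons.prems by auto
    ultimately have "2 \<le> length ws" using False by simp
    then obtain c c' cs where c: "ws = c # c' # cs"
      by (auto simp: numeral_2_eq_2 Suc_le_length_iff)
    then have "c \<in> P" "x < c" "c < c'" "chn c' cs z" "c' \<in> P" using ws(1) by auto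
    moreover have "c' \<le> z" using chn_iv[OF \<open>chn c' cs z\<close> \<open>c' \<in> P\<close>] by (simp add: iv_iff)
    ultimately show ?thesis by (intro exI[of _ "[]"] exI[of _ z] exI[of _ zs] exI[of _ c]) auto
  qed
qed auto

end

section \<open>Galleries in simplicial complexes and their truncation\<close>

definition gstep :: "'v set set \<Rightarrow> 'v set \<Rightarrow> 'v set \<Rightarrow> bool" where
  "gstep K F G \<longleftrightarrow> F \<in> K \<and> G \<in> K \<and> gallery_step F G"

lemma sequential_galleryI:
  assumes "(gstep K)\<^sup>*\<^sup>* F G" "F \<in> K" shows "sequential_gallery K F G"
  using assms
proof (induction rule: rtranclp_induct)
  case base
  then show ?case unfolding sequential_gallery_def by (intro exI[of _ "[F]"]) auto
next
  case (step G H)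
  then obtain Fs where "Fs \<noteq> []" "hd Fs = F" "last Fs = G" "set Fs \<subseteq> K" "successively gallery_step Fs"
    unfolding sequential_gallery_def by auto
  then show ?case using step.hyps(2)
    unfolding sequential_gallery_def gstep_def
    by (intro exI[of _ "Fs @ [H]"]) (auto simp: successively_append_iff)
qed

lemma gallery_step_cases:
  assumes "gallery_step F G" "finite F" "finite G"
  obtains (replace) a b B where "F = insert a B" "G = insert b B" "a \<notin> B" "b \<notin> B" "a \<noteq> b"
    | (add) b where "G = insert b F" "b \<notin> F"
proof -
  have "card F = card G \<and> card G = Suc (card (F \<inter> G))"
    if "face_dim F = face_dim G" "face_dim G = 1 + face_dim (F \<inter> G)"
    using that unfolding face_dim_def by linarith
  moreover have "card G = Suc (card F)" if "face_dim G = face_dim F + 1"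
    using that unfolding face_dim_def by linarith
  ultimately consider "card F = card G \<and> card G = Suc (card (F \<inter> G))" | "F \<subset> G \<and> card G = Suc (card F)"
    using assms(1) unfolding gallery_step_def by blast
  then show thesis
  proof cases
    case 1
    then have "card (F - G) = 1" "card (G - F) = 1"
      using assms(2,3) by (auto simp: card_Diff_subset_Int Int_commute)
    then obtain a b where "F - G = {a}" "G - F = {b}" by (auto simp: card_1_singleton_iff)
    then show thesis by (intro replace[of a "F \<inter> G" b]) auto
  next
    case 2
    then have "card (G - F) = 1" using assms by (simp add: card_Diff_subset psubset_imp_subset)
    then obtain b where "G - F = {b}" by (auto simp: card_1_singleton_iff)
    with 2 have "G = insert b F" "b \<notin> F" by blast+
    then show thesis by (rule add)
  qed
qed

lemma gallery_step_card: "gallery_step F G \<Longrightarrow> card F \<le> card G"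
  unfolding gallery_step_def face_dim_def by (elim disjE conjE) linarith+

lemma gallery_step_replace: "finite B \<Longrightarrow> a \<notin> B \<Longrightarrow> b \<notin> B \<Longrightarrow> a \<noteq> b \<Longrightarrow> gallery_step (insert a B) (insert b B)"
proof -
  assume *: "finite B" "a \<notin> B" "b \<notin> B" "a \<noteq> b"
  then have "insert a B \<inter> insert b B = B" by auto
  with * show ?thesis by (simp add: gallery_step_def face_dim_def)
qed

lemma gallery_step_add: "finite F \<Longrightarrow> b \<notin> F \<Longrightarrow> gallery_step F (insert b F)"
  by (auto simp: gallery_step_def face_dim_def)

text \<open>
  Galleries may be truncated to faces of a fixed cardinality, because any two faces of that
  cardinality in a common simplex are joined by replacements.
\<close>

locale complex =
  fixes K :: "'v set set"
  assumes finite_face: "F \<in> K \<Longrightarrow> finite F" and subface: "F \<in> K \<Longrightarrow> G \<subseteq> F \<Longrightarrow> G \<in> K"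
begin

definition replacement :: "nat \<Rightarrow> 'v set \<Rightarrow> 'v set \<Rightarrow> bool" where
  "replacement e F G \<longleftrightarrow> gstep K F G \<and> card F = e \<and> card G = e"

lemma replacement_sym: "replacement e F G \<Longrightarrow> replacement e G F"
  by (auto simp: replacement_def gstep_def gallery_step_def face_dim_def Int_commute)

lemma replacements_sym: "(replacement e)\<^sup>*\<^sup>* F G \<Longrightarrow> (replacement e)\<^sup>*\<^sup>* G F"
  by (induction rule: rtranclp_induct) (auto intro: converse_rtranclp_into_rtranclp replacement_sym)

text \<open>Exchange a vertex of \<open>A\<close> outside \<open>B\<close> for a vertex of
  \<open>B\<close> outside \<open>A\<close>; every intermediate set is still a subset of the face
  \<open>F\<close>.\<close>

lemma replacements_simplex:
  "F \<in> K \<Longrightarrow> A \<subseteq> F \<Longrightarrow> B \<subseteq> F \<Longrightarrow> card A = e \<Longrightarrow> card B = e \<Longrightarrow> (replacement e)\<^sup>*\<^sup>* A B"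
proof (induction "card (A - B)" arbitrary: A)
  case 0
  have fin: "finite A" "finite B" using 0 finite_face finite_subset by blast+
  then have "A \<subseteq> B" using 0(1) by auto
  then have "A = B" using fin 0 by (simp add: card_subset_eq)
  then show ?case by simp
next
  case (Suc n)
  have fin: "finite A" "finite B" using Suc.prems finite_face finite_subset by blast+
  obtain a where a: "a \<in> A" "a \<notin> B" using Suc.hyps(2) by (metis Diff_iff card.empty ex_in_conv nat.distinct(1))
  have "\<not> B \<subseteq> A" using a fin Suc.prems by (metis card_subset_eq)
  then obtain b where b: "b \<in> B" "b \<notin> A" by auto
  let ?A = "insert b (A - {a})"
  have A: "A = insert a (A - {a})" using a by auto
  have "card ?A = e" using a b fin Suc.prems by (metis A card_insert_disjoint finite_Diff Diff_iff insertI1)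
  moreover have "gallery_step (insert a (A - {a})) ?A"
    using a b fin by (intro gallery_step_replace) auto
  then have "gallery_step A ?A" using A by simp
  moreover have "A \<in> K" "?A \<in> K" using Suc.prems a b by (auto intro: subface)
  ultimately have s: "replacement e A ?A" using Suc.prems by (simp add: replacement_def gstep_def)
  have "?A - B = A - B - {a}" using b by auto
  then have "n = card (?A - B)" using Suc.hyps(2) a fin by simp
  then have "(replacement e)\<^sup>*\<^sup>* ?A B" using Suc \<open>card ?A = e\<close> b by (intro Suc.hyps(1)) auto
  with s show ?case by (rule converse_rtranclp_into_rtranclp)
qed

lemma gsteps_face: "(gstep K)\<^sup>*\<^sup>* F G \<Longrightarrow> F \<in> K \<Longrightarrow> G \<in> K \<and> card F \<le> card G"
proof (induction rule: rtranclp_induct)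
  case (step G H)
  then have "card G \<le> card H" by (auto simp: gstep_def intro: gallery_step_card)
  with step show ?case by (auto simp: gstep_def)
qed auto

text \<open>Two consecutive faces of a gallery usually share a subset of cardinality
  \<open>e\<close>, through which replacements inside the two simplices pass. The exception is a
  replacement between faces that themselves have cardinality \<open>e\<close>, and it is kept as it
  stands.\<close>

lemma truncate:
  "(gstep K)\<^sup>*\<^sup>* F H \<Longrightarrow> F \<in> K \<Longrightarrow> A \<subseteq> F \<Longrightarrow> card A = e \<Longrightarrow> B \<subseteq> H \<Longrightarrow> card B = e \<Longrightarrow> (replacement e)\<^sup>*\<^sup>* A B"
proof (induction arbitrary: B rule: rtranclp_induct)
  case base
  then show ?case by (intro replacements_simplex[of F])
next
  case (step G H)
  have G: "G \<in> K" "card F \<le> card G" using gsteps_face step by auto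
  have H: "H \<in> K" "gallery_step G H" using step by (auto simp: gstep_def)
  have e: "e \<le> card G" using G step.prems card_mono[OF finite_face[OF step.prems(1)] step.prems(2)] by simp
  have key: ?case if C: "C \<subseteq> G" "C \<subseteq> H" "card C = e" for C
    using step.IH[of C] replacements_simplex[OF H(1), of C B e] step.prems C by (auto intro: rtranclp_trans)
  from H(2) finite_face[OF G(1)] finite_face[OF H(1)] show ?case
  proof (cases rule: gallery_step_cases)
    case (replace a b D)
    have fD: "finite D" using finite_face[OF G(1)] replace by simp
    show ?thesis
    proof (cases "e \<le> card D")
      case True
      then obtain C where "C \<subseteq> D" "card C = e" by (rule obtain_subset_with_card_n)
      then show ?thesis using replace by (intro key[of C]) auto
    next
      case False
      then have c: "card G = e" "card H = e" using e replace fD by auto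
      then have "B = H" using step.prems finite_face[OF H(1)] by (simp add: card_subset_eq)
      moreover have "(replacement e)\<^sup>*\<^sup>* A G" using step.IH[of G] step.prems c by simp
      moreover have "replacement e G H" using c G H by (simp add: replacement_def gstep_def)
      ultimately show ?thesis by simp
    qed
  next
    case (add b)
    obtain C where "C \<subseteq> G" "card C = e" using e by (rule obtain_subset_with_card_n)
    then show ?thesis using add by (intro key[of C]) auto
  qed
qed

lemma replacements_gsteps: "(replacement e)\<^sup>*\<^sup>* F G \<Longrightarrow> (gstep K)\<^sup>*\<^sup>* F G"
  by (rule rtranclp_mono[THEN predicate2D]) (auto simp: replacement_def)

lemma gsteps_subset: "G \<in> K \<Longrightarrow> F \<subseteq> G \<Longrightarrow> (gstep K)\<^sup>*\<^sup>* F G"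
proof (induction "card (G - F)" arbitrary: F)
  case 0
  then show ?case using finite_face[of G] by auto
next
  case (Suc n)
  have fin: "finite G" "finite F" using Suc.prems finite_face finite_subset by blast+
  obtain b where b: "b \<in> G" "b \<notin> F" using Suc.hyps(2) by (metis Diff_iff card.empty ex_in_conv nat.distinct(1))
  have "G - insert b F = (G - F) - {b}" by blast
  then have "n = card (G - insert b F)" using Suc.hyps(2) fin b by simp
  then have "(gstep K)\<^sup>*\<^sup>* (insert b F) G" using Suc.prems b by (intro Suc.hyps(1)) simp_all
  moreover have "gstep K F (insert b F)"
    using subface[OF Suc.prems(1), of F] subface[OF Suc.prems(1), of "insert b F"]
      gallery_step_add[OF fin(2) b(2)] Suc.prems b by (simp add: gstep_def)
  ultimately show ?case by (rule converse_rtranclp_into_rtranclp[rotated])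
qed

text \<open>Galleries lead from \<open>F\<close> and from \<open>G\<close> up to faces of
  cardinality \<open>n\<close>, but none leads back down to \<open>G\<close>. Truncated to
  cardinality \<open>card F\<close>, both become reversible sequences of replacements: from
  \<open>F\<close> to a part of the top face \<open>N\<close>, from there back to a part
  \<open>B\<close> of \<open>G\<close>, and \<open>B\<close> finally grows to
  \<open>G\<close>.\<close>

lemma SGC_I:
  assumes up: "\<And>F. F \<in> K \<Longrightarrow> \<exists>M\<in>K. card M = n \<and> (gstep K)\<^sup>*\<^sup>* F M"
    and top: "\<And>M N. M \<in> K \<Longrightarrow> N \<in> K \<Longrightarrow> card M = n \<Longrightarrow> card N = n \<Longrightarrow> (gstep K)\<^sup>*\<^sup>* M N"
  shows "SGC K"
  unfolding SGC_def
proof (intro ballI impI)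
  fix F G assume F: "F \<in> K" and G: "G \<in> K" and d: "face_dim F \<le> face_dim G"
  obtain M N where M: "M \<in> K" "card M = n" "(gstep K)\<^sup>*\<^sup>* F M" and N: "N \<in> K" "card N = n" "(gstep K)\<^sup>*\<^sup>* G N"
    using up[OF F] up[OF G] by blast
  have FN: "(gstep K)\<^sup>*\<^sup>* F N" using M(3) top[OF M(1) N(1) M(2) N(2)] by (rule rtranclp_trans)
  have "card F \<le> card N" using gsteps_face[OF FN F] by simp
  then obtain C where C: "C \<subseteq> N" "card C = card F" by (rule obtain_subset_with_card_n)
  have "card F \<le> card G" using d by (simp add: face_dim_def)
  then obtain B where B: "B \<subseteq> G" "card B = card F" by (rule obtain_subset_with_card_n)
  have "(replacement (card F))\<^sup>*\<^sup>* F C" using truncate[OF FN F, of F] C by simp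
  moreover have "(replacement (card F))\<^sup>*\<^sup>* B C" using truncate[OF N(3) G B C] .
  ultimately have "(replacement (card F))\<^sup>*\<^sup>* F B" by (meson replacements_sym rtranclp_trans)
  then have "(gstep K)\<^sup>*\<^sup>* F G" using replacements_gsteps gsteps_subset[OF G B(1)] rtranclp_trans by metis
  then show "sequential_gallery K F G" using F by (rule sequential_galleryI)
qed

end

lemma complex_order_complex: "complex (order_complex Q)"
  by unfold_locales (auto simp: order_complex_def intro: finite_subset)

section \<open>Moves of paths and galleries of chains\<close>

context invariant_poset
begin

abbreviation faces :: "'p \<Rightarrow> 'p \<Rightarrow> 'p set set" where
  "faces x y \<equiv> order_complex (open_interval P x y)"

lemma tps_split:
  assumes "tps x zs = as @ \<alpha> # \<beta> # bs"
  obtains u z m v where "zs = u @ z # m # v" "tps x u = as" "\<alpha> = cls (last (x # u)) z" "\<beta> = cls z m" "tps m v = bs"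
proof -
  define u where "u = take (length as) zs"
  have l: "length zs = length as + Suc (Suc (length bs))" using arg_cong[OF assms, of length] by simp
  then obtain z m v where "drop (length as) zs = z # m # v"
    by (metis add_diff_cancel_left' length_Suc_conv length_drop)
  then have zs: "zs = u @ z # m # v" unfolding u_def by (metis append_take_drop_id)
  have "length u = length as" using l by (simp add: u_def)
  then have "tps x u = as \<and> cls (last (x # u)) z # cls z m # tps m v = \<alpha> # \<beta> # bs"
    using assms unfolding zs tps_append by (subst (asm) append_eq_append_conv) auto
  then show thesis using that zs by auto
qed

lemma chn_split:
  assumes "chn x (u @ z # m # v) y" "x \<in> P"
  defines "l \<equiv> last (x # u)"
  shows "chn x u l" "l \<in> P" "z \<in> P" "m \<in> P" "l < z" "z < m" "chn m v y" "iv l z" "iv z m" "iv l m" "m \<le> y"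
proof -
  have c: "chn x u l" "chn l (z # m # v) y" using assms(1) unfolding chn_append l_def by auto
  then have l: "l \<in> P" using chn_iv[OF c(1) assms(2)] by (simp add: iv_iff)
  show "chn x u l" "l \<in> P" "z \<in> P" "m \<in> P" "l < z" "z < m" "chn m v y" "iv l z" "iv z m" "iv l m"
    using c l by (auto simp: iv_iff)
  show "m \<le> y" using c chn_iv[of m v y] by (auto simp: iv_iff)
qed

lemma chn_replace:
  "chn x (u @ z # m # v) y \<Longrightarrow> b \<in> P \<Longrightarrow> last (x # u) < b \<Longrightarrow> b < m \<Longrightarrow> chn x (u @ b # m # v) y"
  unfolding chn_append by auto

lemma sat_replace:
  assumes "chn x (u @ z # m # v) y" "sat x (u @ z # m # v)" "x \<in> P" "b \<in> P" "last (x # u) < b" "b < m"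
    and "ht (last (x # u)) m = 2"
  shows "sat x (u @ b # m # v)"
proof -
  let ?l = "last (x # u)"
  note s = chn_split[OF assms(1,3)]
  have iv: "iv ?l b" "iv b m" using s assms by (auto simp: iv_iff)
  have "ht ?l b + ht b m \<le> 2" using ht_add[OF iv] assms(7) by simp
  moreover have "ht ?l b \<noteq> 0" "ht b m \<noteq> 0" using ht_0[OF iv(1)] ht_0[OF iv(2)] assms(5,6) by auto
  ultimately have "ht ?l b = 1" "ht b m = 1" by linarith+
  then show ?thesis using assms(2) unfolding sat_append by simp
qed

lemma move_replace:
  assumes c: "chn x (u @ z # m # v) y" "sat x (u @ z # m # v)" "x \<in> P" "b \<in> P" "last (x # u) < b" "b < m"
    and h: "ht (last (x # u)) m = 2"
  shows "move (chain_path x (u @ z # m # v)) (chain_path x (u @ b # m # v))"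
proof -
  let ?l = "last (x # u)"
  note s = chn_split[OF c(1,3)]
  have iv: "iv ?l b" "iv b m" using s c by (auto simp: iv_iff)
  have e: "cmp (cls ?l z) (cls z m) = cls ?l m" "cmp (cls ?l b) (cls b m) = cls ?l m"
    using s iv by (auto simp: cmp_cls)
  have l: "len (cls ?l m) = 2" using s h by (simp add: len_cls)
  show ?thesis
    unfolding move_def
  proof (intro conjI)
    show "chain_path x (u @ z # m # v) \<in> paths" "chain_path x (u @ b # m # v) \<in> paths"
      using chain_path_paths[OF c(1-3)] chain_path_paths[OF chn_replace[OF c(1,4-6)] sat_replace[OF c h] c(3)] .
    show "\<exists>us x' y' x'' y'' vs. snd (chain_path x (u @ z # m # v)) = us @ x' # y' # vs \<and>
        snd (chain_path x (u @ b # m # v)) = us @ x'' # y'' # vs \<and> cmp x' y' = cmp x'' y'' \<and> len (cmp x' y') = 2"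
      using e l
      by (intro exI[of _ "tps x u"] exI[of _ "cls ?l z"] exI[of _ "cls z m"] exI[of _ "cls ?l b"]
          exI[of _ "cls b m"] exI[of _ "tps m v"]) (simp add: tps_append)
  qed simp
qed

lemma degenerate_chain_path:
  assumes c: "chn x (u @ z # m # v) y" "sat x (u @ z # m # v)" "x \<in> P" and h: "ht (last (x # u)) m \<noteq> 2"
  shows "degenerate (chain_path x (u @ z # m # v))"
proof -
  let ?l = "last (x # u)"
  note s = chn_split[OF c(1,3)]
  have "len (cmp (cls ?l z) (cls z m)) \<noteq> 2" using s h by (simp add: cmp_cls len_cls)
  then show ?thesis
    unfolding degenerate_def using chain_path_paths[OF c]
    by (intro conjI exI[of _ "tps x u"] exI[of _ "cls ?l z"] exI[of _ "cls z m"] exI[of _ "tps m v"])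
      (auto simp: tps_append)
qed

lemma gstep_replace:
  assumes c: "chn x (u @ z # m # v) y" "chn x (u @ b # m # v) y" "x \<in> P"
  shows "face y (u @ z # m # v) = face y (u @ b # m # v) \<or>
    gstep (faces x y) (face y (u @ z # m # v)) (face y (u @ b # m # v))"
proof (cases "b = z")
  case False
  let ?B = "set (u @ m # v) - {y}"
  note s = chn_split[OF c(1,3)] and s' = chn_split[OF c(2,3)]
  have d: "distinct (u @ z # m # v)" "distinct (u @ b # m # v)" using chn_set c by blast+
  have "z \<noteq> y" "b \<noteq> y" using s(6,11) s'(6) by auto
  then have e: "face y (u @ z # m # v) = insert z ?B" "face y (u @ b # m # v) = insert b ?B"
    by (auto simp: face_def)
  have "gallery_step (insert z ?B) (insert b ?B)"
    using d False by (intro gallery_step_replace) auto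
  then show ?thesis
    using face_complex[OF c(1,3)] face_complex[OF c(2,3)] by (simp add: gstep_def e)
qed simp

lemma gstep_insert:
  assumes c: "chn x (u @ z # v) y" "x \<in> P" and b: "b \<in> P" "last (x # u) < b" "b < z"
  shows "chn x (u @ b # z # v) y" "gstep (faces x y) (face y (u @ z # v)) (face y (u @ b # z # v))"
proof -
  show c': "chn x (u @ b # z # v) y" using c b unfolding chn_append by auto
  have d: "distinct (u @ b # z # v)" using chn_set[OF c' c(2)] by blast
  have "b \<noteq> y" using chn_split[OF c' c(2)] by auto
  then have e: "face y (u @ b # z # v) = insert b (face y (u @ z # v))" "b \<notin> face y (u @ z # v)"
    using d by (auto simp: face_def)
  have "gallery_step (face y (u @ z # v)) (insert b (face y (u @ z # v)))"
    using e(2) by (intro gallery_step_add) (auto simp: face_def)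
  then show "gstep (faces x y) (face y (u @ z # v)) (face y (u @ b # z # v))"
    using face_complex[OF c] face_complex[OF c' c(2)] by (simp add: gstep_def e)
qed

text \<open>In a move the new pair of arrows has the same composite, the class of
  \<open>[l,m]\<close> for the neighbours \<open>l\<close> and \<open>m\<close> of the exchanged
  vertex. By \<open>factor_at\<close> it comes from a point \<open>b\<close> of that interval, so
  the move is a replacement of one vertex.\<close>

lemma linked_faces:
  assumes "linked (chain_path x zs) q" "chn x zs y" "sat x zs" "x \<in> P"
  shows "\<exists>ws. chn x ws y \<and> sat x ws \<and> q = chain_path x ws \<and> (gstep (faces x y))\<^sup>*\<^sup>* (face y zs) (face y ws)"
  using assms(1)
proof (induction rule: rtranclp_induct)
  case base
  then show ?case using assms by blast
next
  case (step q q')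
  then obtain ws where ws: "chn x ws y" "sat x ws" "q = chain_path x ws" "(gstep (faces x y))\<^sup>*\<^sup>* (face y zs) (face y ws)"
    by blast
  from step.hyps(2) obtain as \<alpha> \<beta> \<alpha>' \<beta>' bs where e: "q' \<in> paths" "fst q = fst q'" "snd q = as @ \<alpha> # \<beta> # bs"
      "snd q' = as @ \<alpha>' # \<beta>' # bs" "cmp \<alpha> \<beta> = cmp \<alpha>' \<beta>'" "len (cmp \<alpha> \<beta>) = 2"
    unfolding move_def by blast
  have "tps x ws = as @ \<alpha> # \<beta> # bs" using e(3) ws(3) by simp
  then obtain u z m v where s: "ws = u @ z # m # v" "tps x u = as" "\<alpha> = cls (last (x # u)) z" "\<beta> = cls z m" "tps m v = bs"
    by (rule tps_split)
  let ?l = "last (x # u)"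
  note c = chn_split[OF ws(1)[unfolded s(1)] assms(4)]
  have lm: "cmp \<alpha> \<beta> = cls ?l m" using c s by (simp add: cmp_cls)
  then have h: "ht ?l m = 2" using e(6) c by (simp add: len_cls)
  note t = split_at_two(8-12)[OF e(1,4)]
  have "cmp \<alpha>' \<beta>' = cls ?l m" using lm e(5) by simp
  from factor_at[OF t(1,2,5) this c(10)] obtain b where b: "iv ?l b" "iv b m" "\<alpha>' = cls ?l b" "\<beta>' = cls b m" .
  have "ht ?l b = 1" "ht b m = 1" using t b by (simp_all add: len_cls)
  then have b': "b \<in> P" "?l < b" "b < m" using b ht_0[OF b(1)] ht_0[OF b(2)] by (auto simp: iv_iff)
  let ?ws = "u @ b # m # v"
  have ws': "chn x ?ws y" using chn_replace[OF ws(1)[unfolded s(1)] b'] .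
  have "sat x ?ws" using sat_replace[OF ws(1,2)[unfolded s(1)] assms(4) b' h] .
  moreover have "q' = chain_path x ?ws"
    using e(2,4) ws(3) b s by (auto simp: prod_eq_iff tps_append)
  moreover have "(gstep (faces x y))\<^sup>*\<^sup>* (face y ws) (face y ?ws)"
    using gstep_replace[OF ws(1)[unfolded s(1)] ws' assms(4)] s(1) by auto
  ultimately show ?case using ws' rtranclp_trans[OF ws(4)] by blast
qed

text \<open>No vertex can be added to a saturated chain. If \<open>a\<close> is replaced by
  \<open>b\<close>, saturation of the pieces before and after \<open>a\<close> forces
  \<open>b\<close> into the gap between the neighbours of \<open>a\<close>, and the height of this
  gap decides between a move and a degenerate path.\<close>

lemma gallery_step_chain:
  assumes c: "chn x zs y" "sat x zs" "x \<in> P" "x \<noteq> y"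
    and F: "F \<in> faces x y" "gallery_step (face y zs) F"
  shows "degenerate (chain_path x zs) \<or>
    (\<exists>ws. chn x ws y \<and> sat x ws \<and> face y ws = F \<and> move (chain_path x zs) (chain_path x ws))"
proof -
  have iv: "iv x y" using chn_iv[OF c(1,3)] .
  have y: "y \<in> set zs" using chn_ends[OF c(1,4)] .
  have Fb: "b \<in> P" "x < b" "b < y" if "b \<in> F" for b
    using F(1) that by (auto simp: order_complex_def open_interval_def)
  have Fc: "a \<le> b \<or> b \<le> a" if "a \<in> F" "b \<in> F" for a b
    using F(1) that by (auto simp: order_complex_def)
  have fin: "finite (face y zs)" "finite F" using F(1) by (auto simp: order_complex_def face_def)
  from F(2) fin show ?thesis
  proof (cases rule: gallery_step_cases)
    case (add b)
    have b: "b \<in> F" using add by simp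
    have "b \<in> set zs"
    proof (rule sat_maximal[OF c(1-3) Fb(2,3,1)[OF b]])
      fix z assume "z \<in> set zs"
      then show "b \<le> z \<or> z \<le> b" using Fc[OF b, of z] Fb(3)[OF b] add by (cases "z = y") (auto simp: face_def)
    qed
    then show ?thesis using add Fb(3)[OF b] by (auto simp: face_def)
  next
    case (replace a b B)
    have "b \<in> F" by (simp add: replace(2))
    moreover have "b \<notin> face y zs" using replace(4,5) by (simp add: replace(1))
    ultimately have b: "b \<in> F" "b \<notin> set zs" using Fb(3)[of b] by (auto simp: face_def)
    have "a \<in> face y zs" by (simp add: replace(1))
    then have a: "a \<in> set zs" "a \<noteq> y" by (auto simp: face_def)
    then obtain u v' where "zs = u @ a # v'" by (meson split_list)
    moreover have "v' \<noteq> []" using calculation chn_last[OF c(1)] a(2) by auto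
    ultimately obtain m v where zs: "zs = u @ a # m # v" by (cases v') auto
    let ?l = "last (x # u)"
    note s = chn_split[OF c(1)[unfolded zs] c(3)]
    have d: "distinct zs" using chn_set[OF c(1,3)] by blast
    have comp: "b \<le> z \<or> z \<le> b" if "z \<in> set zs" "z \<noteq> a" for z
    proof (cases "z = y")
      case False
      then have "z \<in> face y zs" using that by (simp add: face_def)
      then have "z \<in> F" using that(2) by (simp add: replace(1,2))
      then show ?thesis using Fc[OF b(1)] by simp
    qed (use Fb(3)[OF b(1)] in auto)
    \<comment> \<open>Otherwise \<open>b\<close> would lie below \<open>?l\<close>, comparable with
      the whole saturated piece \<open>u\<close>, and so would already belong to it.\<close>
    have lb: "?l < b"
    proof (rule ccontr)
      assume nl: "\<not> ?l < b"
      have "u \<noteq> []" using nl Fb(2)[OF b(1)] by auto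
      then have "?l \<in> set u" by simp
      have lz: "?l \<in> set zs" using \<open>?l \<in> set u\<close> unfolding zs by (simp del: last.simps)
      have "?l \<noteq> a" using \<open>?l \<in> set u\<close> d unfolding zs by (auto simp del: last.simps)
      then have "b \<le> ?l \<or> ?l \<le> b" using comp[OF lz] by blast
      moreover have "b \<noteq> ?l" using b(2) lz by metis
      ultimately have "b < ?l" using nl by (metis order_le_less)
      moreover have "sat x u" using c(2) unfolding zs sat_append by simp
      ultimately have "b \<in> set u"
        using sat_maximal[OF s(1) _ c(3) Fb(2)[OF b(1)] _ Fb(1)[OF b(1)]] comp d zs by auto
      then show False using b(2) zs by auto
    qed
    have bm: "b < m"
    proof (rule ccontr)
      assume nm: "\<not> b < m"
      have "b \<le> m \<or> m \<le> b" "b \<noteq> m" using comp[of m] b(2) d zs by auto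
      then have "m < b" using nm by auto
      moreover have "sat m v" using c(2) unfolding zs sat_append by simp
      ultimately have "b \<in> set v"
        using sat_maximal[OF s(7) _ s(4) _ Fb(3,1)[OF b(1)]] comp d zs by auto
      then show False using b(2) zs by auto
    qed
    \<comment> \<open>If the gap has height 2, both new steps have height 1 and the exchange is a
      move. Otherwise the chain at hand is already degenerate.\<close>
    show ?thesis
    proof (cases "ht ?l m = 2")
      case False
      then show ?thesis using degenerate_chain_path[OF c(1,2)[unfolded zs] c(3)] zs by simp
    next
      case True
      let ?ws = "u @ b # m # v"
      have "face y ?ws = insert b (face y zs - {a})"
        using d b Fb(3)[OF b(1)] by (auto simp: face_def zs)
      also have "\<dots> = F" using replace(3) unfolding replace(1,2) by auto
      finally show ?thesis
        using chn_replace[OF c(1)[unfolded zs] Fb(1)[OF b(1)] lb bm]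
          sat_replace[OF c(1,2)[unfolded zs] c(3) Fb(1)[OF b(1)] lb bm True]
          move_replace[OF c(1,2)[unfolded zs] c(3) Fb(1)[OF b(1)] lb bm True] zs by blast
    qed
  qed
qed

text \<open>A gallery is followed by moves as long as no degenerate path turns up; up to that point
  the faces stay saturated chains with the same number of vertices.\<close>

lemma gallery_chain:
  assumes "successively gallery_step Fs" "Fs \<noteq> []" "set Fs \<subseteq> faces x y"
    and "chn x zs y" "sat x zs" "x \<in> P" "x \<noteq> y" "face y zs = hd Fs"
  shows "(\<exists>q. linked (chain_path x zs) q \<and> degenerate q) \<or>
    (\<exists>ws. chn x ws y \<and> face y ws = last Fs \<and> linked (chain_path x zs) (chain_path x ws))"
  using assms
proof (induction Fs arbitrary: zs)
  case (Cons F Fs)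
  show ?case
  proof (cases Fs)
    case Nil
    then show ?thesis using Cons.prems by auto
  next
    case (Cons G Gs)
    then have g: "gallery_step (face y zs) G" "G \<in> faces x y" "successively gallery_step Fs" "set Fs \<subseteq> faces x y"
      using Cons.prems by auto
    from gallery_step_chain[OF Cons.prems(4-7) g(2,1)] show ?thesis
    proof (elim disjE exE conjE)
      assume "degenerate (chain_path x zs)"
      then show ?thesis by blast
    next
      fix ws assume ws: "chn x ws y" "sat x ws" "face y ws = G" "move (chain_path x zs) (chain_path x ws)"
      have "(\<exists>q. linked (chain_path x ws) q \<and> degenerate q) \<or>
          (\<exists>ws'. chn x ws' y \<and> face y ws' = last Fs \<and> linked (chain_path x ws) (chain_path x ws'))"
        using ws Cons g by (intro Cons.IH Cons.prems) auto
      moreover have "last (F # Fs) = last Fs" using Cons by simp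
      ultimately show ?thesis using converse_rtranclp_into_rtranclp[where r = move, OF ws(4)] by metis
    qed
  qed
qed simp

text \<open>A gallery from the face of a saturated chain to that of a chain at least as long either
  meets a degenerate path or consists of moves. Links preserve the number of arrows, which settles
  short paths; longest paths are never linked to degenerate ones, which settles the others.\<close>

lemma SGC_imp_linked:
  assumes "\<forall>(x, y)\<in>intervals P. SGC (interval_complex P x y)"
  shows locally_linked
proof -
  have main: "(\<exists>q. linked (chain_path x zs) q \<and> degenerate q) \<or> linked (chain_path x zs) (chain_path x ws)"
    if c: "iv x y" "x \<noteq> y" "chn x zs y" "sat x zs" "chn x ws y" "length zs \<le> length ws" for x y zs ws
  proof -
    have x: "x \<in> P" using c by (simp add: iv_iff)
    have "SGC (faces x y)" using assms c(1,2) by (auto simp: iv_def interval_complex_def)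
    moreover have "face_dim (face y zs) \<le> face_dim (face y ws)"
      using card_face[OF c(3) x c(2)] card_face[OF c(5) x c(2)] c(6) by (simp add: face_dim_def)
    ultimately have "sequential_gallery (faces x y) (face y zs) (face y ws)"
      using face_complex[OF c(3) x] face_complex[OF c(5) x] by (auto simp: SGC_def)
    then obtain Fs where Fs: "Fs \<noteq> []" "hd Fs = face y zs" "last Fs = face y ws" "set Fs \<subseteq> faces x y"
        "successively gallery_step Fs"
      by (auto simp: sequential_gallery_def)
    from gallery_chain[OF Fs(5,1,4) c(3,4) x c(2) Fs(2)[symmetric]] show ?thesis
    proof (elim disjE exE conjE)
      fix ws' assume w: "chn x ws' y" "face y ws' = last Fs" "linked (chain_path x zs) (chain_path x ws')"
      then have "ws' = ws" using face_unique[OF w(1) c(5) x c(2)] Fs(3) by simp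
      with w show ?thesis by simp
    qed blast
  qed
  show ?thesis
    unfolding locally_linked_def
  proof (intro conjI ballI impI)
    fix p assume p: "p \<in> paths" "plen p < len (val p)"
    obtain x y where xy: "iv x y" "val p = cls x y" using val_S[OF p(1)] by (rule typesE)
    obtain zs where zs: "chn x zs y" "sat x zs" "p = chain_path x zs" using path_as_chain[OF p(1) xy(2,1)] .
    obtain ws where ws: "chn x ws y" "length ws = ht x y" using ht_attained[OF xy(1)] .
    have l: "length zs < length ws" using p(2) xy zs ws by (simp add: len_cls)
    then have "x \<noteq> y" using ws ht_0[OF xy(1)] by auto
    \<comment> \<open>The target is a longest chain, hence strictly longer than \<open>zs\<close>,
      so it cannot be linked to \<open>zs\<close> and a degenerate path must be reached.\<close>
    from main[OF xy(1) this zs(1,2) ws(1)] l zs(3) show "\<exists>q. linked p q \<and> degenerate q"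
      using linked_same(1)[of p "chain_path x ws"] by auto
  next
    fix p q assume pq: "p \<in> paths" "q \<in> paths" "val p = val q \<and> plen p = len (val p) \<and> plen q = len (val p)"
    obtain x y where xy: "iv x y" "val p = cls x y" using val_S[OF pq(1)] by (rule typesE)
    obtain zs where zs: "chn x zs y" "sat x zs" "p = chain_path x zs" using path_as_chain[OF pq(1) xy(2,1)] .
    have vq: "val q = cls x y" using pq(3) xy(2) by simp
    obtain ws where ws: "chn x ws y" "sat x ws" "q = chain_path x ws" using path_as_chain[OF pq(2) vq xy(1)] .
    have l: "length zs = length ws" using pq(3) zs(3) ws(3) by simp
    show "linked p q"
    proof (cases "x = y")
      case True
      have "length zs = 0" using pq(3) zs(3) xy ht_0[OF xy(1)] True by (simp add: len_cls)
      then show ?thesis using l zs ws by simp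
    next
      case False
      have "\<not> degenerate q'" if "linked p q'" for q'
        using degenerate_len[of q'] linked_same(1,2)[OF that] pq(3) by auto
      then show ?thesis using main[OF xy(1) False zs(1,2) ws(1)] l zs(3) ws(3) by auto
    qed
  qed
qed

lemma top_sat: assumes "chn x zs y" "x \<in> P" "length zs = ht x y" shows "sat x zs"
proof (rule ccontr)
  assume "\<not> sat x zs"
  then obtain u z v c where *: "zs = u @ z # v" "c \<in> P" "last (x # u) < c" "c < z"
    using not_sat[OF assms(1,2)] by blast
  have "chn x (u @ c # z # v) y" using gstep_insert(1)[OF _ assms(2) *(2-4)] assms(1) *(1) by blast
  from length_ht[OF this assms(2)] show False using assms(3) * by simp
qed

text \<open>A chain that is not saturated gains a vertex at once. A saturated chain shorter than the
  height is linked to a degenerate one, where a gap around one vertex is large enough to hold two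
  vertices after that vertex is exchanged.\<close>

lemma linked_imp_up:
  assumes L: locally_linked and iv: "iv x y" "x \<noteq> y"
  shows "chn x zs y \<Longrightarrow> \<exists>ws. chn x ws y \<and> length ws = ht x y \<and> (gstep (faces x y))\<^sup>*\<^sup>* (face y zs) (face y ws)"
proof (induction "ht x y - length zs" arbitrary: zs rule: less_induct)
  case (less zs)
  have x: "x \<in> P" using iv by (simp add: iv_iff)
  have extend: ?case if us: "chn x us y" "length us = Suc (length zs)" "(gstep (faces x y))\<^sup>*\<^sup>* (face y zs) (face y us)" for us
  proof -
    have "length us \<le> ht x y" using length_ht[OF us(1) x] .
    then have "ht x y - length us < ht x y - length zs" using us(2) by simp
    from less.hyps[OF this us(1)] show ?thesis using us(3) by (meson rtranclp_trans)
  qed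
  show ?case
  proof (cases "length zs = ht x y")
    case True
    then show ?thesis using less.prems by blast
  next
    case False
    then have l: "length zs < ht x y" using length_ht[OF less.prems x] by simp
    show ?thesis
    proof (cases "sat x zs")
      case ns: False
      obtain u z v c where *: "zs = u @ z # v" "c \<in> P" "last (x # u) < c" "c < z"
        using not_sat[OF less.prems x ns] by blast
      have "chn x (u @ c # z # v) y" "gstep (faces x y) (face y zs) (face y (u @ c # z # v))"
        using gstep_insert[OF _ x *(2-4), of v y] less.prems *(1) by auto
      then show ?thesis using *(1) by (intro extend) auto
    next
      case True
      have "chain_path x zs \<in> paths" "plen (chain_path x zs) < len (val (chain_path x zs))"
        using chain_path_paths[OF less.prems True x] l val_chain_path[OF less.prems x] iv by (auto simp: len_cls)
      then obtain q where q: "linked (chain_path x zs) q" "degenerate q"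
        using L by (auto simp: locally_linked_def)
      obtain ws where ws: "chn x ws y" "sat x ws" "q = chain_path x ws" "(gstep (faces x y))\<^sup>*\<^sup>* (face y zs) (face y ws)"
        using linked_faces[OF q(1) less.prems True x] by blast
      have lw: "length ws = length zs" using linked_same(1)[OF q(1)] ws(3) by simp
      obtain as \<alpha> \<beta> bs where d: "tps x ws = as @ \<alpha> # \<beta> # bs" "len (cmp \<alpha> \<beta>) \<noteq> 2"
        using q(2) ws(3) by (auto simp: degenerate_def)
      obtain u z m v where s: "ws = u @ z # m # v" "\<alpha> = cls (last (x # u)) z" "\<beta> = cls z m"
        using tps_split[OF d(1)] by metis
      let ?l = "last (x # u)"
      note c = chn_split[OF ws(1)[unfolded s(1)] x]
      have "ht ?l m \<noteq> 2" using d(2) c s by (simp add: cmp_cls len_cls)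
      moreover have "ht ?l z + ht z m \<le> ht ?l m" by (rule ht_add[OF c(8,9)])
      moreover have "ht ?l z \<noteq> 0" "ht z m \<noteq> 0" using c ht_0 by auto
      ultimately have h: "3 \<le> ht ?l m" by linarith
      obtain cs where cs: "chn ?l cs m" "length cs = ht ?l m" using ht_attained[OF c(10)] .
      then have "3 \<le> length cs" using h by linarith
      then obtain c1 c2 c3 ds where "cs = c1 # c2 # c3 # ds"
        by (auto simp: numeral_3_eq_3 Suc_le_length_iff)
      then have k: "c1 \<in> P" "c2 \<in> P" "?l < c1" "c1 < c2" "c2 < c3" "c3 \<in> P" "chn c3 ds m" using cs(1) by auto
      then have "c2 < m" using chn_iv[OF k(7,6)] by (auto simp: iv_iff)
      \<comment> \<open>A longest chain from \<open>?l\<close> to \<open>m\<close> has at least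
        three steps; \<open>c1\<close> and \<open>c2\<close> are its first two points after
        \<open>?l\<close>. Exchanging \<open>z\<close> for \<open>c1\<close> leaves room for
        \<open>c2\<close> below \<open>m\<close>.\<close>
      let ?ws1 = "u @ c1 # m # v" and ?ws2 = "(u @ [c1]) @ c2 # m # v"
      have w1: "chn x ?ws1 y"
        using chn_replace[OF ws(1)[unfolded s(1)] k(1,3)] k(4) \<open>c2 < m\<close> by simp
      have g1: "(gstep (faces x y))\<^sup>*\<^sup>* (face y ws) (face y ?ws1)"
        using gstep_replace[OF ws(1)[unfolded s(1)] w1 x] s(1) by auto
      have w2: "chn x ?ws2 y" "gstep (faces x y) (face y ?ws1) (face y ?ws2)"
        using gstep_insert[of x "u @ [c1]" m v y c2] w1 x k(2,4) \<open>c2 < m\<close> by auto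
      have "(gstep (faces x y))\<^sup>*\<^sup>* (face y zs) (face y ?ws2)"
        using ws(4) g1 w2(2) by (meson rtranclp.rtrancl_into_rtrancl rtranclp_trans)
      then show ?thesis using w2(1) lw s(1) by (intro extend[of ?ws2]) auto
    qed
  qed
qed

lemma linked_imp_SGC:
  assumes L: locally_linked and xy: "(x, y) \<in> intervals P"
  shows "SGC (interval_complex P x y)"
proof (cases "x = y")
  case True
  then show ?thesis by (simp add: interval_complex_def SGC_def)
next
  case False
  have iv: "iv x y" using xy by (simp add: iv_def)
  then have x: "x \<in> P" by (simp add: iv_iff)
  interpret complex "faces x y" by (rule complex_order_complex)
  have "SGC (faces x y)"
  proof (rule SGC_I)
    fix F assume "F \<in> faces x y"
    then obtain zs where zs: "chn x zs y" "face y zs = F" using face_list[OF _ iv False] by metis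
    obtain ws where ws: "chn x ws y" "length ws = ht x y" "(gstep (faces x y))\<^sup>*\<^sup>* (face y zs) (face y ws)"
      using linked_imp_up[OF L iv False zs(1)] by blast
    have "card (face y ws) = ht x y - 1" using card_face[OF ws(1) x False] ws(2) by simp
    then show "\<exists>M\<in>faces x y. card M = ht x y - 1 \<and> (gstep (faces x y))\<^sup>*\<^sup>* F M"
      using ws zs face_complex[OF ws(1) x] by blast
  next
    fix M N assume M: "M \<in> faces x y" "card M = ht x y - 1" and N: "N \<in> faces x y" "card N = ht x y - 1"
    obtain zs where zs: "chn x zs y" "face y zs = M" using face_list[OF M(1) iv False] by metis
    obtain ws where ws: "chn x ws y" "face y ws = N" using face_list[OF N(1) iv False] by metis
    \<comment> \<open>Excludes truncation in \<open>ht x y - 1\<close>, so the cardinality of a face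
      determines the length of its chain.\<close>
    have h: "ht x y \<noteq> 0" using ht_0[OF iv] False by simp
    have lz: "length zs = ht x y" "length ws = ht x y"
      using card_face[OF zs(1) x False] card_face[OF ws(1) x False] zs ws M N h by auto
    have s: "sat x zs" "sat x ws" using top_sat zs ws x lz by auto
    have "linked (chain_path x zs) (chain_path x ws)"
      using L chain_path_paths[OF zs(1) s(1) x] chain_path_paths[OF ws(1) s(2) x] lz iv
        val_chain_path[OF zs(1) x] val_chain_path[OF ws(1) x]
      unfolding locally_linked_def by (simp add: len_cls)
    from linked_faces[OF this zs(1) s(1) x] obtain ws' where ws': "chn x ws' y" "sat x ws'"
        "chain_path x ws = chain_path x ws'" "(gstep (faces x y))\<^sup>*\<^sup>* M (face y ws')"
      unfolding zs(2) by blast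
    \<comment> \<open>The moves end at some chain with the path of \<open>ws\<close>; a chain
      between fixed end points is determined by its path.\<close>
    have "ws' = ws" using tps_inj[OF ws'(1) ws(1) x] ws'(3) by simp
    then show "(gstep (faces x y))\<^sup>*\<^sup>* M N" using ws'(4) ws(2) by simp
  qed
  then show ?thesis using False by (simp add: interval_complex_def)
qed

end

theorem theorem6p8:
  fixes P :: "'p::order set"
    and r :: "(('p \<times> 'p) \<times> ('p \<times> 'p)) set"
    and A :: "(('p \<times> 'p) set \<Rightarrow> 'k::field) ring"
    and I :: "(('p \<times> 'p) set \<Rightarrow> 'k) set"
  assumes "interval_finite P"
    and "equiv (intervals P) r"
    and "order_compatible r"
    and "interval_invariant P r"
    and "finite (point_classes P r)"
    and "concatenation_closed P r"
    and "A = reduced_incidence_algebra P r"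
    and "I = incidence_ideal P r"
  shows "quadratic_ring (assoc_graded_ring A I) (assoc_graded_component A I) \<longleftrightarrow>
         (\<forall>(x, y) \<in> intervals P. SGC (interval_complex P x y))"
proof -
  interpret incidence_ring P r A I
    by (intro incidence_ring.intro invariant_poset.intro incidence_ring_axioms.intro assms)
  show ?thesis
    unfolding quadratic_iff using SGC_imp_linked linked_imp_SGC by blast
qed

end
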